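(* Let $\kappa$ be an infinite cardinal and let $M$ be a complete $\tau$-structure having a dense subset of cardinality at most $\kappa$. Then there exists a charge space $(I,\mathscr A,\wp)$ such that $M$ is $\mathscr A$-meanable and $M^{\wp}$ is (linearly) $\kappa^+$-saturated.
   Context: Logic. A modulus is an increasing continuous concave function $\lambda:[0,\infty)\to[0,\infty)$ with $\lambda(0)=0$; a map $f$ between metric spaces is $\lambda$-continuous if $d(f(x),f(y))\le\lambda(d(x,y))$ for all $x,y$. A signature $\tau$ is a set of function, relation and constant symbols; each function symbol $F$ has a modulus $\lambda_F$, each relation symbol $R$ has a modulus $\lambda_R$ and a bound $\mathbf b_R\ge0$; $\tau$ contains a distinguished binary relation symbol $d$ with $\mathbf b_d=1$. A $\tau$-structure is a (not necessarily complete) metric space $(M,d)$ with $d$ interpreted as the metric (so diameter $\le1$), each $F^M:M^n\to M$ being $\lambda_F$-continuous, each $R^M:M^n\to\mathbb R$ being $\lambda_R$-continuous with $|R^M|\le\mathbf b_R$, where $M^n$ carries the metric $\sum_{i=1}^n d(x_i,y_i)$. Linear formulas are built inductively from $r$ ($r\in\mathbb R$), $d(t_1,t_2)$, $R(t_1,\dots,t_n)$ ($t_i$ terms) by $r\phi$, $\phi+\psi$, $\sup_x\phi$, $\inf_x\phi$, and evaluated in the obvious way. A linear condition is $\phi\le\psi$ with $\phi,\psi$ linear formulas. Types. For $A\subseteq N$, let $T_A$ be the set of all closed linear conditions with parameters from $A$ true in $N$. An element of $S_n(A)$ (a linear $n$-type over $A$) is a maximal set $p(\bar x)$ of linear conditions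 $\phi(\bar x)\le\psi(\bar x)$, $|\bar x|=n$, with parameters in $A$ such that $T_A\cup p(\bar x)$ is satisfied by some tuple in some model of $T_A$. It is realized in $N$ if some $\bar a\in N^n$ satisfies all its conditions. $N$ is (linearly) $\kappa$-saturated if every $p\in S_1(A)$ is realized in $N$ whenever $A\subseteq N$ and $|A|<\kappa$. Charges. A charge space $(I,\mathscr A,\mu)$ consists of a set $I$, a Boolean algebra $\mathscr A$ of subsets of $I$ and a finitely additive $\mu:\mathscr A\to[0,\infty)$ with $\mu(I)=1$. Integrals of bounded functions $f:I\to\mathbb R$ with $f^{-1}([u,v))\in\mathscr A$ for all $u<v$ are defined as usual (uniform limits of simple functions). Powermean. $M$ is $\mathscr A$-meanable if for some cardinal $\kappa$ the metric space $M$ has a dense subset of cardinality $\le\kappa$ and $\mathscr A$ is $\kappa^+$-complete (closed under unions of at most $\kappa$ members). A map $a:I\to M$ is measurable if $a^{-1}(X)\in\mathscr A$ for every Borel $X\subseteq M$. If $M$ is $\mathscr A$-meanable, $M^\mu$ is the set of classes $[a_i]$ of measurable maps $a=(a_i)_{i\in I}$ modulo $a\sim b\iff\int d(a_i,b_i)\,d\mu=0$, with metric $d([a_i],[b_i])=\int d(a_i,b_i)\,d\mu$, $c^{M^\mu}=[c^M]$, $F^{M^\mu}([a_i],\dots)=[F^M(a_i,\dots)]$, $R^{M^\mu}([a_i],\dots)=\int R^M(a_i,\dots)\,d\mu$; it is a $\tau$-structure. *)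

theory Defs
  imports "HOL-Analysis.Analysis"
begin

unbundle cardinal_syntax

section \<open>Signatures and structures\<close>

definition modulus :: "(real \<Rightarrow> real) \<Rightarrow> bool" where
  "modulus l \<longleftrightarrow> mono_on {0..} l \<and> continuous_on {0..} l \<and> concave_on {0..} l
     \<and> (\<forall>t\<ge>0. 0 \<le> l t) \<and> l 0 = 0"

record ('f, 'r, 'c) signature =
  fsyms :: "'f set"
  rsyms :: "'r set"
  csyms :: "'c set"
  farity :: "'f \<Rightarrow> nat"
  rarity :: "'r \<Rightarrow> nat"
  fmod :: "'f \<Rightarrow> real \<Rightarrow> real"
  rmod :: "'r \<Rightarrow> real \<Rightarrow> real"
  rbound :: "'r \<Rightarrow> real"
  dsym :: 'r

definition signature :: "('f, 'r, 'c) signature \<Rightarrow> bool" where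
  "signature \<tau> \<longleftrightarrow>
     (\<forall>F\<in>fsyms \<tau>. modulus (fmod \<tau> F)) \<and>
     (\<forall>R\<in>rsyms \<tau>. modulus (rmod \<tau> R) \<and> 0 \<le> rbound \<tau> R) \<and>
     dsym \<tau> \<in> rsyms \<tau> \<and> rarity \<tau> (dsym \<tau>) = 2 \<and> rbound \<tau> (dsym \<tau>) = 1"

record ('x, 'f, 'r, 'c) mstruct =
  points :: "'x set"
  fint :: "'f \<Rightarrow> 'x list \<Rightarrow> 'x"
  rint :: "'r \<Rightarrow> 'x list \<Rightarrow> real"
  cint :: "'c \<Rightarrow> 'x"

text \<open>The metric is the interpretation of the distinguished symbol.  It is set to 0 off the
  universe because the library locale \<open>Metric_space\<close> wants nonnegativity and symmetry on the whole
  type; this way no condition is imposed on values of \<open>rint\<close> outside the universe.\<close>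

definition sdist :: "('f, 'r, 'c) signature \<Rightarrow> ('x, 'f, 'r, 'c) mstruct \<Rightarrow> 'x \<Rightarrow> 'x \<Rightarrow> real" where
  "sdist \<tau> S x y = (if x \<in> points S \<and> y \<in> points S then rint S (dsym \<tau>) [x, y] else 0)"

definition tuples :: "('x, 'f, 'r, 'c) mstruct \<Rightarrow> nat \<Rightarrow> 'x list set" where
  "tuples S n = {xs. length xs = n \<and> set xs \<subseteq> points S}"

definition tdist :: "('f, 'r, 'c) signature \<Rightarrow> ('x, 'f, 'r, 'c) mstruct \<Rightarrow> 'x list \<Rightarrow> 'x list \<Rightarrow> real"
  where "tdist \<tau> S xs ys = (\<Sum>i<length xs. sdist \<tau> S (xs ! i) (ys ! i))"

text \<open>As usual in model theory, structures are nonempty.\<close>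

definition tau_structure :: "('f, 'r, 'c) signature \<Rightarrow> ('x, 'f, 'r, 'c) mstruct \<Rightarrow> bool" where
  "tau_structure \<tau> S \<longleftrightarrow>
     points S \<noteq> {} \<and> Metric_space (points S) (sdist \<tau> S) \<and>
     (\<forall>c\<in>csyms \<tau>. cint S c \<in> points S) \<and>
     (\<forall>F\<in>fsyms \<tau>. \<forall>xs\<in>tuples S (farity \<tau> F).
        fint S F xs \<in> points S \<and>
        (\<forall>ys\<in>tuples S (farity \<tau> F).
           sdist \<tau> S (fint S F xs) (fint S F ys) \<le> fmod \<tau> F (tdist \<tau> S xs ys))) \<and>
     (\<forall>R\<in>rsyms \<tau>. \<forall>xs\<in>tuples S (rarity \<tau> R).
        \<bar>rint S R xs\<bar> \<le> rbound \<tau> R \<and>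
        (\<forall>ys\<in>tuples S (rarity \<tau> R).
           \<bar>rint S R xs - rint S R ys\<bar> \<le> rmod \<tau> R (tdist \<tau> S xs ys)))"

definition complete_structure ::
    "('f, 'r, 'c) signature \<Rightarrow> ('x, 'f, 'r, 'c) mstruct \<Rightarrow> bool" where
  "complete_structure \<tau> S \<longleftrightarrow> Metric_space.mcomplete (points S) (sdist \<tau> S)"

abbreviation stopology ::
    "('f, 'r, 'c) signature \<Rightarrow> ('x, 'f, 'r, 'c) mstruct \<Rightarrow> 'x topology" where
  "stopology \<tau> S \<equiv> Metric_space.mtopology (points S) (sdist \<tau> S)"

definition has_dense_subset ::
    "('f, 'r, 'c) signature \<Rightarrow> ('x, 'f, 'r, 'c) mstruct \<Rightarrow> 'k rel \<Rightarrow> bool" where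
  "has_dense_subset \<tau> S k \<longleftrightarrow>
     (\<exists>D. D \<subseteq> points S \<and> stopology \<tau> S closure_of D = points S \<and> |D| \<le>o k)"

section \<open>Linear formulas\<close>

text \<open>\<open>Par a\<close> is the constant symbol naming a parameter \<open>a\<close>; it is interpreted by a separate map.
  Since \<open>d\<close> is one of the relation symbols, \<open>d(s,t)\<close> is \<open>Rel (dsym \<tau>) [s, t]\<close>.\<close>

datatype ('f, 'c, 'a) trm = Var nat | Con 'c | Par 'a | App 'f "('f, 'c, 'a) trm list"

datatype ('f, 'r, 'c, 'a) form =
    Const real
  | Rel 'r "('f, 'c, 'a) trm list"
  | Scale real "('f, 'r, 'c, 'a) form"
  | Plus "('f, 'r, 'c, 'a) form" "('f, 'r, 'c, 'a) form"
  | QSup nat "('f, 'r, 'c, 'a) form"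
  | QInf nat "('f, 'r, 'c, 'a) form"

primrec trm_over :: "('f, 'r, 'c) signature \<Rightarrow> 'a set \<Rightarrow> ('f, 'c, 'a) trm \<Rightarrow> bool" where
  "trm_over \<tau> A (Var n) \<longleftrightarrow> True"
| "trm_over \<tau> A (Con c) \<longleftrightarrow> c \<in> csyms \<tau>"
| "trm_over \<tau> A (Par a) \<longleftrightarrow> a \<in> A"
| "trm_over \<tau> A (App F ts) \<longleftrightarrow>
     F \<in> fsyms \<tau> \<and> length ts = farity \<tau> F \<and> list_all id (map (trm_over \<tau> A) ts)"

primrec form_over :: "('f, 'r, 'c) signature \<Rightarrow> 'a set \<Rightarrow> ('f, 'r, 'c, 'a) form \<Rightarrow> bool" where
  "form_over \<tau> A (Const r) \<longleftrightarrow> True"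
| "form_over \<tau> A (Rel R ts) \<longleftrightarrow>
     R \<in> rsyms \<tau> \<and> length ts = rarity \<tau> R \<and> list_all (trm_over \<tau> A) ts"
| "form_over \<tau> A (Scale r \<phi>) \<longleftrightarrow> form_over \<tau> A \<phi>"
| "form_over \<tau> A (Plus \<phi> \<psi>) \<longleftrightarrow> form_over \<tau> A \<phi> \<and> form_over \<tau> A \<psi>"
| "form_over \<tau> A (QSup x \<phi>) \<longleftrightarrow> form_over \<tau> A \<phi>"
| "form_over \<tau> A (QInf x \<phi>) \<longleftrightarrow> form_over \<tau> A \<phi>"

primrec tvars :: "('f, 'c, 'a) trm \<Rightarrow> nat set" where
  "tvars (Var n) = {n}"
| "tvars (Con c) = {}"
| "tvars (Par a) = {}"
| "tvars (App F ts) = \<Union> (set (map tvars ts))"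

primrec fvars :: "('f, 'r, 'c, 'a) form \<Rightarrow> nat set" where
  "fvars (Const r) = {}"
| "fvars (Rel R ts) = (\<Union>t\<in>set ts. tvars t)"
| "fvars (Scale r \<phi>) = fvars \<phi>"
| "fvars (Plus \<phi> \<psi>) = fvars \<phi> \<union> fvars \<psi>"
| "fvars (QSup x \<phi>) = fvars \<phi> - {x}"
| "fvars (QInf x \<phi>) = fvars \<phi> - {x}"

primrec tval ::
    "('x, 'f, 'r, 'c) mstruct \<Rightarrow> ('a \<Rightarrow> 'x) \<Rightarrow> (nat \<Rightarrow> 'x) \<Rightarrow> ('f, 'c, 'a) trm \<Rightarrow> 'x" where
  "tval S \<pi> v (Var n) = v n"
| "tval S \<pi> v (Con c) = cint S c"
| "tval S \<pi> v (Par a) = \<pi> a"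
| "tval S \<pi> v (App F ts) = fint S F (map (tval S \<pi> v) ts)"

primrec fval ::
    "('x, 'f, 'r, 'c) mstruct \<Rightarrow> ('a \<Rightarrow> 'x) \<Rightarrow> (nat \<Rightarrow> 'x) \<Rightarrow> ('f, 'r, 'c, 'a) form \<Rightarrow> real" where
  "fval S \<pi> v (Const r) = r"
| "fval S \<pi> v (Rel R ts) = rint S R (map (tval S \<pi> v) ts)"
| "fval S \<pi> v (Scale r \<phi>) = r * fval S \<pi> v \<phi>"
| "fval S \<pi> v (Plus \<phi> \<psi>) = fval S \<pi> v \<phi> + fval S \<pi> v \<psi>"
| "fval S \<pi> v (QSup x \<phi>) = (SUP a\<in>points S. fval S \<pi> (v(x := a)) \<phi>)"
| "fval S \<pi> v (QInf x \<phi>) = (INF a\<in>points S. fval S \<pi> (v(x := a)) \<phi>)"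

text \<open>A pair \<open>(\<phi>, \<psi>)\<close> stands for the linear condition \<open>\<phi> \<le> \<psi>\<close>.\<close>

type_synonym ('f, 'r, 'c, 'a) cond = "('f, 'r, 'c, 'a) form \<times> ('f, 'r, 'c, 'a) form"

text \<open>The conditions with parameters in \<open>A\<close> in the free variables \<open>Var 0, ..., Var (n - 1)\<close>.\<close>

definition conds ::
    "('f, 'r, 'c) signature \<Rightarrow> 'a set \<Rightarrow> nat \<Rightarrow> ('f, 'r, 'c, 'a) cond set" where
  "conds \<tau> A n = {(\<phi>, \<psi>). form_over \<tau> A \<phi> \<and> form_over \<tau> A \<psi> \<and> fvars \<phi> \<union> fvars \<psi> \<subseteq> {..<n}}"

definition sat ::
    "('x, 'f, 'r, 'c) mstruct \<Rightarrow> ('a \<Rightarrow> 'x) \<Rightarrow> 'x list \<Rightarrow> ('f, 'r, 'c, 'a) cond \<Rightarrow> bool" where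
  "sat S \<pi> xs = (\<lambda>(\<phi>, \<psi>). fval S \<pi> ((!) xs) \<phi> \<le> fval S \<pi> ((!) xs) \<psi>)"

section \<open>Types and saturation\<close>

definition thy_over ::
    "('f, 'r, 'c) signature \<Rightarrow> ('a, 'f, 'r, 'c) mstruct \<Rightarrow> 'a set \<Rightarrow> ('f, 'r, 'c, 'a) cond set" where
  "thy_over \<tau> N A = {c \<in> conds \<tau> A 0. sat N (\<lambda>a. a) [] c}"

text \<open>A model of a theory with parameters from \<open>A\<close> is a structure together with an
  interpretation \<open>\<pi>\<close> of the parameters.\<close>

definition model_of ::
    "('f, 'r, 'c) signature \<Rightarrow> 'a set \<Rightarrow> ('f, 'r, 'c, 'a) cond set
      \<Rightarrow> ('x, 'f, 'r, 'c) mstruct \<Rightarrow> ('a \<Rightarrow> 'x) \<Rightarrow> bool" where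
  "model_of \<tau> A T K \<pi> \<longleftrightarrow> tau_structure \<tau> K \<and> \<pi> ` A \<subseteq> points K \<and> (\<forall>c\<in>T. sat K \<pi> [] c)"

definition satisfied_in ::
    "('f, 'r, 'c) signature \<Rightarrow> ('a, 'f, 'r, 'c) mstruct \<Rightarrow> 'a set \<Rightarrow> nat
      \<Rightarrow> ('f, 'r, 'c, 'a) cond set \<Rightarrow> ('x, 'f, 'r, 'c) mstruct \<Rightarrow> ('a \<Rightarrow> 'x) \<Rightarrow> bool" where
  "satisfied_in \<tau> N A n p K \<pi> \<longleftrightarrow>
     model_of \<tau> A (thy_over \<tau> N A) K \<pi> \<and>
     (\<exists>xs\<in>tuples K n. \<forall>c\<in>thy_over \<tau> N A \<union> p. sat K \<pi> xs c)"

text \<open>A definition cannot quantify over all types, so the universe of the model has to be a set in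
  some fixed type.  The type of formulas with parameters is large enough that nothing is lost: by the
  downward Loewenheim-Skolem argument in lemma \<open>satisfiable_over_if_satisfied_in\<close> below, a set of
  conditions that is satisfied in a model of any type is satisfied in a model of this type
  (structures need not be complete).\<close>

definition satisfiable_over ::
    "('f, 'r, 'c) signature \<Rightarrow> ('a, 'f, 'r, 'c) mstruct \<Rightarrow> 'a set \<Rightarrow> nat
      \<Rightarrow> ('f, 'r, 'c, 'a) cond set \<Rightarrow> bool" where
  "satisfiable_over \<tau> N A n p \<longleftrightarrow>
     (\<exists>(K :: (('f, 'r, 'c, 'a) form, 'f, 'r, 'c) mstruct) \<pi>. satisfied_in \<tau> N A n p K \<pi>)"

definition lin_types ::
    "('f, 'r, 'c) signature \<Rightarrow> ('a, 'f, 'r, 'c) mstruct \<Rightarrow> nat \<Rightarrow> 'a set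
      \<Rightarrow> ('f, 'r, 'c, 'a) cond set set" where
  "lin_types \<tau> N n A =
     {p. p \<subseteq> conds \<tau> A n \<and> satisfiable_over \<tau> N A n p \<and>
         (\<forall>q. q \<subseteq> conds \<tau> A n \<and> satisfiable_over \<tau> N A n q \<and> p \<subseteq> q \<longrightarrow> q = p)}"

definition realized_in ::
    "('a, 'f, 'r, 'c) mstruct \<Rightarrow> nat \<Rightarrow> ('f, 'r, 'c, 'a) cond set \<Rightarrow> bool" where
  "realized_in N n p \<longleftrightarrow> (\<exists>xs\<in>tuples N n. \<forall>c\<in>p. sat N (\<lambda>a. a) xs c)"

definition saturated ::
    "('f, 'r, 'c) signature \<Rightarrow> ('a, 'f, 'r, 'c) mstruct \<Rightarrow> 'k rel \<Rightarrow> bool" where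
  "saturated \<tau> N k \<longleftrightarrow>
     (\<forall>A. A \<subseteq> points N \<and> |A| <o k \<longrightarrow> (\<forall>p\<in>lin_types \<tau> N 1 A. realized_in N 1 p))"

section \<open>Charges and powermeans\<close>

definition charge_space :: "'i set \<Rightarrow> 'i set set \<Rightarrow> ('i set \<Rightarrow> real) \<Rightarrow> bool" where
  "charge_space I \<A> \<mu> \<longleftrightarrow>
     algebra I \<A> \<and> (\<forall>X\<in>\<A>. 0 \<le> \<mu> X) \<and> additive \<A> \<mu> \<and> \<mu> I = 1"

definition charge_simple :: "'i set \<Rightarrow> 'i set set \<Rightarrow> ('i \<Rightarrow> real) \<Rightarrow> bool" where
  "charge_simple I \<A> s \<longleftrightarrow> finite (s ` I) \<and> (\<forall>y. {i \<in> I. s i = y} \<in> \<A>)"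

definition simple_charge_integral :: "'i set \<Rightarrow> ('i set \<Rightarrow> real) \<Rightarrow> ('i \<Rightarrow> real) \<Rightarrow> real" where
  "simple_charge_integral I \<mu> s = (\<Sum>y\<in>s ` I. y * \<mu> {i \<in> I. s i = y})"

definition has_charge_integral ::
    "'i set \<Rightarrow> 'i set set \<Rightarrow> ('i set \<Rightarrow> real) \<Rightarrow> ('i \<Rightarrow> real) \<Rightarrow> real \<Rightarrow> bool" where
  "has_charge_integral I \<A> \<mu> f L \<longleftrightarrow>
     (\<exists>s. (\<forall>n. charge_simple I \<A> (s n)) \<and> uniform_limit I s f sequentially \<and>
          (\<lambda>n. simple_charge_integral I \<mu> (s n)) \<longlonglongrightarrow> L)"

definition charge_integral ::
    "'i set \<Rightarrow> 'i set set \<Rightarrow> ('i set \<Rightarrow> real) \<Rightarrow> ('i \<Rightarrow> real) \<Rightarrow> real" where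
  "charge_integral I \<A> \<mu> f = (THE L. has_charge_integral I \<A> \<mu> f L)"

text \<open>Being \<open>\<kappa>\<^sup>+\<close>-complete, for a cardinal \<open>\<kappa>\<close>.\<close>

definition suc_complete :: "'i set set \<Rightarrow> 'k rel \<Rightarrow> bool" where
  "suc_complete \<A> k \<longleftrightarrow> (\<forall>\<C>. \<C> \<subseteq> \<A> \<and> |\<C>| \<le>o k \<longrightarrow> \<Union>\<C> \<in> \<A>)"

text \<open>The cardinal may be taken in the type of \<open>M\<close>: any witness can be replaced by the cardinality
  of the dense set.\<close>

definition meanable ::
    "('f, 'r, 'c) signature \<Rightarrow> ('m, 'f, 'r, 'c) mstruct \<Rightarrow> 'i set set \<Rightarrow> bool" where
  "meanable \<tau> M \<A> \<longleftrightarrow>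
     (\<exists>k :: 'm rel. Card_order k \<and> has_dense_subset \<tau> M k \<and> suc_complete \<A> k)"

definition meas_maps ::
    "('f, 'r, 'c) signature \<Rightarrow> ('m, 'f, 'r, 'c) mstruct \<Rightarrow> 'i set \<Rightarrow> 'i set set \<Rightarrow> ('i \<Rightarrow> 'm) set" where
  "meas_maps \<tau> M I \<A> =
     {a \<in> I \<rightarrow>\<^sub>E points M. \<forall>X\<in>sigma_sets (points M) {U. openin (stopology \<tau> M) U}. a -` X \<inter> I \<in> \<A>}"

definition mean_eq ::
    "('f, 'r, 'c) signature \<Rightarrow> ('m, 'f, 'r, 'c) mstruct \<Rightarrow> 'i set \<Rightarrow> 'i set set \<Rightarrow> ('i set \<Rightarrow> real)
      \<Rightarrow> ('i \<Rightarrow> 'm) rel" where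
  "mean_eq \<tau> M I \<A> \<mu> =
     {(a, b) \<in> meas_maps \<tau> M I \<A> \<times> meas_maps \<tau> M I \<A>.
        charge_integral I \<A> \<mu> (\<lambda>i. sdist \<tau> M (a i) (b i)) = 0}"

definition repr :: "('i \<Rightarrow> 'm) set \<Rightarrow> 'i \<Rightarrow> 'm" where
  "repr X = (SOME a. a \<in> X)"

text \<open>The interpretations are given on chosen representatives, whose choice does not matter.
  The clause for relations covers the metric.\<close>

definition powermean ::
    "('f, 'r, 'c) signature \<Rightarrow> ('m, 'f, 'r, 'c) mstruct \<Rightarrow> 'i set \<Rightarrow> 'i set set \<Rightarrow> ('i set \<Rightarrow> real)
      \<Rightarrow> (('i \<Rightarrow> 'm) set, 'f, 'r, 'c) mstruct" where
  "powermean \<tau> M I \<A> \<mu> =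
     \<lparr>points = meas_maps \<tau> M I \<A> // mean_eq \<tau> M I \<A> \<mu>,
      fint = (\<lambda>F Xs. mean_eq \<tau> M I \<A> \<mu> `` {\<lambda>i\<in>I. fint M F (map (\<lambda>X. repr X i) Xs)}),
      rint = (\<lambda>R Xs. charge_integral I \<A> \<mu> (\<lambda>i. rint M R (map (\<lambda>X. repr X i) Xs))),
      cint = (\<lambda>c. mean_eq \<tau> M I \<A> \<mu> `` {\<lambda>i\<in>I. cint M c})\<rparr>"

text \<open>The existential quantifier over index sets needs a type for the points of the index set.  This
  one accommodates powers \<open>M\<^sup>X\<close> and their subsets, for exponents \<open>X\<close> as large as the double power
  set of the pairs of an element of the type carrying \<open>\<kappa>\<close> and a formula with parameters in \<open>M\<close>.\<close>

type_synonym ('f, 'r, 'c, 'm, 'k) index = "('k \<times> ('f, 'r, 'c, 'm) form) set set \<Rightarrow> 'm"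

section \<open>The choice of universe for models loses nothing\<close>

lemma tval_in:
  assumes "tau_structure \<tau> K" "\<pi> ` A \<subseteq> points K" "trm_over \<tau> A t" "\<forall>n\<in>tvars t. v n \<in> points K"
  shows "tval K \<pi> v t \<in> points K"
  using assms(3,4)
proof (induction t)
  case (App F ts)
  have "map (tval K \<pi> v) ts \<in> tuples K (farity \<tau> F)"
    using App by (auto simp: tuples_def list_all_iff)
  then show ?case using assms(1) App.prems by (simp add: tau_structure_def)
qed (use assms in \<open>auto simp: tau_structure_def\<close>)

lemma fval_bounded:
  assumes "signature \<tau>" "tau_structure \<tau> K" "\<pi> ` A \<subseteq> points K" "form_over \<tau> A \<phi>"
  shows "\<exists>C. \<forall>v. range v \<subseteq> points K \<longrightarrow> \<bar>fval K \<pi> v \<phi>\<bar> \<le> C"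
  using assms(4)
proof (induction \<phi>)
  case (Const r) show ?case by auto
next
  case (Rel R ts)
  have "\<bar>fval K \<pi> v (Rel R ts)\<bar> \<le> rbound \<tau> R" if "range v \<subseteq> points K" for v
  proof -
    have "map (tval K \<pi> v) ts \<in> tuples K (rarity \<tau> R)"
      using Rel that tval_in[OF assms(2,3)] by (auto simp: tuples_def list_all_iff subset_iff)
    then show ?thesis using assms(2) Rel by (simp add: tau_structure_def)
  qed
  then show ?case by blast
next
  case (Scale r \<phi>)
  then obtain C where C: "\<forall>v. range v \<subseteq> points K \<longrightarrow> \<bar>fval K \<pi> v \<phi>\<bar> \<le> C" by auto
  show ?case by (rule exI[of _ "\<bar>r\<bar> * C"]) (use C in \<open>auto simp: abs_mult mult_left_mono\<close>)
next
  case (Plus \<phi> \<psi>)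
  then obtain C D where C: "\<forall>v. range v \<subseteq> points K \<longrightarrow> \<bar>fval K \<pi> v \<phi>\<bar> \<le> C"
     "\<forall>v. range v \<subseteq> points K \<longrightarrow> \<bar>fval K \<pi> v \<psi>\<bar> \<le> D" by auto
  show ?case
    by (rule exI[of _ "C + D"]) (use C in \<open>auto intro!: order_trans[OF abs_triangle_ineq] add_mono\<close>)
next
  case (QSup x \<phi>)
  then obtain C where C: "\<And>v. range v \<subseteq> points K \<Longrightarrow> \<bar>fval K \<pi> v \<phi>\<bar> \<le> C" by auto
  have ne: "points K \<noteq> {}" using assms(2) by (simp add: tau_structure_def)
  have "\<bar>fval K \<pi> v (QSup x \<phi>)\<bar> \<le> C" if "range v \<subseteq> points K" for v
  proof -
    have "\<bar>fval K \<pi> (v(x := a)) \<phi>\<bar> \<le> C" if "a \<in> points K" for a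
      by (rule C) (use \<open>range v \<subseteq> points K\<close> that in auto)
    then show ?thesis unfolding fval.simps by (intro cSup_abs_le) (use ne in auto)
  qed
  then show ?case by blast
next
  case (QInf x \<phi>)
  then obtain C where C: "\<And>v. range v \<subseteq> points K \<Longrightarrow> \<bar>fval K \<pi> v \<phi>\<bar> \<le> C" by auto
  have ne: "points K \<noteq> {}" using assms(2) by (simp add: tau_structure_def)
  have "\<bar>fval K \<pi> v (QInf x \<phi>)\<bar> \<le> C" if "range v \<subseteq> points K" for v
  proof -
    have "\<bar>fval K \<pi> (v(x := a)) \<phi>\<bar> \<le> C" if "a \<in> points K" for a
      by (rule C) (use \<open>range v \<subseteq> points K\<close> that in auto)
    then show ?thesis unfolding fval.simps by (intro cInf_abs_ge) (use ne in auto)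
  qed
  then show ?case by blast
qed

lemma tval_cong: "\<forall>n\<in>tvars t. v n = w n \<Longrightarrow> tval K \<pi> v t = tval K \<pi> w t"
  by (induction t) (auto intro!: arg_cong[where f="fint K _"])

lemma fval_cong: "\<forall>n\<in>fvars \<phi>. v n = w n \<Longrightarrow> fval K \<pi> v \<phi> = fval K \<pi> w \<phi>"
proof (induction \<phi> arbitrary: v w)
  case (Rel R ts)
  have "map (tval K \<pi> v) ts = map (tval K \<pi> w) ts"
    using Rel by (auto intro!: tval_cong)
  then show ?case by (metis fval.simps(2))
next
  case (QSup x \<phi>)
  have "fval K \<pi> (v(x := a)) \<phi> = fval K \<pi> (w(x := a)) \<phi>" for a
    by (rule QSup.IH) (use QSup.prems in auto)
  then show ?case by simp
next
  case (QInf x \<phi>)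
  have "fval K \<pi> (v(x := a)) \<phi> = fval K \<pi> (w(x := a)) \<phi>" for a
    by (rule QInf.IH) (use QInf.prems in auto)
  then show ?case by simp
next
  case (Plus \<phi> \<psi>)
  then show ?case by (metis UnI1 UnI2 fvars.simps(4) fval.simps(4))
next
  case (Scale r \<phi>)
  then show ?case by (metis fvars.simps(3) fval.simps(3))
qed simp

lemma finite_tvars: "finite (tvars t)"
  by (induction t) auto

lemma finite_fvars: "finite (fvars \<phi>)"
  by (induction \<phi>) (auto simp: finite_tvars)

text \<open>Codes for the elements of an elementary substructure of \<open>K\<close> that contains the values of \<open>v\<close>:
  each formula codes a sequence of elements.\<close>

definition witness ::
    "('x, 'f, 'r, 'c) mstruct \<Rightarrow> ('a \<Rightarrow> 'x) \<Rightarrow> real \<Rightarrow> nat \<Rightarrow> ('f, 'r, 'c, 'a) form \<Rightarrow> (nat \<Rightarrow> 'x) \<Rightarrow> 'x"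
  where "witness K \<pi> k x \<phi> e =
    (SOME a. a \<in> points K \<and> (\<forall>b\<in>points K. k * fval K \<pi> (e(x := b)) \<phi> - 1 \<le> k * fval K \<pi> (e(x := a)) \<phi>))"

primrec skolem ::
    "('x, 'f, 'r, 'c) mstruct \<Rightarrow> ('a \<Rightarrow> 'x) \<Rightarrow> (nat \<Rightarrow> 'x) \<Rightarrow> ('f, 'r, 'c, 'a) form \<Rightarrow> nat \<Rightarrow> 'x" where
  "skolem K \<pi> v (Const r) = (\<lambda>n. v (n + nat \<lfloor>r\<rfloor>))"
| "skolem K \<pi> v (Rel R ts) = v"
| "skolem K \<pi> v (Scale k \<phi>) = v"
| "skolem K \<pi> v (QSup x \<phi>) = v"
| "skolem K \<pi> v (QInf x \<phi>) = v"
| "skolem K \<pi> v (Plus \<phi> \<psi>) = case_nat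
     (let a = (case \<phi> of Rel R ts \<Rightarrow> tval K \<pi> (skolem K \<pi> v \<psi>) (hd ts)
        | QSup x \<rho> \<Rightarrow> (case \<rho> of Scale k \<theta> \<Rightarrow> witness K \<pi> k x \<theta> (skolem K \<pi> v \<psi>) | _ \<Rightarrow> v 0)
        | _ \<Rightarrow> skolem K \<pi> v \<phi> 0) in if a \<in> points K then a else v 0)
     (skolem K \<pi> v \<psi>)"

lemma lowenheim_skolem:
  fixes K :: "('x, 'f, 'r, 'c) mstruct" and \<pi> :: "'a \<Rightarrow> 'x"
  assumes sig: "signature \<tau>" and K: "tau_structure \<tau> K" and \<pi>: "\<pi> ` A \<subseteq> points K"
    and v: "range v \<subseteq> points K"
  obtains K' :: "(('f, 'r, 'c, 'a) form, 'f, 'r, 'c) mstruct" and \<pi>' v' where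
    "tau_structure \<tau> K'" "\<pi>' ` A \<subseteq> points K'" "range v' \<subseteq> points K'"
    "\<And>\<phi>. form_over \<tau> A \<phi> \<Longrightarrow> fval K' \<pi>' v' \<phi> = fval K \<pi> v \<phi>"
proof -
  define G where "G = skolem K \<pi> v"
  define h where "h = (\<lambda>p. G p 0)"
  define B where "B = range h"
  define j where "j = (\<lambda>b. SOME p. h p = b)"
  have hj: "h (j b) = b" if "b \<in> B" for b
    using that unfolding j_def B_def by (metis (mono_tags) imageE someI)
  have GK: "G p n \<in> points K" for p n
  proof (induction p arbitrary: n)
    case (Plus p q)
    have "v 0 \<in> points K" using v by auto
    then show ?case using Plus(2) by (auto simp: G_def Let_def split: nat.split)
  qed (use v in \<open>auto simp: G_def\<close>)
  then have BK: "B \<subseteq> points K" by (auto simp: B_def h_def)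
  have GPlus: "G (Plus p q) (Suc n) = G q n" for p q n by (simp add: G_def)
  have GRel: "G (Plus (Rel R [t]) q) 0 = tval K \<pi> (G q) t" if "tval K \<pi> (G q) t \<in> points K" for R t q
    using that by (simp add: G_def)
  have GB: "G q n \<in> B" for q n
    using GRel[of q "Var n"] GK by (metis B_def h_def rangeI tval.simps(1))
  have cons: "\<exists>p. G p 0 = b \<and> (\<forall>n. G p (Suc n) = G q n)" if b: "b \<in> B" for b q
  proof -
    obtain p where p: "G p 0 = b" using b by (auto simp: B_def h_def)
    have "\<exists>p'. G (Plus p' q) 0 = b"
    proof (cases "G p 0 = v 0")
      case True
      have "G (Plus (Const 0) q) 0 = v 0" by (simp add: G_def Let_def)
      then show ?thesis using True p by metis
    next
      case False
      then have "G (Plus p q) 0 = G p 0"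
        using GK[of p 0] by (cases p) (auto simp: G_def Let_def)
      then show ?thesis using p by auto
    qed
    then show ?thesis using GPlus by blast
  qed
  have env: "\<exists>q. \<forall>n<N. G q n = w n" if "range w \<subseteq> B" for w :: "nat \<Rightarrow> 'x" and N
    using that
  proof (induction N arbitrary: w)
    case (Suc N)
    have "range (\<lambda>n. w (Suc n)) \<subseteq> B" using Suc.prems by auto
    then obtain q where q: "\<forall>n<N. G q n = w (Suc n)" using Suc.IH by blast
    obtain p where "G p 0 = w 0" "\<forall>n. G p (Suc n) = G q n"
      using cons[of "w 0" q] Suc.prems by auto
    then show ?case using q by (metis not0_implies_Suc Suc_less_eq)
  qed auto
  have wit: "\<exists>a\<in>B. \<forall>b\<in>points K. k * fval K \<pi> (w(x := b)) \<phi> - 1 \<le> k * fval K \<pi> (w(x := a)) \<phi>"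
    if w: "range w \<subseteq> B" and \<phi>: "form_over \<tau> A \<phi>" for w x \<phi> k
  proof -
    obtain N where N: "fvars \<phi> \<subseteq> {..<N}" using finite_fvars finite_nat_iff_bounded by blast
    obtain q where q: "\<forall>n<N. G q n = w n" using env[OF w] by blast
    have eq: "fval K \<pi> ((G q)(x := a)) \<phi> = fval K \<pi> (w(x := a)) \<phi>" for a
      by (rule fval_cong) (use N q in auto)
    let ?f = "\<lambda>a. k * fval K \<pi> ((G q)(x := a)) \<phi>"
    obtain C where C: "\<And>v. range v \<subseteq> points K \<Longrightarrow> \<bar>fval K \<pi> v \<phi>\<bar> \<le> C"
      using fval_bounded[OF sig K \<pi> \<phi>] by blast
    have "\<bar>?f a\<bar> \<le> \<bar>k\<bar> * C" if "a \<in> points K" for a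
      unfolding abs_mult by (intro mult_left_mono C) (use GK that in auto)
    then have bdd: "bdd_above (?f ` points K)" by (intro bdd_aboveI2[where M="\<bar>k\<bar> * C"]) (metis abs_le_D1)
    have ne: "points K \<noteq> {}" using v by auto
    obtain a where "a \<in> points K" "(SUP a\<in>points K. ?f a) - 1 < ?f a"
      using less_cSUP_iff[OF ne bdd, of "(SUP a\<in>points K. ?f a) - 1"] by auto
    then have "\<exists>a. a \<in> points K \<and> (\<forall>b\<in>points K. ?f b - 1 \<le> ?f a)"
      using cSUP_upper[OF _ bdd] by (smt (verit))
    then have W: "witness K \<pi> k x \<phi> (G q) \<in> points K \<and> (\<forall>b\<in>points K. ?f b - 1 \<le> ?f (witness K \<pi> k x \<phi> (G q)))"
      unfolding witness_def by (rule someI_ex)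
    then have "G (Plus (QSup x (Scale k \<phi>)) q) 0 = witness K \<pi> k x \<phi> (G q)" by (simp add: G_def)
    then have "witness K \<pi> k x \<phi> (G q) \<in> B" by (metis GB)
    then show ?thesis using W unfolding eq by blast
  qed
  have tB: "tval K \<pi> w t \<in> B" if w: "range w \<subseteq> B" and t: "tval K \<pi> w t \<in> points K" for w t
  proof -
    obtain N where N: "tvars t \<subseteq> {..<N}" using finite_tvars finite_nat_iff_bounded by blast
    obtain q where q: "\<forall>n<N. G q n = w n" using env[OF w] by blast
    have "tval K \<pi> (G q) t = tval K \<pi> w t" by (rule tval_cong) (use N q in auto)
    then show ?thesis by (metis GB GRel t)
  qed
  define K' where "K' = \<lparr>points = j ` B, fint = (\<lambda>F xs. j (fint K F (map h xs))),
    rint = (\<lambda>R xs. rint K R (map h xs)), cint = (\<lambda>c. j (cint K c))\<rparr>"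
  have hK': "h p \<in> B" for p by (simp add: B_def)
  have U: "points K' = j ` B" by (simp add: K'_def)
  have jh: "j (h p) = p" if "p \<in> points K'" for p using that hj by (auto simp: U)
  have hU: "h p \<in> points K" for p using hK' BK by auto
  have sd: "sdist \<tau> K' p q = sdist \<tau> K (h p) (h q)" if "p \<in> points K'" "q \<in> points K'" for p q
    using that hU by (simp add: sdist_def K'_def)
  have tup: "map h xs \<in> tuples K n" if "xs \<in> tuples K' n" for xs n
    using that hU by (auto simp: tuples_def)
  have td: "tdist \<tau> K' xs ys = tdist \<tau> K (map h xs) (map h ys)"
    if "xs \<in> tuples K' n" "ys \<in> tuples K' n" for xs ys n
    unfolding tdist_def using that sd by (auto simp: tuples_def subset_iff intro!: sum.cong)
  have FB: "fint K F (map h xs) \<in> B" if F: "F \<in> fsyms \<tau>" and xs: "xs \<in> tuples K' (farity \<tau> F)" for F xs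
  proof -
    obtain b0 where b0: "b0 \<in> B" by (auto simp: B_def)
    define w where "w = (\<lambda>i. if i < length xs then h (xs ! i) else b0)"
    have "map h xs = map w [0..<length xs]" by (auto simp: w_def intro: nth_equalityI)
    then have e: "fint K F (map h xs) = tval K \<pi> w (App F (map Var [0..<length xs]))"
      by (simp add: comp_def)
    show ?thesis unfolding e
    proof (rule tB)
      show "range w \<subseteq> B" using b0 hK' by (auto simp: w_def)
      show "tval K \<pi> w (App F (map Var [0..<length xs])) \<in> points K"
        using K F tup[OF xs] by (simp add: e[symmetric] tau_structure_def del: tval.simps)
    qed
  qed
  have bw: "range (\<lambda>_::nat. h (Const 0)) \<subseteq> B" using hK' by auto
  have CB: "cint K c \<in> B" if "c \<in> csyms \<tau>" for c
    using tB[OF bw, of "Con c"] K that by (simp add: tau_structure_def)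
  have PB: "\<pi> a \<in> B" if "a \<in> A" for a
    using tB[OF bw, of "Par a"] \<pi> that by auto
  have KD: "\<And>F xs ys. F \<in> fsyms \<tau> \<Longrightarrow> xs \<in> tuples K (farity \<tau> F) \<Longrightarrow> ys \<in> tuples K (farity \<tau> F)
        \<Longrightarrow> sdist \<tau> K (fint K F xs) (fint K F ys) \<le> fmod \<tau> F (tdist \<tau> K xs ys)"
    "\<And>R xs ys. R \<in> rsyms \<tau> \<Longrightarrow> xs \<in> tuples K (rarity \<tau> R) \<Longrightarrow> ys \<in> tuples K (rarity \<tau> R)
        \<Longrightarrow> \<bar>rint K R xs - rint K R ys\<bar> \<le> rmod \<tau> R (tdist \<tau> K xs ys)"
    "\<And>R xs. R \<in> rsyms \<tau> \<Longrightarrow> xs \<in> tuples K (rarity \<tau> R) \<Longrightarrow> \<bar>rint K R xs\<bar> \<le> rbound \<tau> R"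
    and MK: "Metric_space (points K) (sdist \<tau> K)"
    using K by (auto simp: tau_structure_def)
  have ms: "Metric_space (points K') (sdist \<tau> K')"
  proof
    fix p q
    show "0 \<le> sdist \<tau> K' p q"
      using sd[of p q] Metric_space.nonneg[OF MK] by (cases "p \<in> points K' \<and> q \<in> points K'") (auto simp: sdist_def)
    show "sdist \<tau> K' p q = sdist \<tau> K' q p"
      using sd[of p q] sd[of q p] Metric_space.commute[OF MK]
      by (cases "p \<in> points K' \<and> q \<in> points K'") (auto simp: sdist_def)
    assume pq: "p \<in> points K'" "q \<in> points K'"
    show "sdist \<tau> K' p q = 0 \<longleftrightarrow> p = q"
      using pq Metric_space.zero[OF MK hU hU] jh by (metis sd)
    fix r assume "r \<in> points K'"
    then show "sdist \<tau> K' p r \<le> sdist \<tau> K' p q + sdist \<tau> K' q r"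
      using pq Metric_space.triangle[OF MK hU hU hU] by (metis sd)
  qed
  have fK': "fint K' F xs \<in> points K' \<and> h (fint K' F xs) = fint K F (map h xs)"
    if "F \<in> fsyms \<tau>" "xs \<in> tuples K' (farity \<tau> F)" for F xs
    using FB[OF that] hj by (auto simp: K'_def)
  have rK': "rint K' R xs = rint K R (map h xs)" for R xs by (simp add: K'_def)
  have S: "tau_structure \<tau> K'"
    unfolding tau_structure_def
  proof (intro conjI ballI)
    show "points K' \<noteq> {}" using hK' by (auto simp: U)
    show "Metric_space (points K') (sdist \<tau> K')" by (rule ms)
    show "cint K' c \<in> points K'" if "c \<in> csyms \<tau>" for c using CB[OF that] by (simp add: K'_def)
    fix F xs assume F: "F \<in> fsyms \<tau>" and xs: "xs \<in> tuples K' (farity \<tau> F)"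
    show "fint K' F xs \<in> points K'" using fK'[OF F xs] by simp
    fix ys assume ys: "ys \<in> tuples K' (farity \<tau> F)"
    show "sdist \<tau> K' (fint K' F xs) (fint K' F ys) \<le> fmod \<tau> F (tdist \<tau> K' xs ys)"
      using fK'[OF F xs] fK'[OF F ys] KD(1)[OF F tup[OF xs] tup[OF ys]] by (simp add: sd td[OF xs ys])
  next
    fix R xs assume R: "R \<in> rsyms \<tau>" and xs: "xs \<in> tuples K' (rarity \<tau> R)"
    show "\<bar>rint K' R xs\<bar> \<le> rbound \<tau> R" using KD(3)[OF R tup[OF xs]] by (simp add: rK')
    fix ys assume ys: "ys \<in> tuples K' (rarity \<tau> R)"
    show "\<bar>rint K' R xs - rint K' R ys\<bar> \<le> rmod \<tau> R (tdist \<tau> K' xs ys)"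
      using KD(2)[OF R tup[OF xs] tup[OF ys]] by (simp add: rK' td[OF xs ys])
  qed
  define \<pi>' where "\<pi>' = (\<lambda>a. j (\<pi> a))"
  have P: "\<pi>' ` A \<subseteq> points K'" using PB by (auto simp: \<pi>'_def U)
  have tv: "h (tval K' \<pi>' w t) = tval K \<pi> (h \<circ> w) t"
    if w: "range w \<subseteq> points K'" and t: "trm_over \<tau> A t" for w t
    using t
  proof (induction t)
    case (App F ts)
    have "map (tval K' \<pi>' w) ts \<in> tuples K' (farity \<tau> F)"
      using App.prems w tval_in[OF S P] by (auto simp: tuples_def list_all_iff image_subset_iff)
    moreover have "map h (map (tval K' \<pi>' w) ts) = map (tval K \<pi> (h \<circ> w)) ts"
      using App by (auto simp: list_all_iff comp_def)
    moreover have "F \<in> fsyms \<tau>" using App.prems by simp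
    ultimately show ?case using fK' by (metis tval.simps(4))
  qed (use hj CB PB in \<open>auto simp: K'_def \<pi>'_def\<close>)
  have fv: "fval K' \<pi>' w \<phi> = fval K \<pi> (h \<circ> w) \<phi>"
    if "range w \<subseteq> points K'" "form_over \<tau> A \<phi>" for w \<phi>
    using that
  proof (induction \<phi> arbitrary: w)
    case (Rel R ts)
    have "map h (map (tval K' \<pi>' w) ts) = map (tval K \<pi> (h \<circ> w)) ts"
      using Rel tv by (auto simp: list_all_iff)
    then show ?case by (metis rK' fval.simps(2))
  next
    case (QSup x \<phi>)
    have hw: "range (h \<circ> w) \<subseteq> B" "range (h \<circ> w) \<subseteq> points K" using hK' hU by auto
    have \<phi>: "form_over \<tau> A \<phi>" using QSup.prems by simp
    let ?f = "\<lambda>b. fval K \<pi> ((h \<circ> w)(x := b)) \<phi>"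
    have "fval K' \<pi>' (w(x := p)) \<phi> = ?f (h p)" if "p \<in> points K'" for p
    proof -
      have "h \<circ> w(x := p) = (h \<circ> w)(x := h p)" by auto
      then show ?thesis using QSup.IH[of "w(x := p)"] QSup.prems that by fastforce
    qed
    then have "fval K' \<pi>' w (QSup x \<phi>) = (SUP p\<in>points K'. ?f (h p))" by simp
    also have "\<dots> = (SUP b\<in>B. ?f b)" by (simp add: U image_image hj)
    also have "\<dots> = (SUP b\<in>points K. ?f b)"
    proof (rule antisym)
      obtain C where C: "\<And>v. range v \<subseteq> points K \<Longrightarrow> \<bar>fval K \<pi> v \<phi>\<bar> \<le> C"
        using fval_bounded[OF sig K \<pi> \<phi>] by blast
      have "\<bar>?f a\<bar> \<le> C" if "a \<in> points K" for a by (intro C) (use hU that in auto)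
      then have bdd: "bdd_above (?f ` points K)" by (intro bdd_aboveI2[where M=C]) (metis abs_le_D1)
      then have bddB: "bdd_above (?f ` B)" using BK by (meson bdd_above_mono image_mono)
      show "(SUP b\<in>B. ?f b) \<le> (SUP b\<in>points K. ?f b)"
        by (rule cSUP_subset_mono) (use BK bdd hK' in auto)
      show "(SUP b\<in>points K. ?f b) \<le> (SUP b\<in>B. ?f b)"
      proof (rule cSUP_least)
        fix b assume b: "b \<in> points K"
        show "?f b \<le> (SUP b\<in>B. ?f b)"
        proof (rule field_le_epsilon)
          fix e :: real assume e: "0 < e"
          obtain a where a: "a \<in> B" "1 / e * ?f b - 1 \<le> 1 / e * ?f a"
            using wit[OF hw(1) \<phi>, of "1 / e" x] b by blast
          have "e * (1 / e * ?f b - 1) \<le> e * (1 / e * ?f a)"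
            by (rule mult_left_mono[OF a(2)]) (use e in simp)
          then have "?f b \<le> ?f a + e" using e by (simp add: right_diff_distrib)
          also have "?f a \<le> (SUP b\<in>B. ?f b)" by (rule cSUP_upper[OF a(1) bddB])
          finally show "?f b \<le> (SUP b\<in>B. ?f b) + e" by simp
        qed
      qed (use v in auto)
    qed
    finally show ?case by (simp only: fval.simps)
  next
    case (QInf x \<phi>)
    have hw: "range (h \<circ> w) \<subseteq> B" "range (h \<circ> w) \<subseteq> points K" using hK' hU by auto
    have \<phi>: "form_over \<tau> A \<phi>" using QInf.prems by simp
    let ?f = "\<lambda>b. fval K \<pi> ((h \<circ> w)(x := b)) \<phi>"
    have "fval K' \<pi>' (w(x := p)) \<phi> = ?f (h p)" if "p \<in> points K'" for p
    proof -
      have "h \<circ> w(x := p) = (h \<circ> w)(x := h p)" by auto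
      then show ?thesis using QInf.IH[of "w(x := p)"] QInf.prems that by fastforce
    qed
    then have "fval K' \<pi>' w (QInf x \<phi>) = (INF p\<in>points K'. ?f (h p))" by simp
    also have "\<dots> = (INF b\<in>B. ?f b)" by (simp add: U image_image hj)
    also have "\<dots> = (INF b\<in>points K. ?f b)"
    proof (rule antisym)
      obtain C where C: "\<And>v. range v \<subseteq> points K \<Longrightarrow> \<bar>fval K \<pi> v \<phi>\<bar> \<le> C"
        using fval_bounded[OF sig K \<pi> \<phi>] by blast
      have "\<bar>?f a\<bar> \<le> C" if "a \<in> points K" for a by (intro C) (use hU that in auto)
      then have bdd: "bdd_below (?f ` points K)" by (intro bdd_belowI2[where m="-C"]) (metis abs_le_D2 minus_le_iff)
      then have bddB: "bdd_below (?f ` B)" using BK by (meson bdd_below_mono image_mono)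
      show "(INF b\<in>points K. ?f b) \<le> (INF b\<in>B. ?f b)"
        by (rule cINF_superset_mono) (use BK bdd hK' in auto)
      show "(INF b\<in>B. ?f b) \<le> (INF b\<in>points K. ?f b)"
      proof (rule cINF_greatest)
        fix b assume b: "b \<in> points K"
        show "(INF b\<in>B. ?f b) \<le> ?f b"
        proof (rule field_le_epsilon)
          fix e :: real assume e: "0 < e"
          obtain a where a: "a \<in> B" "- (1 / e) * ?f b - 1 \<le> - (1 / e) * ?f a"
            using wit[OF hw(1) \<phi>, of "- (1 / e)" x] b by blast
          have "e * (- (1 / e) * ?f b - 1) \<le> e * (- (1 / e) * ?f a)"
            by (rule mult_left_mono[OF a(2)]) (use e in simp)
          then have "?f a \<le> ?f b + e" using e by (simp add: right_diff_distrib)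
          with cINF_lower[OF bddB a(1)] show "(INF b\<in>B. ?f b) \<le> ?f b + e" by simp
        qed
      qed (use v in auto)
    qed
    finally show ?case by (simp only: fval.simps)
  qed simp_all
  define v' where "v' = (\<lambda>n. j (v n))"
  have vB: "v n \<in> B" for n
  proof -
    have "h (Const (real n)) = v n" by (simp add: h_def G_def)
    then show ?thesis by (metis hK')
  qed
  show thesis
  proof (rule that[OF S P])
    show r: "range v' \<subseteq> points K'" using vB by (auto simp: v'_def U)
    have "h \<circ> v' = v" using vB hj by (auto simp: v'_def)
    then show "fval K' \<pi>' v' \<phi> = fval K \<pi> v \<phi>" if "form_over \<tau> A \<phi>" for \<phi>
      using fv[OF r that] by simp
  qed
qed

lemma satisfiable_over_if_satisfied_in:
  fixes K :: "('x, 'f, 'r, 'c) mstruct"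
  assumes sig: "signature \<tau>" and p: "p \<subseteq> conds \<tau> A n" and s: "satisfied_in \<tau> N A n p K \<pi>"
  shows "satisfiable_over \<tau> N A n p"
proof -
  obtain xs where K: "tau_structure \<tau> K" and \<pi>: "\<pi> ` A \<subseteq> points K"
    and T: "\<forall>c\<in>thy_over \<tau> N A. sat K \<pi> [] c"
    and xs: "xs \<in> tuples K n" and X: "\<forall>c\<in>thy_over \<tau> N A \<union> p. sat K \<pi> xs c"
    using s unfolding satisfied_in_def model_of_def by blast
  obtain b where b: "b \<in> points K" using K by (auto simp: tau_structure_def)
  define v where "v = (\<lambda>i. if i < n then xs ! i else b)"
  have v: "range v \<subseteq> points K" using xs b by (auto simp: v_def tuples_def)
  obtain K' :: "(('f, 'r, 'c, 'a) form, 'f, 'r, 'c) mstruct" and \<pi>' v' where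
    K': "tau_structure \<tau> K'" "\<pi>' ` A \<subseteq> points K'" "range v' \<subseteq> points K'"
    and eq: "\<And>\<phi>. form_over \<tau> A \<phi> \<Longrightarrow> fval K' \<pi>' v' \<phi> = fval K \<pi> v \<phi>"
    using lowenheim_skolem[OF sig K \<pi> v] by blast
  define ys where "ys = map v' [0..<n]"
  have ys: "ys \<in> tuples K' n" using K'(3) by (auto simp: ys_def tuples_def)
  have *: "fval K' \<pi>' ((!) us) \<phi> = fval K \<pi> ((!) zs) \<phi>"
    if \<phi>: "form_over \<tau> A \<phi>" "fvars \<phi> \<subseteq> {..<m}" and m: "\<forall>i<m. us ! i = v' i \<and> zs ! i = v i" for \<phi> m us zs
  proof -
    have "fval K' \<pi>' ((!) us) \<phi> = fval K' \<pi>' v' \<phi>" by (rule fval_cong) (use \<phi> m in auto)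
    also have "\<dots> = fval K \<pi> v \<phi>" by (rule eq[OF \<phi>(1)])
    also have "\<dots> = fval K \<pi> ((!) zs) \<phi>" by (rule fval_cong) (use \<phi> m in auto)
    finally show ?thesis .
  qed
  have s0: "sat K' \<pi>' [] c = sat K \<pi> [] c" if "c \<in> conds \<tau> A 0" for c
    using that *[of _ 0 "[]" "[]"] by (auto simp: sat_def conds_def)
  have sn: "sat K' \<pi>' ys c = sat K \<pi> xs c" if "c \<in> conds \<tau> A n" for c
    using that *[of _ n ys xs] by (auto simp: sat_def conds_def ys_def v_def)
  have sub: "thy_over \<tau> N A \<subseteq> conds \<tau> A 0" "conds \<tau> A 0 \<subseteq> conds \<tau> A n"
    by (auto simp: thy_over_def conds_def)
  have "\<forall>c\<in>thy_over \<tau> N A. sat K' \<pi>' [] c" using T s0 sub by blast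
  moreover have "\<forall>c\<in>thy_over \<tau> N A \<union> p. sat K' \<pi>' ys c" using X sn sub p by blast
  ultimately have "satisfied_in \<tau> N A n p K' \<pi>'"
    unfolding satisfied_in_def model_of_def using K' ys by blast
  then show ?thesis unfolding satisfiable_over_def by blast
qed

end

(* A complete type p over A is realized by a point x of some model K of the theory of N, so for every
   formula phi over A the infimum of phi in N is at most its value P phi at x.  Applied to linear
   combinations of finitely many formulas, this one-sided bound suffices to choose points of N one
   after the other so that the running averages of all these formulas converge to their values P phi
   (the greedy choice of Blackwell's approachability theorem).

   Hence N = M^mu is saturated as soon as mu can convert such averages into single points.  The index
   set consists of functions w on a regular cardinal r, successor of a cardinal that bounds kappa and
   the number of formulas; the values of w are pairs of a finite set of formula codes and a position
   in a sequence.  The algebra consists of the sets that depend on boundedly many coordinates, so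
   measurable maps into M are exactly the maps that depend on boundedly many coordinates, and by
   regularity the representatives of A and of all averaging sequences depend on the coordinates up to
   one a < r.  The charge iterates, along r, a fixed mean that takes Cesaro limits in the position and
   then a limit along the finite sets of formulas.  Reading off a fresh coordinate b > a which averaging
   sequence to use, and which of its terms, gives a map whose class realizes p: the values of formulas
   in N are integrals of the values in M, and the integral over b computes the limit of the averages. *)
theory Submission
  imports Defs
begin


section \<open>Means on bounded functions\<close>

definition bounded_fn :: "('a \<Rightarrow> real) \<Rightarrow> bool" where
  "bounded_fn f \<longleftrightarrow> (\<exists>C. \<forall>x. \<bar>f x\<bar> \<le> C)"

lemma bounded_fnI: "(\<And>x. \<bar>f x\<bar> \<le> C) \<Longrightarrow> bounded_fn f"
  by (auto simp: bounded_fn_def)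

lemma bounded_fn_const [simp]: "bounded_fn (\<lambda>_. c)"
  by (auto simp: bounded_fn_def)

lemma bounded_fn_add [simp]: "bounded_fn f \<Longrightarrow> bounded_fn g \<Longrightarrow> bounded_fn (\<lambda>x. f x + g x)"
  unfolding bounded_fn_def by (metis abs_triangle_ineq add_mono order_trans)

lemma bounded_fn_scale [simp]: "bounded_fn f \<Longrightarrow> bounded_fn (\<lambda>x. c * f x)"
  unfolding bounded_fn_def by (metis abs_ge_zero abs_mult mult_left_mono)

lemma bounded_fn_comp [simp]: "bounded_fn f \<Longrightarrow> bounded_fn (\<lambda>x. f (g x))"
  unfolding bounded_fn_def by blast

lemma bounded_fn_uminus [simp]: "bounded_fn f \<Longrightarrow> bounded_fn (\<lambda>x. - f x)"
  by (simp add: bounded_fn_def)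

lemma bounded_fn_diff [simp]: "bounded_fn f \<Longrightarrow> bounded_fn g \<Longrightarrow> bounded_fn (\<lambda>x. f x - g x)"
  using bounded_fn_add[of f "\<lambda>x. - g x"] by simp

lemma bounded_fn_sum [simp]: "(\<And>k. k \<in> F \<Longrightarrow> bounded_fn (f k)) \<Longrightarrow> bounded_fn (\<lambda>x. \<Sum>k\<in>F. f k x)"
  by (induction F rule: infinite_finite_induct) auto

text \<open>A normalised positive linear functional on the bounded functions, that is, integration
  against a finitely additive probability defined on all subsets of the type. Values at unbounded
  functions are unconstrained.\<close>

definition mean :: "(('a \<Rightarrow> real) \<Rightarrow> real) \<Rightarrow> bool" where
  "mean L \<longleftrightarrow>
     (\<forall>f g. bounded_fn f \<longrightarrow> bounded_fn g \<longrightarrow> L (\<lambda>x. f x + g x) = L f + L g) \<and>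
     (\<forall>c f. bounded_fn f \<longrightarrow> L (\<lambda>x. c * f x) = c * L f) \<and>
     (\<forall>f g. bounded_fn f \<longrightarrow> bounded_fn g \<longrightarrow> (\<forall>x. f x \<le> g x) \<longrightarrow> L f \<le> L g) \<and>
     L (\<lambda>_. 1) = 1"

lemma mean_add: "mean L \<Longrightarrow> bounded_fn f \<Longrightarrow> bounded_fn g \<Longrightarrow> L (\<lambda>x. f x + g x) = L f + L g"
  and mean_scale: "mean L \<Longrightarrow> bounded_fn f \<Longrightarrow> L (\<lambda>x. c * f x) = c * L f"
  and mean_mono: "mean L \<Longrightarrow> bounded_fn f \<Longrightarrow> bounded_fn g \<Longrightarrow> (\<And>x. f x \<le> g x) \<Longrightarrow> L f \<le> L g"
  by (auto simp: mean_def)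

lemma mean_const: "mean L \<Longrightarrow> L (\<lambda>_. c) = c"
  using mean_scale[of L "\<lambda>_. 1" c] by (simp add: mean_def)

lemma mean_diff: "mean L \<Longrightarrow> bounded_fn f \<Longrightarrow> bounded_fn g \<Longrightarrow> L (\<lambda>x. f x - g x) = L f - L g"
  using mean_add[of L f "\<lambda>x. -1 * g x"] mean_scale[of L g "-1"] by simp

lemma mean_sum:
  "mean L \<Longrightarrow> (\<And>k. k \<in> F \<Longrightarrow> bounded_fn (f k)) \<Longrightarrow> L (\<lambda>x. \<Sum>k\<in>F. f k x) = (\<Sum>k\<in>F. L (f k))"
proof (induction F rule: infinite_finite_induct)
  case (insert k F)
  have "L (\<lambda>x. f k x + (\<Sum>k\<in>F. f k x)) = L (f k) + L (\<lambda>x. \<Sum>k\<in>F. f k x)"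
    by (rule mean_add) (use insert in auto)
  then show ?case using insert by simp
qed (auto simp: mean_const)

lemma mean_abs_le:
  assumes "mean L" "\<And>x. \<bar>f x\<bar> \<le> C"
  shows "\<bar>L f\<bar> \<le> C"
proof -
  have b: "bounded_fn f" using assms(2) by (rule bounded_fnI)
  have "f x \<le> C" "- C \<le> f x" for x using assms(2)[of x] by auto
  then have "L f \<le> C" "- C \<le> L f"
    using mean_mono[OF assms(1) b, of "\<lambda>_. C"] mean_mono[OF assms(1) _ b, of "\<lambda>_. - C"]
    by (auto simp: mean_const[OF assms(1)])
  then show ?thesis by simp
qed

lemma mean_eval: "mean (\<lambda>f. f a)"
  by (simp add: mean_def)

lemma mean_image: "mean L \<Longrightarrow> mean (\<lambda>f. L (\<lambda>x. f (g x)))"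
  by (simp add: mean_def)

text \<open>Iterated integrals are again means: a bound on \<open>f\<close> bounds all
  \<open>L x f\<close> uniformly in \<open>x\<close>, so the inner integral is a bounded function to
  which \<open>M\<close> applies.\<close>

lemma mean_mixture:
  fixes L :: "'x \<Rightarrow> ('a \<Rightarrow> real) \<Rightarrow> real"
  assumes M: "mean M" and L: "\<And>x. mean (L x)"
  shows "mean (\<lambda>f. M (\<lambda>x. L x f))"
proof -
  have b: "bounded_fn (\<lambda>x. L x f)" if "bounded_fn f" for f
  proof -
    obtain C where "\<bar>f x\<bar> \<le> C" for x using \<open>bounded_fn f\<close> by (auto simp: bounded_fn_def)
    then have "\<bar>L x f\<bar> \<le> C" for x by (rule mean_abs_le[OF L])
    then show ?thesis by (rule bounded_fnI)
  qed
  show ?thesis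
    unfolding mean_def
  proof (intro conjI allI impI)
    fix f g :: "'a \<Rightarrow> real" and c :: real assume f: "bounded_fn f"
    show "M (\<lambda>x. L x (\<lambda>y. c * f y)) = c * M (\<lambda>x. L x f)"
      by (simp add: mean_scale[OF L f] mean_scale[OF M b[OF f]])
    assume g: "bounded_fn g"
    show "M (\<lambda>x. L x (\<lambda>y. f y + g y)) = M (\<lambda>x. L x f) + M (\<lambda>x. L x g)"
      by (simp add: mean_add[OF L f g] mean_add[OF M b[OF f] b[OF g]])
    assume "\<forall>x. f x \<le> g x"
    then show "M (\<lambda>x. L x f) \<le> M (\<lambda>x. L x g)"
      by (auto intro!: mean_mono[OF M b[OF f] b[OF g]] mean_mono[OF L f g])
  next
    show "M (\<lambda>x. L x (\<lambda>_. 1)) = 1" by (simp add: mean_const[OF L] mean_const[OF M])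
  qed
qed

section \<open>Ultrafilter limits and the mean on the values of one coordinate\<close>

definition ultra :: "'a filter \<Rightarrow> 'a filter" where
  "ultra F = (SOME U. U \<noteq> bot \<and> U \<le> F \<and> (\<forall>P. eventually P U \<or> eventually (\<lambda>x. \<not> P x) U))"

text \<open>Zorn's lemma for proper filters below \<open>F\<close>, where smaller means finer. A
  minimal \<open>U\<close> decides every \<open>P\<close>: if the negation of \<open>P\<close> does
  not hold eventually, adding \<open>P\<close> to \<open>U\<close> keeps it proper, so by minimality
  \<open>U\<close> contained \<open>P\<close> already.\<close>

lemma ultrafilter_exists:
  assumes "F \<noteq> bot"
  shows "\<exists>U. U \<noteq> bot \<and> U \<le> F \<and> (\<forall>P. eventually P U \<or> eventually (\<lambda>x. \<not> P x) U)"
proof -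
  define A where "A = {G. G \<noteq> bot \<and> G \<le> F}"
  have "\<exists>m\<in>A. \<forall>a\<in>A. m \<ge> a \<longrightarrow> a = m"
  proof (rule predicate_Zorn)
    show "partial_order_on A (relation_of (\<ge>) A)"
      by (auto simp: partial_order_on_def preorder_on_def refl_on_def trans_def antisym_def relation_of_def)
    fix C assume C: "C \<in> Chains (relation_of (\<ge>) A)"
    show "\<exists>u\<in>A. \<forall>a\<in>C. u \<le> a"
    proof (cases "C = {}")
      case False
      have CA: "C \<subseteq> A" and lin: "\<And>x y. x \<in> C \<Longrightarrow> y \<in> C \<Longrightarrow> x \<le> y \<or> y \<le> x"
        using C by (auto simp: Chains_def relation_of_def)
      \<comment> \<open>In a chain, what holds eventually in the infimum holds eventually in one
        member; hence the infimum cannot be improper.\<close>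
      have "eventually P (Inf C) \<longleftrightarrow> (\<exists>b\<in>C. eventually P b)" for P
        by (rule eventually_Inf_base[OF False]) (use lin in \<open>metis inf_absorb1 inf_absorb2 order_refl\<close>)
      then have "Inf C \<noteq> bot" using CA by (auto simp: trivial_limit_def A_def)
      moreover have "Inf C \<le> F" using CA False by (auto simp: A_def intro: Inf_lower2)
      ultimately show ?thesis by (intro bexI[of _ "Inf C"]) (auto simp: A_def Inf_lower)
    qed (use assms in \<open>auto simp: A_def\<close>)
  qed
  then obtain U where U: "U \<noteq> bot" "U \<le> F" and mx: "\<And>G. G \<noteq> bot \<Longrightarrow> G \<le> F \<Longrightarrow> G \<le> U \<Longrightarrow> G = U"
    by (auto simp: A_def)
  have "eventually P U \<or> eventually (\<lambda>x. \<not> P x) U" for P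
  proof (rule disjCI)
    assume "\<not> eventually (\<lambda>x. \<not> P x) U"
    then have "inf U (principal {x. P x}) \<noteq> bot"
      by (auto simp: trivial_limit_def eventually_inf_principal)
    then have "inf U (principal {x. P x}) = U" by (intro mx) (use U in \<open>auto intro: le_infI1\<close>)
    then have "U \<le> principal {x. P x}" by (rule le_iff_inf[THEN iffD2])
    then show "eventually P U" by (simp add: le_principal)
  qed
  then show ?thesis using U by blast
qed

lemma ultra:
  assumes "F \<noteq> bot"
  shows "ultra F \<noteq> bot" "ultra F \<le> F" "eventually P (ultra F) \<or> eventually (\<lambda>x. \<not> P x) (ultra F)"
  using someI_ex[OF ultrafilter_exists[OF assms]] unfolding ultra_def[symmetric] by auto

definition ulim :: "'a filter \<Rightarrow> ('a \<Rightarrow> real) \<Rightarrow> real" where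
  "ulim F f = Lim (ultra F) f"

text \<open>By compactness the image filter on \<open>{-C..C}\<close> has a cluster point, and a
  cluster point of an ultrafilter is a limit: each neighbourhood is either eventually entered or
  eventually avoided, and the latter is excluded.\<close>

lemma ulim_tendsto:
  assumes F: "F \<noteq> bot" and f: "bounded_fn f"
  shows "(f \<longlongrightarrow> ulim F f) (ultra F)"
proof -
  let ?U = "ultra F"
  note U = ultra[OF F]
  obtain C where C: "\<And>x. \<bar>f x\<bar> \<le> C" using f by (auto simp: bounded_fn_def)
  have "filtermap f ?U \<noteq> bot" using U(1) by (simp add: filtermap_bot_iff)
  moreover have "eventually (\<lambda>y. y \<in> {-C..C}) (filtermap f ?U)"
    using C by (auto simp: eventually_filtermap abs_le_iff minus_le_iff intro!: always_eventually)
  ultimately obtain l where l: "inf (nhds l) (filtermap f ?U) \<noteq> bot"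
    using compact_Icc[of "-C" C] unfolding compact_filter by blast
  have "(f \<longlongrightarrow> l) ?U"
  proof (rule topological_tendstoI)
    fix S :: "real set" assume S: "open S" "l \<in> S"
    show "eventually (\<lambda>x. f x \<in> S) ?U"
    proof (rule ccontr)
      assume "\<not> eventually (\<lambda>x. f x \<in> S) ?U"
      then have "eventually (\<lambda>x. f x \<notin> S) ?U" using U(3)[of "\<lambda>x. f x \<in> S"] by blast
      then have "eventually (\<lambda>y. y \<notin> S) (filtermap f ?U)" by (simp add: eventually_filtermap)
      moreover have "eventually (\<lambda>y. y \<in> S) (nhds l)" using S by (rule eventually_nhds_in_open)
      ultimately have "eventually (\<lambda>y. False) (inf (nhds l) (filtermap f ?U))"
        unfolding eventually_inf by blast
      then show False using l by (simp add: trivial_limit_def)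
    qed
  qed
  then show ?thesis unfolding ulim_def by (metis tendsto_Lim[OF U(1)])
qed

lemma ulim_eq:
  assumes "F \<noteq> bot" "(f \<longlongrightarrow> l) F"
  shows "ulim F f = l"
  unfolding ulim_def using ultra[OF assms(1)] assms(2) by (meson tendsto_Lim tendsto_mono)

lemma mean_ulim:
  assumes F: "F \<noteq> bot"
  shows "mean (ulim F)"
proof -
  note U = ultra[OF F]
  show ?thesis
    unfolding mean_def
  proof (intro conjI allI impI)
    fix f g :: "'a \<Rightarrow> real" and c :: real assume f: "bounded_fn f"
    show "ulim F (\<lambda>x. c * f x) = c * ulim F f"
      using tendsto_Lim[OF U(1) tendsto_mult_left[OF ulim_tendsto[OF F f]]] by (simp add: ulim_def)
    assume g: "bounded_fn g"
    show "ulim F (\<lambda>x. f x + g x) = ulim F f + ulim F g"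
      using tendsto_Lim[OF U(1) tendsto_add[OF ulim_tendsto[OF F f] ulim_tendsto[OF F g]]] by (simp add: ulim_def)
    assume "\<forall>x. f x \<le> g x"
    then show "ulim F f \<le> ulim F g"
      by (intro tendsto_le[OF U(1) ulim_tendsto[OF F g] ulim_tendsto[OF F f]]) auto
  next
    show "ulim F (\<lambda>_. 1) = 1" by (rule ulim_eq[OF F]) simp
  qed
qed

text \<open>The position is averaged with the finite set held fixed, and the finite set tends to
  infinity last, so any single element may be assumed to lie in it. Averaging over
  \<open>Suc n\<close> terms gives every average total mass 1, including the first.\<close>

definition cesaro :: "('x set \<times> nat \<Rightarrow> real) \<Rightarrow> real" where
  "cesaro f = ulim (finite_subsets_at_top UNIV)
     (\<lambda>G. ulim sequentially (\<lambda>n. 1 / real (Suc n) * (\<Sum>k<Suc n. f (G, k))))"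

lemma mean_cesaro: "mean cesaro"
proof -
  have av: "mean (\<lambda>f. 1 / real (Suc n) * (\<Sum>k<Suc n. f (G, k)))" for n and G :: "'x set"
    unfolding mean_def
  proof (intro conjI allI impI)
    fix f g :: "'x set \<times> nat \<Rightarrow> real" and c :: real
    show "1 / real (Suc n) * (\<Sum>k<Suc n. c * f (G, k)) = c * (1 / real (Suc n) * (\<Sum>k<Suc n. f (G, k)))"
      by (simp only: sum_distrib_left[symmetric] mult.left_commute)
    show "1 / real (Suc n) * (\<Sum>k<Suc n. f (G, k) + g (G, k))
        = 1 / real (Suc n) * (\<Sum>k<Suc n. f (G, k)) + 1 / real (Suc n) * (\<Sum>k<Suc n. g (G, k))"
      by (simp only: sum.distrib distrib_left)
    assume "\<forall>x. f x \<le> g x"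
    then show "1 / real (Suc n) * (\<Sum>k<Suc n. f (G, k)) \<le> 1 / real (Suc n) * (\<Sum>k<Suc n. g (G, k))"
      by (intro mult_left_mono sum_mono) simp_all
  next
    show "1 / real (Suc n) * (\<Sum>k<Suc n. 1) = 1" by (simp only: sum_constant card_lessThan) simp
  qed
  show ?thesis
    unfolding cesaro_def
    by (rule mean_mixture[OF mean_ulim mean_mixture[OF mean_ulim av]]) simp_all
qed

text \<open>The finite sets containing \<open>x\<close> are eventual in the outer limit, so only
  they matter; for these the ultrafilter limit in the position extends the ordinary one.\<close>

lemma cesaro_eq:
  assumes "\<And>G. finite G \<Longrightarrow> x \<in> G \<Longrightarrow> (\<lambda>n. (\<Sum>k<n. f (G, k)) / real n) \<longlonglongrightarrow> l"
  shows "cesaro f = l"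
proof -
  have "ulim sequentially (\<lambda>n. 1 / real (Suc n) * (\<Sum>k<Suc n. f (G, k))) = l" if "finite G" "x \<in> G" for G
    using LIMSEQ_Suc[OF assms[OF that]] by (intro ulim_eq) simp_all
  moreover have "eventually (\<lambda>G. finite G \<and> x \<in> G) (finite_subsets_at_top UNIV)"
    unfolding eventually_finite_subsets_at_top by (intro exI[of _ "{x}"]) auto
  ultimately have "eventually (\<lambda>G. ulim sequentially (\<lambda>n. 1 / real (Suc n) * (\<Sum>k<Suc n. f (G, k))) = l)
      (finite_subsets_at_top UNIV)"
    by (auto elim: eventually_mono)
  then show ?thesis unfolding cesaro_def by (intro ulim_eq tendsto_eventually) simp_all
qed

section \<open>Iterated means on a power\<close>

text \<open>The filter of final segments. For a linear order it is principal at the greatest element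
  of \<open>X\<close> if there is one, so successor and limit steps of the recursion below need no
  distinction.\<close>

definition tail :: "'s rel \<Rightarrow> 's set \<Rightarrow> 's filter" where
  "tail r X = (INF b\<in>X. principal {c \<in> X. (b, c) \<in> r})"

locale iterated_mean =
  fixes r :: "'s rel" and J :: "('j \<Rightarrow> real) \<Rightarrow> real"
  assumes wo: "Well_order r" and J: "mean J"
begin

text \<open>The limit of the functionals \<open>L b\<close> as \<open>b\<close> increases through
  \<open>X\<close>. The default, evaluation at a fixed point, is itself a mean, and it makes the
  value depend on \<open>L\<close> only through its restriction to \<open>X\<close>, as well-founded
  recursion requires.\<close>

definition upto :: "('s \<Rightarrow> (('s \<Rightarrow> 'j) \<Rightarrow> real) \<Rightarrow> real) \<Rightarrow> 's set \<Rightarrow> (('s \<Rightarrow> 'j) \<Rightarrow> real) \<Rightarrow> real" where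
  "upto L X f = (if X = {} then f undefined
     else ulim (tail r X) (\<lambda>b. if b \<in> X then L b f else f undefined))"

text \<open>\<open>stage a\<close> integrates over the coordinates up to \<open>a\<close>, the last coordinate being the outermost
  one; the remaining coordinates are frozen at an arbitrary value.\<close>

definition stage :: "'s \<Rightarrow> (('s \<Rightarrow> 'j) \<Rightarrow> real) \<Rightarrow> real" where
  "stage = wfrec (r - Id) (\<lambda>L a f. J (\<lambda>j. upto L (underS r a) (\<lambda>w. f (w(a := j)))))"

definition total :: "(('s \<Rightarrow> 'j) \<Rightarrow> real) \<Rightarrow> real" where
  "total = upto stage (Field r)"

definition depends :: "'s \<Rightarrow> (('s \<Rightarrow> 'j) \<Rightarrow> 'b) \<Rightarrow> bool" where
  "depends a f \<longleftrightarrow> (\<forall>w w'. (\<forall>b. (b, a) \<in> r \<longrightarrow> w b = w' b) \<longrightarrow> f w = f w')"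

lemma stage_unfold: "stage a f = J (\<lambda>j. upto stage (underS r a) (\<lambda>w. f (w(a := j))))"
proof -
  have wf: "wf (r - Id)" using wo by (simp add: well_order_on_def)
  \<comment> \<open>The recursive call sees only the stages strictly below \<open>a\<close>, and
    \<open>upto\<close> over \<open>underS r a\<close> consults no others.\<close>
  have "upto (cut stage (r - Id) a) (underS r a) g = upto stage (underS r a) g" for g
    unfolding upto_def by (auto simp: cut_def underS_def intro!: arg_cong[where f="ulim _"])
  then show ?thesis
    by (subst stage_def, subst wfrec[OF wf]) (simp add: stage_def[symmetric])
qed

lemma r_refl: "a \<in> Field r \<Longrightarrow> (a, a) \<in> r"
  and r_trans: "(a, b) \<in> r \<Longrightarrow> (b, c) \<in> r \<Longrightarrow> (a, c) \<in> r"
  and r_antisym: "(a, b) \<in> r \<Longrightarrow> (b, a) \<in> r \<Longrightarrow> a = b"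
  and r_total: "a \<in> Field r \<Longrightarrow> b \<in> Field r \<Longrightarrow> (a, b) \<in> r \<or> (b, a) \<in> r"
  using wo
  by (auto simp: well_order_on_def linear_order_on_def partial_order_on_def preorder_on_def refl_on_def
      total_on_def dest: transD antisymD) metis

lemma tail:
  assumes X: "X \<subseteq> Field r" "X \<noteq> {}"
  shows "tail r X \<noteq> bot" "b \<in> X \<Longrightarrow> eventually (\<lambda>c. c \<in> X \<and> (b, c) \<in> r) (tail r X)"
proof -
  have base: "eventually P (tail r X) \<longleftrightarrow> (\<exists>b\<in>X. eventually P (principal {c \<in> X. (b, c) \<in> r}))" for P
    unfolding tail_def
  proof (rule eventually_INF_base[OF X(2)])
    fix a b assume ab: "a \<in> X" "b \<in> X"
    then consider "(a, b) \<in> r" | "(b, a) \<in> r" using X r_total by blast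
    then show "\<exists>x\<in>X. principal {c \<in> X. (x, c) \<in> r}
        \<le> inf (principal {c \<in> X. (a, c) \<in> r}) (principal {c \<in> X. (b, c) \<in> r})"
    proof cases
      case 1
      then show ?thesis using ab r_trans by (intro bexI[of _ b]) auto
    next
      case 2
      then show ?thesis using ab r_trans by (intro bexI[of _ a]) auto
    qed
  qed
  show "tail r X \<noteq> bot"
    using X r_refl by (auto simp: trivial_limit_def base eventually_principal)
  show "eventually (\<lambda>c. c \<in> X \<and> (b, c) \<in> r) (tail r X)" if "b \<in> X"
    unfolding base using that by (auto simp: eventually_principal)
qed

lemma mean_upto:
  assumes "X \<subseteq> Field r" "\<And>b. b \<in> X \<Longrightarrow> mean (L b)"
  shows "mean (upto L X)"
proof (cases "X = {}")
  case True
  then have "upto L X = (\<lambda>f. f undefined)" by (auto simp: upto_def)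
  then show ?thesis by (simp add: mean_eval)
next
  case False
  have "mean (\<lambda>f. ulim (tail r X) (\<lambda>b. (if b \<in> X then L b else (\<lambda>f. f undefined)) f))"
    by (rule mean_mixture[OF mean_ulim[OF tail(1)[OF assms(1) False]]]) (use assms(2) mean_eval in auto)
  moreover have "upto L X = (\<lambda>f. ulim (tail r X) (\<lambda>b. (if b \<in> X then L b else (\<lambda>f. f undefined)) f))"
    using False by (auto simp: upto_def fun_eq_iff intro!: arg_cong[where f="ulim _"])
  ultimately show ?thesis by simp
qed

lemma wf_induct_r: "(\<And>a. (\<And>b. b \<in> underS r a \<Longrightarrow> P b) \<Longrightarrow> P a) \<Longrightarrow> P a"
proof -
  assume *: "\<And>a. (\<And>b. b \<in> underS r a \<Longrightarrow> P b) \<Longrightarrow> P a"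
  have wf: "wf (r - Id)" using wo by (simp add: well_order_on_def)
  show "P a" by (induction a rule: wf_induct_rule[OF wf]) (use * in \<open>auto simp: underS_def\<close>)
qed

lemma mean_stage: "mean (stage a)"
proof (induction a rule: wf_induct_r)
  case (1 a)
  have "stage a = (\<lambda>f. J (\<lambda>j. upto stage (underS r a) (\<lambda>w. f (w(a := j)))))"
    by (simp add: fun_eq_iff stage_unfold)
  moreover have "underS r a \<subseteq> Field r" by (auto simp: underS_def Field_def)
  ultimately show ?case
    using mean_mixture[OF J mean_image[OF mean_upto[OF _ 1]]] by simp
qed

lemma mean_total: "mean total"
  unfolding total_def by (intro mean_upto mean_stage) simp

lemma depends_mono: "depends a f \<Longrightarrow> (a, b) \<in> r \<Longrightarrow> depends b f"
  unfolding depends_def by (meson r_trans)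

lemma upto_eq:
  assumes "X \<subseteq> Field r" "b \<in> X" "\<And>c. c \<in> X \<Longrightarrow> (b, c) \<in> r \<Longrightarrow> L c f = l"
  shows "upto L X f = l"
proof -
  have X: "X \<noteq> {}" using assms(2) by auto
  have "eventually (\<lambda>c. (if c \<in> X then L c f else f undefined) = l) (tail r X)"
    using tail(2)[OF assms(1) X assms(2)] by eventually_elim (use assms(3) in auto)
  then have "ulim (tail r X) (\<lambda>c. if c \<in> X then L c f else f undefined) = l"
    by (intro ulim_eq[OF tail(1)[OF assms(1) X]] tendsto_eventually)
  then show ?thesis using X by (simp add: upto_def)
qed

text \<open>Well-founded induction on \<open>a\<close>. Above \<open>b\<close> the function ignores
  the coordinate \<open>a\<close>, the stages from \<open>b\<close> up to below \<open>a\<close> all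
  give the same value, hence so does their limit, and \<open>J\<close> preserves constants.\<close>

lemma stage_depends:
  assumes "depends b f" "(b, a) \<in> r"
  shows "stage a f = stage b f"
  using assms(2)
proof (induction a rule: wf_induct_r)
  case (1 a)
  show ?case
  proof (cases "a = b")
    case False
    then have ba: "b \<in> underS r a" using 1 by (auto simp: underS_def)
    have U: "underS r a \<subseteq> Field r" by (auto simp: underS_def Field_def)
    have "(\<lambda>w. f (w(a := j))) = f" for j
    proof
      fix w show "f (w(a := j)) = f w"
        using assms(1) 1(2) False r_antisym unfolding depends_def by (metis fun_upd_apply)
    qed
    moreover have "upto stage (underS r a) f = stage b f"
      by (rule upto_eq[OF U ba]) (use 1 in blast)
    ultimately show ?thesis by (simp add: stage_unfold[of a] mean_const[OF J])
  qed simp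
qed

lemma total_depends:
  assumes "depends b f" "b \<in> Field r"
  shows "total f = stage b f"
  unfolding total_def by (rule upto_eq) (use assms stage_depends in auto)

text \<open>The form of Fubini built into the recursion: stage \<open>a\<close> integrates its own
  coordinate outermost. For a frozen value \<open>j\<close> the function \<open>h j\<close> lives on
  the coordinates up to \<open>b\<close>, so the stages below \<open>a\<close> have already computed
  its total.\<close>

lemma total_fubini:
  assumes h: "\<And>j. depends b (h j)" and ba: "(b, a) \<in> r" "b \<noteq> a"
  shows "total (\<lambda>w. h (w a) w) = J (\<lambda>j. total (h j))"
proof -
  have F: "a \<in> Field r" "b \<in> Field r" using ba by (auto simp: Field_def)
  have U: "underS r a \<subseteq> Field r" by (auto simp: underS_def Field_def)
  have b: "b \<in> underS r a" using ba by (auto simp: underS_def)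
  have e: "(\<lambda>w. h j (w(a := j))) = h j" for j
  proof
    fix w show "h j (w(a := j)) = h j w"
      using h ba r_antisym unfolding depends_def by (metis fun_upd_apply)
  qed
  have "depends a (\<lambda>w. h (w a) w)"
    using h[THEN depends_mono, OF ba(1)] r_refl[OF F(1)] unfolding depends_def by metis
  then have "total (\<lambda>w. h (w a) w) = stage a (\<lambda>w. h (w a) w)" by (rule total_depends[OF _ F(1)])
  also have "\<dots> = J (\<lambda>j. upto stage (underS r a) (h j))" by (simp add: stage_unfold[of a] e)
  also have "\<dots> = J (\<lambda>j. total (h j))"
    using upto_eq[OF U b, of stage] stage_depends[OF h] total_depends[OF h F(2)] by simp
  finally show ?thesis .
qed

end


section \<open>The charge of a mean\<close>

text \<open>\<open>L_cong\<close> says that the mean, a functional on functions on the whole type,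
  is carried by \<open>I\<close>.\<close>

locale charge_of_mean =
  fixes I :: "'i set" and \<A> :: "'i set set" and L :: "('i \<Rightarrow> real) \<Rightarrow> real"
  assumes alg: "algebra I \<A>" and L: "mean L"
    and L_cong: "\<And>f g. (\<And>i. i \<in> I \<Longrightarrow> f i = g i) \<Longrightarrow> L f = L g"
begin

definition charge :: "'i set \<Rightarrow> real" where
  "charge X = L (indicator X)"

lemma bounded_fn_indicator [simp]: "bounded_fn (indicator X)"
  by (rule bounded_fnI[where C=1]) (simp add: indicator_def)

lemma charge_space_charge: "charge_space I \<A> charge"
  unfolding charge_space_def
proof (intro conjI ballI alg)
  show "0 \<le> charge X" for X
    using mean_mono[OF L, of "\<lambda>_. 0" "indicator X"] by (simp add: charge_def mean_const[OF L])
  have "L (indicator (X \<union> Y)) = L (indicator X) + L (indicator Y)" if "X \<inter> Y = {}" for X Y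
  proof -
    have "(indicator (X \<union> Y) :: _ \<Rightarrow> real) = (\<lambda>i. indicator X i + indicator Y i)"
      using that by (auto simp: indicator_def fun_eq_iff)
    then show ?thesis by (simp add: mean_add[OF L])
  qed
  then show "additive \<A> charge" by (simp add: additive_def charge_def)
  have "L (indicator I) = L (\<lambda>_. 1)" by (rule L_cong) simp
  then show "charge I = 1" by (simp add: charge_def mean_const[OF L])
qed

lemma simple_charge_integral_eq:
  assumes "charge_simple I \<A> s"
  shows "simple_charge_integral I charge s = L s"
proof -
  have fin: "finite (s ` I)" using assms by (simp add: charge_simple_def)
  have "L s = L (\<lambda>i. \<Sum>y\<in>s ` I. y * indicator {i \<in> I. s i = y} i)"
  proof (rule L_cong)
    fix i assume i: "i \<in> I"
    have "(\<Sum>y\<in>s ` I. y * indicator {i \<in> I. s i = y} i) = (\<Sum>y\<in>s ` I. if y = s i then y else 0)"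
      using i by (intro sum.cong) (auto simp: indicator_def)
    then show "s i = (\<Sum>y\<in>s ` I. y * indicator {i \<in> I. s i = y} i)" using i fin by simp
  qed
  also have "\<dots> = (\<Sum>y\<in>s ` I. y * charge {i \<in> I. s i = y})"
    by (simp add: mean_sum[OF L] mean_scale[OF L] charge_def)
  finally show ?thesis by (simp add: simple_charge_integral_def)
qed

lemma mean_uniform_limit:
  assumes lim: "uniform_limit I s f sequentially"
    and s: "\<And>n. \<exists>C. \<forall>i\<in>I. \<bar>s n i\<bar> \<le> C" and f: "\<exists>C. \<forall>i\<in>I. \<bar>f i\<bar> \<le> C"
  shows "(\<lambda>n. L (s n)) \<longlonglongrightarrow> L f"
proof -
  \<comment> \<open>Means are controlled only on functions bounded on the whole type; cutting off to
    0 outside \<open>I\<close> achieves this and leaves the value of \<open>L\<close>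
    unchanged.\<close>
  define z where "z = (\<lambda>(g :: 'i \<Rightarrow> real) i. if i \<in> I then g i else 0)"
  have Lz: "L (z g) = L g" for g by (rule L_cong) (simp add: z_def)
  have bz: "bounded_fn (z g)" if "\<exists>C. \<forall>i\<in>I. \<bar>g i\<bar> \<le> C" for g
  proof -
    obtain C where "\<forall>i\<in>I. \<bar>g i\<bar> \<le> C" using \<open>\<exists>C. \<forall>i\<in>I. \<bar>g i\<bar> \<le> C\<close> by (rule exE)
    then show ?thesis by (intro bounded_fnI[where C="max C 0"]) (auto simp: z_def)
  qed
  show ?thesis
  proof (rule metric_LIMSEQ_I)
    fix \<epsilon> :: real assume \<epsilon>: "0 < \<epsilon>"
    have "\<forall>\<^sub>F n in sequentially. \<forall>i\<in>I. dist (s n i) (f i) < \<epsilon> / 2"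
      using lim \<epsilon> half_gt_zero unfolding uniform_limit_iff by blast
    then obtain N where N: "\<And>n i. n \<ge> N \<Longrightarrow> i \<in> I \<Longrightarrow> dist (s n i) (f i) < \<epsilon> / 2"
      by (auto simp: eventually_sequentially)
    have "dist (L (s n)) (L f) < \<epsilon>" if n: "n \<ge> N" for n
    proof -
      have "\<bar>L (\<lambda>i. z (s n) i - z f i)\<bar> \<le> \<epsilon> / 2"
        by (rule mean_abs_le[OF L]) (use N[OF n] \<epsilon> in \<open>auto simp: z_def dist_real_def less_imp_le\<close>)
      then have "\<bar>L (s n) - L f\<bar> \<le> \<epsilon> / 2" by (simp add: mean_diff[OF L bz[OF s] bz[OF f]] Lz)
      then show ?thesis using \<epsilon> by (simp add: dist_real_def)
    qed
    then show "\<exists>no. \<forall>n\<ge>no. dist (L (s n)) (L f) < \<epsilon>" by blast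
  qed
qed

text \<open>Rounding \<open>f\<close> down to multiples of \<open>1 / real (Suc n)\<close> gives
  simple functions converging uniformly, and a mean is continuous for uniform convergence. The same
  continuity shows that every other approximating sequence yields the same limit.\<close>

lemma charge_integral_eq:
  assumes C: "\<And>i. i \<in> I \<Longrightarrow> \<bar>f i\<bar> \<le> C" and m: "\<And>u v. {i \<in> I. u \<le> f i \<and> f i < v} \<in> \<A>"
  shows "charge_integral I \<A> charge f = L f"
proof -
  have f: "\<exists>C. \<forall>i\<in>I. \<bar>f i\<bar> \<le> C" using C by blast
  have bs: "\<exists>C. \<forall>i\<in>I. \<bar>s i\<bar> \<le> C" if "charge_simple I \<A> s" for s
  proof -
    have "finite (abs ` s ` I)" using that by (simp add: charge_simple_def)
    then have "\<bar>s i\<bar> \<le> Max (abs ` s ` I)" if "i \<in> I" for i by (rule Max_ge) (use that in auto)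
    then show ?thesis by blast
  qed
  define s where "s = (\<lambda>n i. of_int \<lfloor>f i * real (Suc n)\<rfloor> / real (Suc n))"
  \<comment> \<open>The level sets of the rounded function are half-open strips of \<open>f\<close>,
    which are exactly the sets that \<open>m\<close> puts into the algebra.\<close>
  have iff: "s n i = of_int k / real (Suc n) \<longleftrightarrow>
      of_int k / real (Suc n) \<le> f i \<and> f i < (of_int k + 1) / real (Suc n)" for n i and k :: int
  proof -
    have "s n i = of_int k / real (Suc n) \<longleftrightarrow> \<lfloor>f i * real (Suc n)\<rfloor> = k" by (simp add: s_def)
    also have "\<dots> \<longleftrightarrow> of_int k \<le> f i * real (Suc n) \<and> f i * real (Suc n) < of_int k + 1"
      by (simp only: floor_eq_iff)
    also have "\<dots> \<longleftrightarrow> of_int k / real (Suc n) \<le> f i \<and> f i < (of_int k + 1) / real (Suc n)"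
      by (simp add: pos_divide_le_eq pos_less_divide_eq del: of_nat_Suc)
    finally show ?thesis .
  qed
  have simple: "charge_simple I \<A> (s n)" for n
    unfolding charge_simple_def
  proof (intro conjI allI)
    define N where "N = \<lceil>C * real (Suc n)\<rceil> + 1"
    have "s n i \<in> (\<lambda>k::int. of_int k / real (Suc n)) ` {-N..N}" if i: "i \<in> I" for i
    proof -
      have "\<bar>f i * real (Suc n)\<bar> \<le> C * real (Suc n)"
        unfolding abs_mult using C[OF i] by (simp del: of_nat_Suc)
      then have "\<lfloor>f i * real (Suc n)\<rfloor> \<in> {-N..N}" unfolding N_def atLeastAtMost_iff by linarith
      then show ?thesis by (auto simp: s_def)
    qed
    then show "finite (s n ` I)" by (meson finite_surj finite_atLeastAtMost_int image_subsetI)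
    fix y
    show "{i \<in> I. s n i = y} \<in> \<A>"
    proof (cases "\<exists>k::int. y = of_int k / real (Suc n)")
      case True
      then obtain k :: int where "y = of_int k / real (Suc n)" by blast
      then show ?thesis using m by (simp only: iff)
    next
      case False
      then have "{i \<in> I. s n i = y} = {}" by (auto simp: s_def)
      moreover have "{} \<in> \<A>" using alg by (simp add: algebra_iff_Un)
      ultimately show ?thesis by (simp only:)
    qed
  qed
  have lim: "uniform_limit I s f sequentially"
  proof (rule uniform_limitI)
    fix e :: real assume "0 < e"
    then have "\<forall>\<^sub>F n in sequentially. 1 / real (Suc n) < e"
      using order_tendstoD(2)[OF LIMSEQ_inverse_real_of_nat] by (simp add: inverse_eq_divide)
    then show "\<forall>\<^sub>F n in sequentially. \<forall>i\<in>I. dist (s n i) (f i) < e"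
    proof eventually_elim
      case (elim n)
      have "dist (s n i) (f i) \<le> 1 / real (Suc n)" for i
        using iff[of n i "\<lfloor>f i * real (Suc n)\<rfloor>"] by (simp add: s_def dist_real_def add_divide_distrib)
      then show ?case using elim le_less_trans by blast
    qed
  qed
  have "has_charge_integral I \<A> charge f (L f)"
    unfolding has_charge_integral_def
    using simple lim mean_uniform_limit[OF lim bs[OF simple] f]
    by (intro exI[of _ s]) (simp add: simple_charge_integral_eq)
  moreover have "l = L f" if l: "has_charge_integral I \<A> charge f l" for l
  proof -
    obtain t where t: "\<And>n. charge_simple I \<A> (t n)" and lt: "uniform_limit I t f sequentially"
      and tl: "(\<lambda>n. simple_charge_integral I charge (t n)) \<longlonglongrightarrow> l"
      using l by (auto simp: has_charge_integral_def)
    show ?thesis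
      using LIMSEQ_unique[OF tl] mean_uniform_limit[OF lt bs[OF t] f]
      by (simp add: simple_charge_integral_eq[OF t])
  qed
  ultimately show ?thesis unfolding charge_integral_def by (rule the_equality)
qed

end

section \<open>The algebra of sets that depend on boundedly many coordinates\<close>

text \<open>The coordinates are elements of \<open>'q set\<close> because \<open>cardSuc k\<close>
  is a relation on that type. The injection \<open>e\<close> copies the power into a prescribed
  index type; the index set is its range.\<close>

locale tower =
  fixes k :: "'q rel" and J :: "('j \<Rightarrow> real) \<Rightarrow> real" and e :: "('q set \<Rightarrow> 'j) \<Rightarrow> 'i"
  assumes k: "Card_order k" "infinite (Field k)" and mean_J: "mean J" and inj_e: "inj e"
begin

abbreviation "r \<equiv> cardSuc k"

sublocale iterated_mean r J
proof
  show "Well_order r" using cardSuc_Card_order[OF k(1)] card_order_on_well_order_on by blast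
qed (rule mean_J)

definition dep :: "'q set \<Rightarrow> ('i \<Rightarrow> 'b) \<Rightarrow> bool" where
  "dep a f \<longleftrightarrow> depends a (\<lambda>w. f (e w))"

definition bdep :: "('i \<Rightarrow> 'b) \<Rightarrow> bool" where
  "bdep f \<longleftrightarrow> (\<exists>a\<in>Field r. dep a f)"

definition \<A> :: "'i set set" where
  "\<A> = {X. X \<subseteq> range e \<and> bdep (\<lambda>i. i \<in> X)}"

definition L :: "('i \<Rightarrow> real) \<Rightarrow> real" where
  "L f = total (\<lambda>w. f (e w))"

lemma dep_mono: "dep a f \<Longrightarrow> (a, b) \<in> r \<Longrightarrow> dep b f"
  unfolding dep_def by (rule depends_mono)

lemma dep_comp: "dep a f \<Longrightarrow> dep a (\<lambda>i. g (f i))"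
  unfolding dep_def depends_def by metis

lemma bdep_comp: "bdep f \<Longrightarrow> bdep (\<lambda>i. g (f i))"
  using dep_comp unfolding bdep_def by blast

lemma dep_cong: "dep a f \<Longrightarrow> (\<And>i. i \<in> range e \<Longrightarrow> f i = g i) \<Longrightarrow> dep a g"
  unfolding dep_def depends_def by auto

lemma bdep_cong: "bdep f \<Longrightarrow> (\<And>i. i \<in> range e \<Longrightarrow> f i = g i) \<Longrightarrow> bdep g"
  using dep_cong unfolding bdep_def by blast

text \<open>Regularity of the successor cardinal \<open>r\<close>: a set of size at most
  \<open>k\<close> covered by an increasing chain along \<open>r\<close> is contained in one member
  of the chain.\<close>

lemma bdep_family:
  assumes X: "|X| \<le>o k" and f: "\<And>x. x \<in> X \<Longrightarrow> bdep (f x)"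
  obtains a where "a \<in> Field r" "\<And>x. x \<in> X \<Longrightarrow> dep a (f x)"
proof -
  have "\<exists>a\<in>Field r. X \<subseteq> {x. dep a (f x)}"
  proof (rule cardSuc_UNION[OF k _ _ X])
    show "relChain r (\<lambda>a. {x. dep a (f x)})" using dep_mono by (auto simp: relChain_def)
    show "X \<subseteq> (\<Union>a\<in>Field r. {x. dep a (f x)})" using f by (auto simp: bdep_def)
  qed
  then show ?thesis using that by blast
qed

lemma nat_ordLeq: "|X :: nat set| \<le>o k"
proof -
  have "|UNIV :: nat set| \<le>o |Field k|" using k(2) infinite_iff_card_of_nat by blast
  moreover have "|Field k| =o k" by (rule card_of_Field_ordIso[OF k(1)])
  moreover have "|X| \<le>o |UNIV :: nat set|" by (rule card_of_mono1) simp
  ultimately show ?thesis by (meson ordLeq_ordIso_trans ordLeq_transitive)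
qed

text \<open>Bundles up to \<open>k\<close> many maps into a single one, so that
  \<open>bdep_comp\<close> then yields closure under arbitrary operations of that many arguments.
  Restriction to \<open>X\<close> keeps other members of the family from entering.\<close>

lemma bdep_family_fun:
  assumes X: "|X| \<le>o k" and f: "\<And>x. x \<in> X \<Longrightarrow> bdep (f x)"
  shows "bdep (\<lambda>i. \<lambda>x\<in>X. f x i)"
proof -
  obtain a where a: "a \<in> Field r" "\<And>x. x \<in> X \<Longrightarrow> dep a (f x)" using bdep_family[of X f] X f by blast
  have "dep a (\<lambda>i. \<lambda>x\<in>X. f x i)"
    using a(2) unfolding dep_def depends_def by (metis (mono_tags, lifting) restrict_ext)
  then show ?thesis using a(1) by (auto simp: bdep_def)
qed

lemma Field_r_nonempty: "Field r \<noteq> {}"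
  using cardSuc_finite[OF k(1)] k(2) by auto

lemma bdep_const: "bdep (\<lambda>_. c)"
  using Field_r_nonempty by (auto simp: bdep_def dep_def depends_def)

lemma bdep_pair:
  assumes "bdep f" "bdep g"
  shows "bdep (\<lambda>i. (f i, g i))"
proof -
  obtain a b where ab: "a \<in> Field r" "dep a f" "b \<in> Field r" "dep b g"
    using assms by (auto simp: bdep_def)
  then consider "(a, b) \<in> r" | "(b, a) \<in> r" using r_total by blast
  then obtain c where "c \<in> Field r" "dep c f" "dep c g"
    by cases (use ab dep_mono in blast)+
  then show ?thesis unfolding bdep_def dep_def depends_def by (metis (no_types, lifting))
qed

lemma mean_L: "mean L"
proof -
  have "L = (\<lambda>f. total (\<lambda>w. f (e w)))" by (simp add: fun_eq_iff L_def)
  then show ?thesis using mean_image[OF mean_total] by simp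
qed

lemma union_mem:
  assumes "\<C> \<subseteq> \<A>" "|\<C>| \<le>o k"
  shows "\<Union>\<C> \<in> \<A>"
proof -
  have "bdep (\<lambda>i. \<lambda>X\<in>\<C>. i \<in> X)"
    by (rule bdep_family_fun[OF assms(2)]) (use assms(1) in \<open>auto simp: \<A>_def\<close>)
  then have "bdep (\<lambda>i. \<exists>X\<in>\<C>. (\<lambda>X\<in>\<C>. i \<in> X) X)" by (rule bdep_comp)
  then have "bdep (\<lambda>i. i \<in> \<Union>\<C>)" by (rule bdep_cong) auto
  then show ?thesis using assms(1) by (auto simp: \<A>_def)
qed

lemma suc_complete_le:
  assumes "c \<le>o k"
  shows "suc_complete \<A> c"
  unfolding suc_complete_def using union_mem assms ordLeq_transitive by blast

lemma algebra_\<A>: "algebra (range e) \<A>"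
  unfolding algebra_iff_Un
proof (intro conjI ballI)
  show "\<A> \<subseteq> Pow (range e)" by (auto simp: \<A>_def)
  show "{} \<in> \<A>" by (simp add: \<A>_def bdep_const)
next
  fix X assume X: "X \<in> \<A>"
  have "bdep (\<lambda>i. \<not> i \<in> X)" by (rule bdep_comp) (use X in \<open>simp add: \<A>_def\<close>)
  then have "bdep (\<lambda>i. i \<in> range e - X)" by (rule bdep_cong) auto
  then show "range e - X \<in> \<A>" by (auto simp: \<A>_def)
  fix Y assume Y: "Y \<in> \<A>"
  have "bdep (\<lambda>i. (i \<in> X, i \<in> Y))" by (rule bdep_pair) (use X Y in \<open>auto simp: \<A>_def\<close>)
  then have "bdep (\<lambda>i. fst (i \<in> X, i \<in> Y) \<or> snd (i \<in> X, i \<in> Y))" by (rule bdep_comp)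
  then show "X \<union> Y \<in> \<A>" using X Y by (auto simp: \<A>_def)
qed

sublocale charge_of_mean "range e" \<A> L
proof (rule charge_of_mean.intro)
  fix f g :: "'i \<Rightarrow> real" assume "\<And>i. i \<in> range e \<Longrightarrow> f i = g i"
  then show "L f = L g" by (simp add: L_def)
qed (rule algebra_\<A> mean_L)+

lemma charge_integral_bdep:
  assumes "\<And>i. i \<in> range e \<Longrightarrow> \<bar>f i\<bar> \<le> C" "bdep f"
  shows "charge_integral (range e) \<A> charge f = L f"
proof (rule charge_integral_eq)
  fix u v
  have "bdep (\<lambda>i. u \<le> f i \<and> f i < v)" using assms(2) by (rule bdep_comp)
  then have "bdep (\<lambda>i. i \<in> {i \<in> range e. u \<le> f i \<and> f i < v})" by (rule bdep_cong) auto
  then show "{i \<in> range e. u \<le> f i \<and> f i < v} \<in> \<A>" by (auto simp: \<A>_def)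
qed (rule assms(1))

text \<open>A common bound for the at most \<open>k\<close> many tests bounds \<open>f\<close>,
  because the tests determine its value.\<close>

lemma bdep_if_separated:
  assumes X: "|X| \<le>o k" and P: "\<And>x. x \<in> X \<Longrightarrow> bdep (\<lambda>i. P x (f i))"
    and sep: "\<And>i j. i \<in> range e \<Longrightarrow> j \<in> range e \<Longrightarrow> (\<And>x. x \<in> X \<Longrightarrow> P x (f i) = P x (f j)) \<Longrightarrow> f i = f j"
  shows "bdep f"
proof -
  obtain a where a: "a \<in> Field r" "\<And>x. x \<in> X \<Longrightarrow> dep a (\<lambda>i. P x (f i))"
    using bdep_family[OF X, of "\<lambda>x i. P x (f i)"] P by blast
  have "f (e w) = f (e w')" if w: "\<forall>b. (b, a) \<in> r \<longrightarrow> w b = w' b" for w w'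
    by (rule sep) (use a(2) w in \<open>auto simp: dep_def depends_def\<close>)
  then show ?thesis using a(1) by (auto simp: bdep_def dep_def depends_def)
qed

text \<open>A map with bounded dependence pulls every subset back into the algebra. Conversely,
  balls with centres in the dense set and radii \<open>1 / real (Suc n)\<close> are at most
  \<open>k\<close> many Borel sets that separate points, so measurability forces bounded
  dependence.\<close>

lemma meas_maps_eq:
  fixes M :: "('m, 'f, 'r, 'c) mstruct"
  assumes M: "Metric_space (points M) (sdist \<tau> M)" and D: "has_dense_subset \<tau> M c" "c \<le>o k"
  shows "meas_maps \<tau> M (range e) \<A> = {a \<in> range e \<rightarrow>\<^sub>E points M. bdep a}"
proof (intro equalityI subsetI CollectI conjI)
  fix a assume "a \<in> {a \<in> range e \<rightarrow>\<^sub>E points M. bdep a}"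
  then have a: "a \<in> range e \<rightarrow>\<^sub>E points M" "bdep a" by auto
  have "a -` X \<inter> range e \<in> \<A>" for X
  proof -
    have "bdep (\<lambda>i. a i \<in> X)" by (rule bdep_comp[OF a(2)])
    then have "bdep (\<lambda>i. i \<in> a -` X \<inter> range e)" by (rule bdep_cong) auto
    then show ?thesis by (simp add: \<A>_def)
  qed
  then show "a \<in> meas_maps \<tau> M (range e) \<A>" using a by (simp add: meas_maps_def)
next
  interpret M: Metric_space "points M" "sdist \<tau> M" by (rule M)
  fix a assume a: "a \<in> meas_maps \<tau> M (range e) \<A>"
  then show aM: "a \<in> range e \<rightarrow>\<^sub>E points M" by (simp add: meas_maps_def)
  obtain D where DM: "D \<subseteq> points M" and cl: "M.mtopology closure_of D = points M" and "|D| \<le>o c"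
    using D(1) by (auto simp: has_dense_subset_def)
  then have Dk: "|D| \<le>o k" using D(2) ordLeq_transitive by blast
  show "bdep a"
  proof (rule bdep_if_separated)
    show "|D \<times> (UNIV :: nat set)| \<le>o k"
      by (rule card_of_Times_ordLeq_infinite_Field[OF k(2) Dk nat_ordLeq k(1)])
    fix x :: "'m \<times> nat"
    let ?B = "M.mball (fst x) (1 / real (Suc (snd x)))"
    have "?B \<in> sigma_sets (points M) {U. openin M.mtopology U}" by (auto intro: sigma_sets.Basic)
    then have "a -` ?B \<inter> range e \<in> \<A>" using a by (simp add: meas_maps_def)
    then have "bdep (\<lambda>i. i \<in> a -` ?B \<inter> range e)" by (simp add: \<A>_def)
    then show "bdep (\<lambda>i. a i \<in> M.mball (fst x) (1 / real (Suc (snd x))))" by (rule bdep_cong) auto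
  next
    fix i j assume ij: "i \<in> range e" "j \<in> range e"
      and eq: "\<And>x. x \<in> D \<times> UNIV \<Longrightarrow> (a i \<in> M.mball (fst x) (1 / real (Suc (snd x))))
        = (a j \<in> M.mball (fst x) (1 / real (Suc (snd x))))"
    have p: "a i \<in> points M" "a j \<in> points M" using aM ij by auto
    show "a i = a j"
    proof (rule ccontr)
      assume "a i \<noteq> a j"
      \<comment> \<open>A ball of radius below half the distance cannot contain both points; its
        centre is taken from the dense set close to \<open>a i\<close>.\<close>
      then have "0 < sdist \<tau> M (a i) (a j) / 2" using p by simp
      then obtain n where n: "1 / real (Suc n) < sdist \<tau> M (a i) (a j) / 2"
        using reals_Archimedean unfolding inverse_eq_divide by blast
      have "a i \<in> M.mtopology closure_of D" using p cl by simp
      then have "\<forall>r>0. \<exists>y\<in>D. y \<in> M.mball (a i) r" unfolding M.metric_closure_of by blast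
      moreover have "0 < 1 / real (Suc n)" by simp
      ultimately obtain d where d: "d \<in> D" "d \<in> M.mball (a i) (1 / real (Suc n))" by blast
      then have "a i \<in> M.mball d (1 / real (Suc n))" by (auto simp: M.commute)
      then have "a j \<in> M.mball d (1 / real (Suc n))" using eq[of "(d, n)"] d by simp
      then show False using d n M.triangle[OF p(1) _ p(2), of d] by (auto simp: M.in_mball)
    qed
  qed
qed

end


section \<open>Values of formulas in the powermean\<close>

text \<open>Unlike in \<open>fval_bounded\<close>, the bound does not depend on
  \<open>\<pi>\<close>. This matters because the parameters of a powermean are interpreted
  differently at each index.\<close>

lemma fval_bounded_uniform:
  assumes "signature \<tau>" "tau_structure \<tau> K" "form_over \<tau> A \<phi>"
  shows "\<exists>C. \<forall>\<pi> v. \<pi> ` A \<subseteq> points K \<longrightarrow> range v \<subseteq> points K \<longrightarrow> \<bar>fval K \<pi> v \<phi>\<bar> \<le> C"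
  using assms(3)
proof (induction \<phi>)
  case (Rel R ts)
  have "\<bar>fval K \<pi> v (Rel R ts)\<bar> \<le> rbound \<tau> R" if "\<pi> ` A \<subseteq> points K" "range v \<subseteq> points K" for \<pi> v
  proof -
    have "map (tval K \<pi> v) ts \<in> tuples K (rarity \<tau> R)"
      using Rel that tval_in[OF assms(2) that(1)] by (auto simp: tuples_def list_all_iff subset_iff)
    then show ?thesis using assms(2) Rel by (simp add: tau_structure_def)
  qed
  then show ?case by blast
next
  case (Scale c \<phi>)
  then obtain C where C: "\<forall>\<pi> v. \<pi> ` A \<subseteq> points K \<longrightarrow> range v \<subseteq> points K \<longrightarrow> \<bar>fval K \<pi> v \<phi>\<bar> \<le> C" by auto
  show ?case by (rule exI[of _ "\<bar>c\<bar> * C"]) (use C in \<open>auto simp: abs_mult mult_left_mono\<close>)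
next
  case (Plus \<phi> \<psi>)
  then obtain C D where C: "\<forall>\<pi> v. \<pi> ` A \<subseteq> points K \<longrightarrow> range v \<subseteq> points K \<longrightarrow> \<bar>fval K \<pi> v \<phi>\<bar> \<le> C"
     "\<forall>\<pi> v. \<pi> ` A \<subseteq> points K \<longrightarrow> range v \<subseteq> points K \<longrightarrow> \<bar>fval K \<pi> v \<psi>\<bar> \<le> D" by auto
  show ?case
    by (rule exI[of _ "C + D"]) (use C in \<open>auto intro!: order_trans[OF abs_triangle_ineq] add_mono\<close>)
next
  case (QSup x \<phi>)
  then obtain C where "\<forall>\<pi> v. \<pi> ` A \<subseteq> points K \<longrightarrow> range v \<subseteq> points K \<longrightarrow> \<bar>fval K \<pi> v \<phi>\<bar> \<le> C" by auto
  then have C: "\<bar>fval K \<pi> v \<phi>\<bar> \<le> C" if "\<pi> ` A \<subseteq> points K" "range v \<subseteq> points K" for \<pi> v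
    using that by blast
  have ne: "points K \<noteq> {}" using assms(2) by (simp add: tau_structure_def)
  have "\<bar>fval K \<pi> v (QSup x \<phi>)\<bar> \<le> C" if v: "\<pi> ` A \<subseteq> points K" "range v \<subseteq> points K" for \<pi> v
  proof -
    have "\<bar>fval K \<pi> (v(x := a)) \<phi>\<bar> \<le> C" if "a \<in> points K" for a
      by (rule C) (use v that in auto)
    then show ?thesis unfolding fval.simps by (intro cSup_abs_le) (use ne in auto)
  qed
  then show ?case by blast
next
  case (QInf x \<phi>)
  then obtain C where "\<forall>\<pi> v. \<pi> ` A \<subseteq> points K \<longrightarrow> range v \<subseteq> points K \<longrightarrow> \<bar>fval K \<pi> v \<phi>\<bar> \<le> C" by auto
  then have C: "\<bar>fval K \<pi> v \<phi>\<bar> \<le> C" if "\<pi> ` A \<subseteq> points K" "range v \<subseteq> points K" for \<pi> v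
    using that by blast
  have ne: "points K \<noteq> {}" using assms(2) by (simp add: tau_structure_def)
  have "\<bar>fval K \<pi> v (QInf x \<phi>)\<bar> \<le> C" if v: "\<pi> ` A \<subseteq> points K" "range v \<subseteq> points K" for \<pi> v
  proof -
    have "\<bar>fval K \<pi> (v(x := a)) \<phi>\<bar> \<le> C" if "a \<in> points K" for a
      by (rule C) (use v that in auto)
    then show ?thesis unfolding fval.simps by (intro cInf_abs_ge) (use ne in auto)
  qed
  then show ?case by blast
qed auto

text \<open>Lets the infimum case of later inductions be reduced to the supremum case.\<close>

lemma fval_QInf: "fval S \<pi> v (QInf x \<phi>) = - fval S \<pi> v (QSup x (Scale (-1) \<phi>))"
  by (simp add: Inf_real_def image_image)

text \<open>Makes a modulus compatible with means, which respect affine bounds. Continuity at 0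
  gives \<open>\<epsilon>\<close> below some \<open>\<delta>\<close>; from \<open>\<delta>\<close>
  on, the line of slope \<open>l C / \<delta>\<close> has already passed the largest value
  \<open>l C\<close>.\<close>

lemma modulus_affine_bound:
  assumes l: "modulus l" and \<epsilon>: "0 < \<epsilon>"
  obtains K where "\<And>t. 0 \<le> t \<Longrightarrow> t \<le> C \<Longrightarrow> l t \<le> \<epsilon> + K * t"
proof -
  have "continuous (at 0 within {0..}) l" "l 0 = 0"
    using l by (auto simp: modulus_def continuous_on_eq_continuous_within)
  then obtain \<delta> where \<delta>: "0 < \<delta>" "\<And>t. 0 \<le> t \<Longrightarrow> t < \<delta> \<Longrightarrow> l t < \<epsilon>"
    using \<epsilon> unfolding continuous_within_eps_delta by (force simp: dist_real_def)
  show thesis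
  proof (rule that[of "l C / \<delta>"])
    fix t assume t: "0 \<le> t" "t \<le> C"
    have lC: "0 \<le> l C" "l t \<le> l C" using l t by (auto simp: modulus_def mono_on_def)
    show "l t \<le> \<epsilon> + l C / \<delta> * t"
    proof (cases "t < \<delta>")
      case True
      then have "l t < \<epsilon>" using \<delta>(2) t by blast
      moreover have "0 \<le> l C / \<delta> * t" using lC t \<delta>(1) by simp
      ultimately show ?thesis by linarith
    next
      case False
      then have "l C * 1 \<le> l C * (t / \<delta>)" using lC \<delta>(1) by (intro mult_left_mono) auto
      then show ?thesis using lC \<epsilon> by simp
    qed
  qed
qed

text \<open>With finite additivity a null function may be positive everywhere, so there is no
  almost-everywhere argument; the affine bound gives
  \<open>\<bar>m g\<bar> \<le> \<epsilon> + K * m h = \<epsilon>\<close> instead.\<close>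

lemma mean_null_modulus:
  assumes m: "mean m" and l: "modulus l" and h: "\<And>x. 0 \<le> h x" "bounded_fn h" "m h = 0"
    and g: "bounded_fn g" "\<And>x. \<bar>g x\<bar> \<le> l (h x)"
  shows "m g = 0"
proof -
  obtain C where C: "\<And>x. \<bar>h x\<bar> \<le> C" using h(2) by (auto simp: bounded_fn_def)
  have "\<bar>m g\<bar> \<le> \<epsilon>" if \<epsilon>: "0 < \<epsilon>" for \<epsilon>
  proof -
    obtain K where K: "\<And>t. 0 \<le> t \<Longrightarrow> t \<le> C \<Longrightarrow> l t \<le> \<epsilon> + K * t"
      using modulus_affine_bound[OF l \<epsilon>] by blast
    have le: "\<bar>g x\<bar> \<le> \<epsilon> + K * h x" for x
      using K[of "h x"] g(2)[of x] h(1)[of x] C[of x] by linarith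
    have b: "bounded_fn (\<lambda>x. \<epsilon> + K * h x)" using h(2) by simp
    have e: "m (\<lambda>x. \<epsilon> + K * h x) = \<epsilon>"
      using mean_add[OF m, of "\<lambda>_. \<epsilon>" "\<lambda>x. K * h x"] h by (simp add: mean_const[OF m] mean_scale[OF m])
    have "m g \<le> \<epsilon>" using mean_mono[OF m g(1) b] le by (simp add: e abs_le_iff)
    moreover have "m (\<lambda>x. - 1 * g x) \<le> \<epsilon>" using mean_mono[OF m _ b, of "\<lambda>x. - 1 * g x"] g(1) le by (simp add: e abs_le_iff)
    ultimately show ?thesis using mean_scale[OF m g(1), of "-1"] by (simp add: abs_le_iff)
  qed
  then show ?thesis by (metis abs_le_zero_iff field_le_epsilon add_0)
qed

locale powermean_tower = tower k J e
  for k :: "'q rel" and J :: "('j \<Rightarrow> real) \<Rightarrow> real" and e :: "('q set \<Rightarrow> 'j) \<Rightarrow> 'i" +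
  fixes \<tau> :: "('f, 'r, 'c) signature" and M :: "('m, 'f, 'r, 'c) mstruct" and d :: "'d rel"
  assumes sig: "signature \<tau>" and M: "tau_structure \<tau> M"
    and dense: "has_dense_subset \<tau> M d" "d \<le>o k"
begin

abbreviation "I \<equiv> range e"
abbreviation "maps \<equiv> meas_maps \<tau> M I \<A>"
abbreviation "N \<equiv> powermean \<tau> M I \<A> charge"
abbreviation "cls a \<equiv> mean_eq \<tau> M I \<A> charge `` {a}"
abbreviation "dM \<equiv> sdist \<tau> M"

sublocale M: Metric_space "points M" dM
  using M by (simp add: tau_structure_def)

lemma maps_iff: "a \<in> maps \<longleftrightarrow> a \<in> I \<rightarrow>\<^sub>E points M \<and> bdep a"
  using meas_maps_eq[OF M.Metric_space_axioms dense] by auto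

lemma maps_in: "a \<in> maps \<Longrightarrow> a (e w) \<in> points M"
  and maps_bdep: "a \<in> maps \<Longrightarrow> bdep a"
  and maps_restrict: "a \<in> maps \<Longrightarrow> (\<lambda>i\<in>I. a i) = a"
  by (auto simp: maps_iff PiE_restrict)

lemma maps_restrictI: "(\<And>w. f (e w) \<in> points M) \<Longrightarrow> bdep f \<Longrightarrow> (\<lambda>i\<in>I. f i) \<in> maps"
  unfolding maps_iff by (auto intro: bdep_cong)

lemma charge_integral_total:
  assumes "\<And>w. \<bar>f (e w)\<bar> \<le> C" "bdep f"
  shows "charge_integral I \<A> charge f = total (\<lambda>w. f (e w))"
  using charge_integral_bdep[of f C] assms by (auto simp: L_def)

lemma dM_le_1: "\<bar>dM x y\<bar> \<le> 1"
proof (cases "x \<in> points M \<and> y \<in> points M")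
  case True
  then have "[x, y] \<in> tuples M (rarity \<tau> (dsym \<tau>))" using sig by (simp add: tuples_def signature_def)
  then have "\<bar>rint M (dsym \<tau>) [x, y]\<bar> \<le> 1" using M sig by (force simp: tau_structure_def signature_def)
  then show ?thesis by (simp add: sdist_def)
qed (auto simp: sdist_def)

lemma bounded_fn_dM [simp]: "bounded_fn (\<lambda>w. dM (f w) (g w))"
  using dM_le_1 by (rule bounded_fnI)

lemma mean_eq_iff:
  "(a, b) \<in> mean_eq \<tau> M I \<A> charge \<longleftrightarrow>
     a \<in> maps \<and> b \<in> maps \<and> total (\<lambda>w. dM (a (e w)) (b (e w))) = 0"
proof -
  have "charge_integral I \<A> charge (\<lambda>i. dM (a i) (b i)) = total (\<lambda>w. dM (a (e w)) (b (e w)))"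
    if "a \<in> maps" "b \<in> maps"
  proof (rule charge_integral_total)
    have "bdep (\<lambda>i. (a i, b i))" by (rule bdep_pair) (use that maps_bdep in auto)
    then have "bdep (\<lambda>i. dM (fst (a i, b i)) (snd (a i, b i)))" by (rule bdep_comp)
    then show "bdep (\<lambda>i. dM (a i) (b i))" by simp
  qed (rule dM_le_1)
  then show ?thesis by (auto simp: mean_eq_def)
qed

lemma total_nonneg: "bounded_fn f \<Longrightarrow> (\<And>w. 0 \<le> f w) \<Longrightarrow> 0 \<le> total f"
  using mean_mono[OF mean_total, of "\<lambda>_. 0" f] by (simp add: mean_const[OF mean_total])

lemma equiv_mean_eq: "equiv maps (mean_eq \<tau> M I \<A> charge)"
proof (rule equivI)
  show "mean_eq \<tau> M I \<A> charge \<subseteq> maps \<times> maps" by (auto simp: mean_eq_iff)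
  show "refl_on maps (mean_eq \<tau> M I \<A> charge)"
    by (auto simp: refl_on_def mean_eq_iff maps_in mean_const[OF mean_total])
  show "sym (mean_eq \<tau> M I \<A> charge)" by (auto simp: sym_def mean_eq_iff M.commute)
  show "trans (mean_eq \<tau> M I \<A> charge)"
  proof (rule transI)
    fix a b c assume ab: "(a, b) \<in> mean_eq \<tau> M I \<A> charge" and bc: "(b, c) \<in> mean_eq \<tau> M I \<A> charge"
    have "total (\<lambda>w. dM (a (e w)) (c (e w)))
        \<le> total (\<lambda>w. dM (a (e w)) (b (e w)) + dM (b (e w)) (c (e w)))"
    proof (rule mean_mono[OF mean_total])
      show "dM (a (e w)) (c (e w)) \<le> dM (a (e w)) (b (e w)) + dM (b (e w)) (c (e w))" for w
        by (rule M.triangle) (use ab bc in \<open>auto simp: mean_eq_iff maps_in\<close>)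
    qed simp_all
    also have "\<dots> = 0" using ab bc by (simp add: mean_add[OF mean_total] mean_eq_iff)
    finally show "(a, c) \<in> mean_eq \<tau> M I \<A> charge"
      using ab bc total_nonneg[of "\<lambda>w. dM (a (e w)) (c (e w))"] by (simp add: mean_eq_iff)
  qed
qed

lemma points_N: "points N = cls ` maps"
  by (auto simp: powermean_def quotient_def)

lemma repr:
  assumes "X \<in> points N"
  shows "repr X \<in> maps" "cls (repr X) = X"
proof -
  have X: "X \<in> maps // mean_eq \<tau> M I \<A> charge" using assms by (simp add: powermean_def)
  then obtain a where a: "a \<in> maps" "X = cls a" by (rule quotientE)
  then have "a \<in> X" using equiv_class_self[OF equiv_mean_eq] by blast
  then have "repr X \<in> X" unfolding repr_def by (rule someI[where P="\<lambda>a. a \<in> X"])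
  then have ar: "(a, repr X) \<in> mean_eq \<tau> M I \<A> charge" unfolding a(2) by simp
  then show "repr X \<in> maps" by (simp only: mean_eq_iff)
  have "cls a = cls (repr X)" by (rule equiv_class_eq[OF equiv_mean_eq ar])
  with a(2) show "cls (repr X) = X" by (rule trans[symmetric])
qed

lemma repr_cls: "a \<in> maps \<Longrightarrow> (repr (cls a), a) \<in> mean_eq \<tau> M I \<A> charge"
  by (rule eq_equiv_class[OF _ equiv_mean_eq]) (auto simp: points_N intro!: repr)

section \<open>Independence of the chosen representatives\<close>

lemma bdep_map_list: "\<forall>a\<in>set as. bdep a \<Longrightarrow> bdep (\<lambda>i. map (\<lambda>a. a i) as)"
proof (induction as)
  case (Cons a as)
  have "bdep (\<lambda>i. (a i, map (\<lambda>a. a i) as))" by (rule bdep_pair) (use Cons in auto)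
  then have "bdep (\<lambda>i. (\<lambda>(x, xs). x # xs) (a i, map (\<lambda>a. a i) as))" by (rule bdep_comp)
  then show ?case by simp
qed (simp add: bdep_const)

lemma maps_tuple: "set as \<subseteq> maps \<Longrightarrow> length as = n \<Longrightarrow> map (\<lambda>a. a (e w)) as \<in> tuples M n"
  by (auto simp: tuples_def maps_in subset_iff)

text \<open>\<open>powermean\<close> evaluates symbols on \<open>repr\<close>; this bounds, in the
  mean, the error of replacing given maps by those representatives.\<close>

lemma total_tdist_reprs:
  assumes as: "set as \<subseteq> maps"
  defines "h \<equiv> \<lambda>w. tdist \<tau> M (map (\<lambda>a. repr (cls a) (e w)) as) (map (\<lambda>a. a (e w)) as)"
  shows "\<And>w. 0 \<le> h w" "bounded_fn h" "total h = 0"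
proof -
  have h: "h = (\<lambda>w. \<Sum>i<length as. dM (repr (cls (as ! i)) (e w)) ((as ! i) (e w)))"
    by (auto simp: h_def tdist_def intro!: sum.cong)
  show "0 \<le> h w" for w by (simp add: h sum_nonneg)
  show "bounded_fn h" by (simp add: h)
  have "total h = (\<Sum>i<length as. total (\<lambda>w. dM (repr (cls (as ! i)) (e w)) ((as ! i) (e w))))"
    unfolding h by (rule mean_sum[OF mean_total]) simp
  also have "\<dots> = 0"
    by (rule sum.neutral) (use as repr_cls in \<open>auto simp: mean_eq_iff subset_iff\<close>)
  finally show "total h = 0" .
qed

lemma reprs_in_maps: "set as \<subseteq> maps \<Longrightarrow> set (map (\<lambda>a. repr (cls a)) as) \<subseteq> maps"
  using repr_cls by (auto simp: mean_eq_iff)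

lemma fint_in_maps:
  assumes F: "F \<in> fsyms \<tau>" and as: "set as \<subseteq> maps" "length as = farity \<tau> F"
  shows "(\<lambda>i\<in>I. fint M F (map (\<lambda>a. a i) as)) \<in> maps"
proof (rule maps_restrictI)
  show "fint M F (map (\<lambda>a. a (e w)) as) \<in> points M" for w
    using maps_tuple[OF as] M F by (simp add: tau_structure_def)
  show "bdep (\<lambda>i. fint M F (map (\<lambda>a. a i) as))"
    by (rule bdep_comp[OF bdep_map_list]) (use as maps_bdep in auto)
qed

text \<open>Changing representatives moves the arguments by a tuple distance of mean zero, and
  \<open>F\<close> moves its value by at most the modulus of that distance, which is null by
  \<open>mean_null_modulus\<close>.\<close>

lemma fint_cls:
  assumes F: "F \<in> fsyms \<tau>" and as: "set as \<subseteq> maps" "length as = farity \<tau> F"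
  shows "fint N F (map (\<lambda>a. cls a) as) = cls (\<lambda>i\<in>I. fint M F (map (\<lambda>a. a i) as))"
proof -
  let ?bs = "map (\<lambda>a. repr (cls a)) as"
  let ?f = "\<lambda>i\<in>I. fint M F (map (\<lambda>a. a i) ?bs)" and ?g = "\<lambda>i\<in>I. fint M F (map (\<lambda>a. a i) as)"
  let ?h = "\<lambda>w. tdist \<tau> M (map (\<lambda>a. repr (cls a) (e w)) as) (map (\<lambda>a. a (e w)) as)"
  note h = total_tdist_reprs[OF as(1)]
  have bs: "set ?bs \<subseteq> maps" "length ?bs = farity \<tau> F" using reprs_in_maps[OF as(1)] as(2) by auto
  have "total (\<lambda>w. dM (?f (e w)) (?g (e w))) = 0"
  proof (rule mean_null_modulus[where m=total and h="?h" and g="\<lambda>w. dM (?f (e w)) (?g (e w))", OF mean_total _ h])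
    show "modulus (fmod \<tau> F)" using sig F by (simp add: signature_def)
    fix w
    have "dM (fint M F (map (\<lambda>a. a (e w)) ?bs)) (fint M F (map (\<lambda>a. a (e w)) as))
        \<le> fmod \<tau> F (tdist \<tau> M (map (\<lambda>a. a (e w)) ?bs) (map (\<lambda>a. a (e w)) as))"
      using maps_tuple[OF as] maps_tuple[OF bs] M F unfolding tau_structure_def by blast
    then show "\<bar>dM (?f (e w)) (?g (e w))\<bar>
        \<le> fmod \<tau> F (tdist \<tau> M (map (\<lambda>a. repr (cls a) (e w)) as) (map (\<lambda>a. a (e w)) as))"
      by (simp add: comp_def)
  qed simp
  then have "(?f, ?g) \<in> mean_eq \<tau> M I \<A> charge"
    using fint_in_maps[OF F bs] fint_in_maps[OF F as] by (simp only: mean_eq_iff)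
  then have "cls ?f = cls ?g" by (rule equiv_class_eq[OF equiv_mean_eq])
  then show ?thesis by (simp add: powermean_def comp_def)
qed

text \<open>As for function symbols, the two integrands differ by a null function. In addition the
  charge integral is identified with \<open>total\<close>, because the integrand has bounded
  dependence.\<close>

lemma rint_cls:
  assumes R: "R \<in> rsyms \<tau>" and as: "set as \<subseteq> maps" "length as = rarity \<tau> R"
  shows "rint N R (map (\<lambda>a. cls a) as) = total (\<lambda>w. rint M R (map (\<lambda>a. a (e w)) as))"
proof -
  let ?bs = "map (\<lambda>a. repr (cls a)) as"
  let ?f = "\<lambda>w. rint M R (map (\<lambda>a. a (e w)) ?bs)" and ?g = "\<lambda>w. rint M R (map (\<lambda>a. a (e w)) as)"
  let ?h = "\<lambda>w. tdist \<tau> M (map (\<lambda>a. repr (cls a) (e w)) as) (map (\<lambda>a. a (e w)) as)"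
  note h = total_tdist_reprs[OF as(1)]
  have bs: "set ?bs \<subseteq> maps" "length ?bs = rarity \<tau> R" using reprs_in_maps[OF as(1)] as(2) by auto
  have le: "\<bar>rint M R (map (\<lambda>a. a (e w)) cs)\<bar> \<le> rbound \<tau> R"
    if "set cs \<subseteq> maps" "length cs = rarity \<tau> R" for cs w
    using maps_tuple[OF that] M R unfolding tau_structure_def by blast
  have b: "bounded_fn ?f" "bounded_fn ?g"
    using le[OF bs] le[OF as] by (blast intro: bounded_fnI)+
  have "total (\<lambda>w. ?f w - ?g w) = 0"
  proof (rule mean_null_modulus[where m=total and h="?h" and g="\<lambda>w. ?f w - ?g w", OF mean_total _ h])
    show "modulus (rmod \<tau> R)" using sig R by (simp add: signature_def)
    fix w
    have "\<bar>?f w - ?g w\<bar> \<le> rmod \<tau> R (tdist \<tau> M (map (\<lambda>a. a (e w)) ?bs) (map (\<lambda>a. a (e w)) as))"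
      using maps_tuple[OF as] maps_tuple[OF bs] M R unfolding tau_structure_def by blast
    then show "\<bar>?f w - ?g w\<bar>
        \<le> rmod \<tau> R (tdist \<tau> M (map (\<lambda>a. repr (cls a) (e w)) as) (map (\<lambda>a. a (e w)) as))"
      by (simp add: comp_def)
  qed (rule bounded_fn_diff[OF b])
  then have eq: "total ?f = total ?g" using mean_diff[OF mean_total b] by simp
  have "charge_integral I \<A> charge (\<lambda>i. rint M R (map (\<lambda>a. a i) ?bs)) = total ?f"
  proof (rule charge_integral_total[where f="\<lambda>i. rint M R (map (\<lambda>a. a i) ?bs)"])
    show "bdep (\<lambda>i. rint M R (map (\<lambda>a. a i) ?bs))"
      by (rule bdep_comp[OF bdep_map_list]) (use bs maps_bdep in auto)
  qed (rule le[OF bs])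
  then show ?thesis using eq by (simp add: powermean_def comp_def)
qed

lemma const_in_maps: "x \<in> points M \<Longrightarrow> (\<lambda>i\<in>I. x) \<in> maps"
  by (rule maps_restrictI) (auto simp: bdep_const)

lemma points_N_nonempty: "points N \<noteq> {}"
  using const_in_maps M by (auto simp: points_N tau_structure_def)

section \<open>Formulas in the powermean as integrals of their pointwise values\<close>

lemma tval_cls:
  assumes p: "\<And>a. a \<in> A \<Longrightarrow> p a \<in> maps \<and> cls (p a) = a" and v: "\<And>n. v n \<in> maps"
    and t: "trm_over \<tau> A t"
  shows "(\<lambda>i\<in>I. tval M (\<lambda>a. p a i) (\<lambda>n. v n i) t) \<in> maps \<and>
    tval N (\<lambda>a. a) (\<lambda>n. cls (v n)) t = cls (\<lambda>i\<in>I. tval M (\<lambda>a. p a i) (\<lambda>n. v n i) t)"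
proof -
  define u where "u = (\<lambda>t. \<lambda>i\<in>I. tval M (\<lambda>a. p a i) (\<lambda>n. v n i) t)"
  have "u t \<in> maps \<and> tval N (\<lambda>a. a) (\<lambda>n. cls (v n)) t = cls (u t)"
    using t
  proof (induction t)
    case (Var n)
    then show ?case using v maps_restrict by (simp add: u_def)
  next
    case (Con c)
    have "cint M c \<in> points M" using M Con by (simp add: tau_structure_def)
    moreover have "cint N c = cls (\<lambda>i\<in>I. cint M c)" by (simp add: powermean_def)
    ultimately show ?case unfolding u_def tval.simps using const_in_maps by blast
  next
    case (Par a)
    then show ?case using p maps_restrict by (simp add: u_def)
  next
    case (App F ts)
    let ?as = "map u ts"
    have F: "F \<in> fsyms \<tau>" and as: "set ?as \<subseteq> maps" "length ?as = farity \<tau> F"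
      using App by (auto simp: list_all_iff)
    have eq: "u (App F ts) = (\<lambda>i\<in>I. fint M F (map (\<lambda>a. a i) ?as))"
      unfolding u_def by (rule restrict_ext) (simp add: comp_def)
    have "map (tval N (\<lambda>a. a) (\<lambda>n. cls (v n))) ts = map (\<lambda>a. cls a) ?as"
      using App by (auto simp: list_all_iff)
    then have "tval N (\<lambda>a. a) (\<lambda>n. cls (v n)) (App F ts) = fint N F (map (\<lambda>a. cls a) ?as)"
      by (simp only: tval.simps)
    then show ?case using fint_in_maps[OF F as] fint_cls[OF F as] by (simp only: eq)
  qed
  then show ?thesis by (simp only: u_def)
qed

lemma bounded_fn_fval:
  assumes p: "\<And>a. a \<in> A \<Longrightarrow> p a \<in> maps" and v: "\<And>n. v n \<in> maps" and \<phi>: "form_over \<tau> A \<phi>"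
  shows "bounded_fn (\<lambda>w. fval M (\<lambda>a. p a (e w)) (\<lambda>n. v n (e w)) \<phi>)"
proof -
  obtain C where "\<forall>\<pi> v. \<pi> ` A \<subseteq> points M \<longrightarrow> range v \<subseteq> points M \<longrightarrow> \<bar>fval M \<pi> v \<phi>\<bar> \<le> C"
    using fval_bounded_uniform[OF sig M \<phi>] by blast
  then have "\<bar>fval M (\<lambda>a. p a (e w)) (\<lambda>n. v n (e w)) \<phi>\<bar> \<le> C" for w
    using p v maps_in by (simp add: image_subset_iff)
  then show ?thesis by (rule bounded_fnI)
qed

lemma bdep_sequence: "(\<And>n. v n \<in> maps) \<Longrightarrow> bdep (\<lambda>i n :: nat. v n i)"
  using bdep_family_fun[OF nat_ordLeq, of UNIV v] maps_bdep by (simp add: restrict_UNIV)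

text \<open>Supremum and integral commute: no map exceeds the pointwise supremum, and pointwise
  choice of almost optimal elements gives a map that is measurable and loses at most
  \<open>\<epsilon>\<close>.\<close>

lemma fval_QSup_cls:
  assumes p: "\<And>a. a \<in> A \<Longrightarrow> p a \<in> maps \<and> cls (p a) = a" and bp: "bdep (\<lambda>i a. p a i)"
    and \<phi>: "form_over \<tau> A \<phi>"
    and IH: "\<And>v. (\<And>n. v n \<in> maps) \<Longrightarrow>
      fval N (\<lambda>a. a) (\<lambda>n. cls (v n)) \<phi> = total (\<lambda>w. fval M (\<lambda>a. p a (e w)) (\<lambda>n. v n (e w)) \<phi>)"
    and v: "\<And>n. v n \<in> maps"
  shows "fval N (\<lambda>a. a) (\<lambda>n. cls (v n)) (QSup x \<phi>)
    = total (\<lambda>w. fval M (\<lambda>a. p a (e w)) (\<lambda>n. v n (e w)) (QSup x \<phi>))"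
proof -
  define f where "f = (\<lambda>i m. fval M (\<lambda>a. p a i) ((\<lambda>n. v n i)(x := m)) \<phi>)"
  define S where "S = (\<lambda>i. SUP m\<in>points M. f i m)"
  have pM: "points M \<noteq> {}" using M by (simp add: tau_structure_def)
  obtain C where C: "\<forall>\<pi> v. \<pi> ` A \<subseteq> points M \<longrightarrow> range v \<subseteq> points M \<longrightarrow> \<bar>fval M \<pi> v \<phi>\<bar> \<le> C"
    using fval_bounded_uniform[OF sig M \<phi>] by blast
  have fC: "\<bar>f (e w) m\<bar> \<le> C" if "m \<in> points M" for w m
    unfolding f_def using C p v maps_in that by (simp add: image_subset_iff)
  have bdd: "bdd_above (f (e w) ` points M)" for w
    using fC by (intro bdd_aboveI2[where M=C]) (metis abs_le_D1)
  have SC: "\<bar>S (e w)\<bar> \<le> C" for w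
    unfolding S_def by (rule cSup_abs_le) (use pM fC in auto)
  then have bS: "bounded_fn (\<lambda>w. S (e w))" by (rule bounded_fnI)
  define T where "T = (\<lambda>b. total (\<lambda>w. f (e w) (b (e w))))"
  have bT: "bounded_fn (\<lambda>w. f (e w) (b (e w)))" if "b \<in> maps" for b
    by (rule bounded_fnI[where C=C]) (use fC maps_in[OF that] in blast)
  have T: "fval N (\<lambda>a. a) ((\<lambda>n. cls (v n))(x := cls b)) \<phi> = T b" if b: "b \<in> maps" for b
  proof -
    have "fval N (\<lambda>a. a) (\<lambda>n. cls ((v(x := b)) n)) \<phi>
        = total (\<lambda>w. fval M (\<lambda>a. p a (e w)) (\<lambda>n. (v(x := b)) n (e w)) \<phi>)"
      by (rule IH) (use v b in auto)
    moreover have "(\<lambda>n. cls ((v(x := b)) n)) = (\<lambda>n. cls (v n))(x := cls b)" by (simp add: fun_eq_iff)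
    moreover have "(\<lambda>n. (v(x := b)) n i) = (\<lambda>n. v n i)(x := b i)" for i by auto
    ultimately show ?thesis by (simp add: T_def f_def)
  qed
  have "fval N (\<lambda>a. a) (\<lambda>n. cls (v n)) (QSup x \<phi>) = (SUP b\<in>maps. T b)"
    unfolding fval.simps points_N image_image by (rule SUP_cong) (use T in auto)
  also have "\<dots> = total (\<lambda>w. S (e w))"
  proof (rule antisym)
    have le: "T b \<le> total (\<lambda>w. S (e w))" if b: "b \<in> maps" for b
      unfolding T_def
    proof (rule mean_mono[OF mean_total bT[OF b] bS])
      show "f (e w) (b (e w)) \<le> S (e w)" for w
        unfolding S_def by (rule cSUP_upper[OF maps_in[OF b] bdd])
    qed
    have ne: "maps \<noteq> {}" using points_N_nonempty points_N by auto
    show "(SUP b\<in>maps. T b) \<le> total (\<lambda>w. S (e w))" by (rule cSUP_least[OF ne le])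
    show "total (\<lambda>w. S (e w)) \<le> (SUP b\<in>maps. T b)"
    proof (rule field_le_epsilon)
      fix \<epsilon> :: real assume \<epsilon>: "0 < \<epsilon>"
      define b where "b = (\<lambda>i. SOME m. m \<in> points M \<and> S i - \<epsilon> \<le> f i m)"
      have b: "b (e w) \<in> points M \<and> S (e w) - \<epsilon> \<le> f (e w) (b (e w))" for w
      proof -
        have "\<exists>m\<in>points M. S (e w) - \<epsilon> < f (e w) m"
          using less_cSUP_iff[OF pM bdd, of "S (e w) - \<epsilon>" w] \<epsilon> by (simp add: S_def)
        then have "\<exists>m. m \<in> points M \<and> S (e w) - \<epsilon> \<le> f (e w) m" by force
        then show ?thesis unfolding b_def by (rule someI_ex)
      qed
      \<comment> \<open>The choice at \<open>i\<close> uses \<open>i\<close> only through the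
        parameters and the assignment at \<open>i\<close>. Both have bounded dependence, so the
        chosen map has it too, whatever the choice operator does.\<close>
      have "bdep (\<lambda>i. (\<lambda>a. p a i, \<lambda>n. v n i))" by (rule bdep_pair[OF bp bdep_sequence[OF v]])
      then have "bdep (\<lambda>i. (\<lambda>(q, u). SOME m. m \<in> points M \<and>
          (SUP m\<in>points M. fval M q (u(x := m)) \<phi>) - \<epsilon> \<le> fval M q (u(x := m)) \<phi>) (\<lambda>a. p a i, \<lambda>n. v n i))"
        by (rule bdep_comp)
      then have "bdep b" by (simp add: b_def S_def f_def)
      then have bm: "(\<lambda>i\<in>I. b i) \<in> maps" using b by (intro maps_restrictI) auto
      have "total (\<lambda>w. S (e w)) - \<epsilon> = total (\<lambda>w. S (e w) - \<epsilon>)"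
        using mean_diff[OF mean_total bS, of "\<lambda>_. \<epsilon>"] by (simp add: mean_const[OF mean_total])
      also have "\<dots> \<le> T (\<lambda>i\<in>I. b i)"
        unfolding T_def by (rule mean_mono[OF mean_total _ bT[OF bm]]) (use bS b in auto)
      also have "\<dots> \<le> (SUP b\<in>maps. T b)"
        by (rule cSUP_upper[OF bm]) (rule bdd_aboveI2[OF le])
      finally show "total (\<lambda>w. S (e w)) \<le> (SUP b\<in>maps. T b) + \<epsilon>" by simp
    qed
  qed
  finally show ?thesis by (simp add: S_def f_def)
qed

text \<open>The counterpart of Los's theorem for linear formulas. Linear connectives commute with
  any mean, and the quantifier case is \<open>fval_QSup_cls\<close>; \<open>bp\<close> asks for a
  common bound on all parameters at once.\<close>

lemma fval_cls:
  assumes p: "\<And>a. a \<in> A \<Longrightarrow> p a \<in> maps \<and> cls (p a) = a" and bp: "bdep (\<lambda>i a. p a i)"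
    and \<phi>: "form_over \<tau> A \<phi>" and v: "\<And>n. v n \<in> maps"
  shows "fval N (\<lambda>a. a) (\<lambda>n. cls (v n)) \<phi> = total (\<lambda>w. fval M (\<lambda>a. p a (e w)) (\<lambda>n. v n (e w)) \<phi>)"
  using \<phi> v
proof (induction \<phi> arbitrary: v)
  case (Const c)
  then show ?case by (simp add: mean_const[OF mean_total])
next
  case (Rel R ts)
  define as where "as = map (\<lambda>t. \<lambda>i\<in>I. tval M (\<lambda>a. p a i) (\<lambda>n. v n i) t) ts"
  have t: "(\<lambda>i\<in>I. tval M (\<lambda>a. p a i) (\<lambda>n. v n i) t) \<in> maps"
    "tval N (\<lambda>a. a) (\<lambda>n. cls (v n)) t = cls (\<lambda>i\<in>I. tval M (\<lambda>a. p a i) (\<lambda>n. v n i) t)"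
    if "t \<in> set ts" for t
    using tval_cls[OF p Rel(2), where t=t] Rel(1) that by (auto simp: list_all_iff)
  have R: "R \<in> rsyms \<tau>" and as: "set as \<subseteq> maps" "length as = rarity \<tau> R"
    using Rel(1) t(1) by (auto simp: as_def)
  have "map (tval N (\<lambda>a. a) (\<lambda>n. cls (v n))) ts = map (\<lambda>a. cls a) as"
    using t(2) by (auto simp: as_def)
  then have "fval N (\<lambda>a. a) (\<lambda>n. cls (v n)) (Rel R ts) = rint N R (map (\<lambda>a. cls a) as)"
    by (simp only: fval.simps)
  also have "\<dots> = total (\<lambda>w. rint M R (map (\<lambda>a. a (e w)) as))" by (rule rint_cls[OF R as])
  finally show ?case by (simp add: as_def comp_def)
next
  case (Scale c \<phi>)
  have "bounded_fn (\<lambda>w. fval M (\<lambda>a. p a (e w)) (\<lambda>n. v n (e w)) \<phi>)"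
    by (rule bounded_fn_fval) (use p Scale in auto)
  then show ?case using Scale by (simp add: mean_scale[OF mean_total])
next
  case (Plus \<phi> \<psi>)
  have "bounded_fn (\<lambda>w. fval M (\<lambda>a. p a (e w)) (\<lambda>n. v n (e w)) \<phi>)"
    "bounded_fn (\<lambda>w. fval M (\<lambda>a. p a (e w)) (\<lambda>n. v n (e w)) \<psi>)"
    by (rule bounded_fn_fval; use p Plus in auto)+
  then show ?case using Plus by (simp add: mean_add[OF mean_total])
next
  case (QSup x \<phi>)
  then show ?case by (intro fval_QSup_cls[OF p bp]) auto
next
  case (QInf x \<phi>)
  have \<phi>: "form_over \<tau> A \<phi>" using QInf.prems by simp
  have b: "bounded_fn (\<lambda>w. fval M (\<lambda>a. p a (e w)) (\<lambda>n. u n (e w)) \<psi>)"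
    if "form_over \<tau> A \<psi>" "\<And>n. u n \<in> maps" for u \<psi>
    by (rule bounded_fn_fval) (use p that in auto)
  have "fval N (\<lambda>a. a) (\<lambda>n. cls (v n)) (QSup x (Scale (-1) \<phi>))
      = total (\<lambda>w. fval M (\<lambda>a. p a (e w)) (\<lambda>n. v n (e w)) (QSup x (Scale (-1) \<phi>)))"
  proof (rule fval_QSup_cls[OF p bp _ _ QInf.prems(2)])
    fix u :: "nat \<Rightarrow> 'i \<Rightarrow> 'm" assume u: "\<And>n. u n \<in> maps"
    show "fval N (\<lambda>a. a) (\<lambda>n. cls (u n)) (Scale (-1) \<phi>)
        = total (\<lambda>w. fval M (\<lambda>a. p a (e w)) (\<lambda>n. u n (e w)) (Scale (-1) \<phi>))"
      using QInf.IH[OF \<phi> u] mean_scale[OF mean_total b[OF \<phi> u], of "-1"] by simp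
  qed (use \<phi> in auto)
  moreover have "form_over \<tau> A (QSup x (Scale (-1) \<phi>))" using \<phi> by simp
  ultimately show ?case
    unfolding fval_QInf using mean_scale[OF mean_total b[OF _ QInf.prems(2)], of "QSup x (Scale (-1) \<phi>)" "-1"] by simp
qed

end


section \<open>Saturation\<close>

text \<open>Squared accumulated error of order \<open>n\<close> means that the error of the averages
  is of order \<open>1 / sqrt n\<close>. The slack 1 in \<open>half\<close> is harmless since it
  does not grow with the coefficients \<open>s\<close>.\<close>

lemma simultaneous_averages:
  fixes val :: "'c \<Rightarrow> 'p \<Rightarrow> real" and P :: "'p \<Rightarrow> real"
  assumes F: "finite F" and bdd: "\<And>\<phi>. \<phi> \<in> F \<Longrightarrow> \<exists>C. \<forall>c\<in>X. \<bar>val c \<phi>\<bar> \<le> C"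
    and half: "\<And>s. \<exists>c\<in>X. (\<Sum>\<phi>\<in>F. s \<phi> * val c \<phi>) \<le> (\<Sum>\<phi>\<in>F. s \<phi> * P \<phi>) + 1"
  shows "\<exists>c :: nat \<Rightarrow> 'c. range c \<subseteq> X \<and> (\<forall>\<phi>\<in>F. (\<lambda>n. (\<Sum>k<n. val (c k) \<phi>) / real n) \<longlonglongrightarrow> P \<phi>)"
proof -
  txt \<open>The next point is chosen against the accumulated error \<open>S n\<close>; then the squared norm of
    \<open>S n\<close> grows only linearly.\<close>
  define u where "u = (\<lambda>c \<phi>. val c \<phi> - P \<phi>)"
  define pick where "pick = (\<lambda>s. SOME c. c \<in> X \<and> (\<Sum>\<phi>\<in>F. s \<phi> * u c \<phi>) \<le> 1)"
  have pick: "pick s \<in> X \<and> (\<Sum>\<phi>\<in>F. s \<phi> * u (pick s) \<phi>) \<le> 1" for s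
  proof -
    obtain c where "c \<in> X" "(\<Sum>\<phi>\<in>F. s \<phi> * val c \<phi>) \<le> (\<Sum>\<phi>\<in>F. s \<phi> * P \<phi>) + 1" using half by blast
    then have "\<exists>c. c \<in> X \<and> (\<Sum>\<phi>\<in>F. s \<phi> * u c \<phi>) \<le> 1"
      by (intro exI[of _ c]) (simp add: u_def right_diff_distrib sum_subtractf)
    then show ?thesis unfolding pick_def by (rule someI_ex)
  qed
  define S where "S = rec_nat (\<lambda>_. 0) (\<lambda>n s \<phi>. s \<phi> + u (pick s) \<phi>)"
  have S0: "S 0 = (\<lambda>_. 0)" and SS: "S (Suc n) = (\<lambda>\<phi>. S n \<phi> + u (pick (S n)) \<phi>)" for n
    by (simp_all add: S_def)
  define c where "c = (\<lambda>n. pick (S n))"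
  have Ssum: "S n \<phi> = (\<Sum>k<n. u (c k) \<phi>)" for n \<phi>
    by (induction n) (simp_all add: S0 SS c_def)
  have "\<forall>\<phi>\<in>F. \<exists>C. \<forall>c\<in>X. \<bar>u c \<phi>\<bar> \<le> C"
  proof
    fix \<phi> assume "\<phi> \<in> F"
    then obtain C where "\<forall>c\<in>X. \<bar>val c \<phi>\<bar> \<le> C" using bdd by blast
    then have "\<bar>u c \<phi>\<bar> \<le> C + \<bar>P \<phi>\<bar>" if "c \<in> X" for c
      using that abs_triangle_ineq4[of "val c \<phi>" "P \<phi>"] unfolding u_def by fastforce
    then show "\<exists>C. \<forall>c\<in>X. \<bar>u c \<phi>\<bar> \<le> C" by blast
  qed
  then obtain B where B: "\<And>\<phi> c. \<phi> \<in> F \<Longrightarrow> c \<in> X \<Longrightarrow> \<bar>u c \<phi>\<bar> \<le> B \<phi>" by metis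
  \<comment> \<open>The growth of the squared norm per step: twice the inner product of old error
    and new deviation, which is at most 1, plus the squared norm of the new deviation.\<close>
  define K where "K = 2 + (\<Sum>\<phi>\<in>F. (B \<phi>)\<^sup>2)"
  have D: "(\<Sum>\<phi>\<in>F. (S n \<phi>)\<^sup>2) \<le> real n * K" for n
  proof (induction n)
    case (Suc n)
    have "(\<Sum>\<phi>\<in>F. (S (Suc n) \<phi>)\<^sup>2)
        = (\<Sum>\<phi>\<in>F. (S n \<phi>)\<^sup>2) + 2 * (\<Sum>\<phi>\<in>F. S n \<phi> * u (c n) \<phi>) + (\<Sum>\<phi>\<in>F. (u (c n) \<phi>)\<^sup>2)"
      by (simp add: SS c_def power2_sum sum.distrib sum_distrib_left algebra_simps)
    also have "(\<Sum>\<phi>\<in>F. S n \<phi> * u (c n) \<phi>) \<le> 1" using pick by (simp add: c_def)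
    also have "(\<Sum>\<phi>\<in>F. (u (c n) \<phi>)\<^sup>2) \<le> (\<Sum>\<phi>\<in>F. (B \<phi>)\<^sup>2)"
    proof (intro sum_mono abs_le_square_iff[THEN iffD1])
      show "\<bar>u (c n) \<phi>\<bar> \<le> \<bar>B \<phi>\<bar>" if "\<phi> \<in> F" for \<phi>
        using B[OF that, of "c n"] pick[of "S n"] by (simp add: c_def)
    qed
    finally show ?case using Suc by (simp add: K_def algebra_simps)
  qed (simp add: S0)
  have "(\<lambda>n. (\<Sum>k<n. val (c k) \<phi>) / real n) \<longlonglongrightarrow> P \<phi>" if \<phi>: "\<phi> \<in> F" for \<phi>
  proof -
    have "(S n \<phi> / real n)\<^sup>2 \<le> K / real n" if "0 < n" for n
    proof -
      have "(S n \<phi>)\<^sup>2 \<le> (\<Sum>\<phi>\<in>F. (S n \<phi>)\<^sup>2)" by (rule member_le_sum) (use F \<phi> in auto)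
      then have "(S n \<phi>)\<^sup>2 \<le> real n * K" using D[of n] by linarith
      then show ?thesis using \<open>0 < n\<close> by (simp add: field_simps power2_eq_square)
    qed
    then have "eventually (\<lambda>n. norm ((S n \<phi> / real n)\<^sup>2) \<le> K / real n) sequentially"
      by (intro eventually_sequentiallyI[of 1]) simp
    then have "(\<lambda>n. (S n \<phi> / real n)\<^sup>2) \<longlonglongrightarrow> 0"
      by (rule Lim_null_comparison) (rule lim_const_over_n)
    then have "(\<lambda>n. sqrt ((S n \<phi> / real n)\<^sup>2)) \<longlonglongrightarrow> sqrt 0" by (rule tendsto_real_sqrt)
    then have "(\<lambda>n. S n \<phi> / real n) \<longlonglongrightarrow> 0"
      unfolding real_sqrt_abs real_sqrt_zero by (rule tendsto_rabs_zero_cancel)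
    then have "(\<lambda>n. S n \<phi> / real n + P \<phi>) \<longlonglongrightarrow> 0 + P \<phi>" by (intro tendsto_add tendsto_const)
    moreover have "eventually (\<lambda>n. S n \<phi> / real n + P \<phi> = (\<Sum>k<n. val (c k) \<phi>) / real n) sequentially"
      by (rule eventually_sequentiallyI[of 1]) (simp add: Ssum u_def sum_subtractf field_simps)
    ultimately show ?thesis by (simp add: Lim_transform_eventually)
  qed
  moreover have "range c \<subseteq> X" using pick by (auto simp: c_def)
  ultimately show ?thesis by blast
qed

section \<open>Reduction of types to limits of averages\<close>

definition unary_forms :: "('f, 'r, 'c) signature \<Rightarrow> 'a set \<Rightarrow> ('f, 'r, 'c, 'a) form set" where
  "unary_forms \<tau> A = {\<phi>. form_over \<tau> A \<phi> \<and> fvars \<phi> \<subseteq> {0}}"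

primrec lin_comb :: "(('f, 'r, 'c, 'a) form \<Rightarrow> real) \<Rightarrow> ('f, 'r, 'c, 'a) form list \<Rightarrow> ('f, 'r, 'c, 'a) form" where
  "lin_comb s [] = Const 0"
| "lin_comb s (\<phi> # \<phi>s) = Plus (Scale (s \<phi>) \<phi>) (lin_comb s \<phi>s)"

lemma lin_comb_unary: "set \<phi>s \<subseteq> unary_forms \<tau> A \<Longrightarrow> lin_comb s \<phi>s \<in> unary_forms \<tau> A"
  by (induction \<phi>s) (auto simp: unary_forms_def)

lemma fval_lin_comb: "distinct \<phi>s \<Longrightarrow> fval S \<pi> v (lin_comb s \<phi>s) = (\<Sum>\<phi>\<in>set \<phi>s. s \<phi> * fval S \<pi> v \<phi>)"
  by (induction \<phi>s) auto

lemma fval_unary: "\<phi> \<in> unary_forms \<tau> A \<Longrightarrow> v 0 = x \<Longrightarrow> fval S \<pi> v \<phi> = fval S \<pi> (\<lambda>_. x) \<phi>"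
  by (rule fval_cong) (auto simp: unary_forms_def)

text \<open>The infimum \<open>q\<close> of \<open>\<phi>\<close> in \<open>N\<close>, used as a
  constant, gives a closed condition over \<open>A\<close> true in \<open>N\<close>, hence in
  \<open>K\<close>; so \<open>q\<close> bounds the value at \<open>x\<close> from below. The slack 1
  is there because \<open>N\<close> need not attain its infimum.\<close>

lemma almost_below_model:
  assumes sig: "signature \<tau>" and K: "model_of \<tau> A (thy_over \<tau> N A) K \<pi>" and x: "x \<in> points K"
    and N: "points N \<noteq> {}" and \<phi>: "\<phi> \<in> unary_forms \<tau> A"
  shows "\<exists>c\<in>points N. fval N (\<lambda>a. a) (\<lambda>_. c) \<phi> \<le> fval K \<pi> (\<lambda>_. x) \<phi> + 1"
proof -
  define q where "q = fval N (\<lambda>a. a) ((!) []) (QInf 0 \<phi>)"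
  have KS: "tau_structure \<tau> K" "\<pi> ` A \<subseteq> points K" using K by (auto simp: model_of_def)
  have "(Const q, QInf 0 \<phi>) \<in> thy_over \<tau> N A"
    using \<phi> by (auto simp: thy_over_def conds_def sat_def q_def unary_forms_def simp del: fval.simps(6))
  then have "sat K \<pi> [] (Const q, QInf 0 \<phi>)" using K by (auto simp: model_of_def)
  then have "q \<le> (INF b\<in>points K. fval K \<pi> (((!) [])(0 := b)) \<phi>)" by (simp add: sat_def)
  also have "\<dots> = (INF b\<in>points K. fval K \<pi> (\<lambda>_. b) \<phi>)"
    by (rule INF_cong[OF refl fval_unary[OF \<phi>]]) simp
  also have "\<dots> \<le> fval K \<pi> (\<lambda>_. x) \<phi>"
  proof (rule cINF_lower[OF _ x])
    obtain C where C: "\<forall>v. range v \<subseteq> points K \<longrightarrow> \<bar>fval K \<pi> v \<phi>\<bar> \<le> C"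
      using fval_bounded[OF sig KS, of \<phi>] \<phi> by (auto simp: unary_forms_def)
    show "bdd_below ((\<lambda>b. fval K \<pi> (\<lambda>_. b) \<phi>) ` points K)"
    proof (rule bdd_belowI2)
      fix b assume "b \<in> points K"
      then have "\<bar>fval K \<pi> (\<lambda>_. b) \<phi>\<bar> \<le> C" using C by auto
      then show "- C \<le> fval K \<pi> (\<lambda>_. b) \<phi>" by linarith
    qed
  qed
  finally have q: "q \<le> fval K \<pi> (\<lambda>_. x) \<phi>" .
  have "q = (INF c\<in>points N. fval N (\<lambda>a. a) (\<lambda>_. c) \<phi>)"
    unfolding q_def fval.simps by (rule INF_cong[OF refl fval_unary[OF \<phi>]]) simp
  then have "\<exists>y\<in>(\<lambda>c. fval N (\<lambda>a. a) (\<lambda>_. c) \<phi>) ` points N. y < q + 1"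
    by (intro cInf_lessD) (use N in auto)
  then show ?thesis using q by force
qed

text \<open>Isolates in \<open>step\<close> what is asked of \<open>N\<close>: values that can be
  averaged on every finite set of formulas must be the values at one point. It is applied to the
  values at a realization \<open>x\<close> of the type in a model \<open>K\<close>.\<close>

lemma realized_by_averages:
  fixes N :: "('a, 'f, 'r, 'c) mstruct"
  assumes sig: "signature \<tau>" and p: "p \<in> lin_types \<tau> N 1 A" and N: "points N \<noteq> {}"
    and bdd: "\<And>\<phi>. \<phi> \<in> unary_forms \<tau> A \<Longrightarrow> \<exists>C. \<forall>c\<in>points N. \<bar>fval N (\<lambda>a. a) (\<lambda>_. c) \<phi>\<bar> \<le> C"
    and step: "\<And>P. (\<And>F. finite F \<Longrightarrow> F \<subseteq> unary_forms \<tau> A \<Longrightarrow> \<exists>c::nat \<Rightarrow> _. range c \<subseteq> points N \<and>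
        (\<forall>\<phi>\<in>F. (\<lambda>n. (\<Sum>k<n. fval N (\<lambda>a. a) (\<lambda>_. c k) \<phi>) / real n) \<longlonglongrightarrow> P \<phi>)) \<Longrightarrow>
      \<exists>X\<in>points N. \<forall>\<phi>\<in>unary_forms \<tau> A. fval N (\<lambda>a. a) (\<lambda>_. X) \<phi> = P \<phi>"
  shows "realized_in N 1 p"
proof -
  have pc: "p \<subseteq> conds \<tau> A 1" using p by (simp add: lin_types_def)
  obtain K :: "(('f, 'r, 'c, 'a) form, 'f, 'r, 'c) mstruct" and \<pi> xs where K: "model_of \<tau> A (thy_over \<tau> N A) K \<pi>"
    and xs: "xs \<in> tuples K 1" and sat: "\<forall>c\<in>thy_over \<tau> N A \<union> p. sat K \<pi> xs c"
    using p unfolding lin_types_def satisfiable_over_def satisfied_in_def by blast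
  define x where "x = xs ! 0"
  have x: "x \<in> points K" using xs by (auto simp: x_def tuples_def)
  have "\<exists>X\<in>points N. \<forall>\<phi>\<in>unary_forms \<tau> A. fval N (\<lambda>a. a) (\<lambda>_. X) \<phi> = fval K \<pi> (\<lambda>_. x) \<phi>"
  proof (rule step)
    fix F assume F: "finite F" "F \<subseteq> unary_forms \<tau> A"
    show "\<exists>c::nat \<Rightarrow> _. range c \<subseteq> points N \<and>
        (\<forall>\<phi>\<in>F. (\<lambda>n. (\<Sum>k<n. fval N (\<lambda>a. a) (\<lambda>_. c k) \<phi>) / real n) \<longlonglongrightarrow> fval K \<pi> (\<lambda>_. x) \<phi>)"
    proof (rule simultaneous_averages[where val="\<lambda>c \<phi>. fval N (\<lambda>a. a) (\<lambda>_. c) \<phi>", OF F(1)])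
      show "\<exists>C. \<forall>c\<in>points N. \<bar>fval N (\<lambda>a. a) (\<lambda>_. c) \<phi>\<bar> \<le> C" if "\<phi> \<in> F" for \<phi>
        using bdd F(2) that by blast
      fix s
      \<comment> \<open>A weighted sum of formulas is again a formula, so the bound for single
        formulas covers all coefficients \<open>s\<close>; distinctness makes
        \<open>lin_comb\<close> count each member of \<open>F\<close> once.\<close>
      obtain \<phi>s where \<phi>s: "set \<phi>s = F" "distinct \<phi>s" using finite_distinct_list[OF F(1)] by blast
      show "\<exists>c\<in>points N. (\<Sum>\<phi>\<in>F. s \<phi> * fval N (\<lambda>a. a) (\<lambda>_. c) \<phi>) \<le> (\<Sum>\<phi>\<in>F. s \<phi> * fval K \<pi> (\<lambda>_. x) \<phi>) + 1"
        using almost_below_model[OF sig K x N lin_comb_unary, of \<phi>s s] F(2) \<phi>s(1)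
        by (simp add: fval_lin_comb[OF \<phi>s(2)])
    qed
  qed
  then obtain X where X: "X \<in> points N"
    "\<And>\<phi>. \<phi> \<in> unary_forms \<tau> A \<Longrightarrow> fval N (\<lambda>a. a) (\<lambda>_. X) \<phi> = fval K \<pi> (\<lambda>_. x) \<phi>" by blast
  have "sat N (\<lambda>a. a) [X] (\<phi>, \<psi>)" if c: "(\<phi>, \<psi>) \<in> p" for \<phi> \<psi>
  proof -
    have u: "\<phi> \<in> unary_forms \<tau> A" "\<psi> \<in> unary_forms \<tau> A" using pc c by (auto simp: conds_def unary_forms_def)
    have "sat K \<pi> xs (\<phi>, \<psi>)" using sat c by blast
    then have "fval K \<pi> (\<lambda>_. x) \<phi> \<le> fval K \<pi> (\<lambda>_. x) \<psi>"
      using fval_unary[OF u(1), of "(!) xs" x K \<pi>] fval_unary[OF u(2), of "(!) xs" x K \<pi>]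
      by (simp add: sat_def x_def)
    then show ?thesis
      using fval_unary[OF u(1), of "(!) [X]" X N "\<lambda>a. a"] fval_unary[OF u(2), of "(!) [X]" X N "\<lambda>a. a"]
      by (simp add: sat_def X(2)[OF u(1)] X(2)[OF u(2)])
  qed
  moreover have "[X] \<in> tuples N 1" using X by (simp add: tuples_def)
  ultimately show ?thesis unfolding realized_in_def by (intro bexI[of _ "[X]"]) auto
qed

section \<open>Realizing types by reading a fresh coordinate\<close>

lemma card_finite_sets:
  assumes "infinite (UNIV :: 'a set)"
  shows "|{G :: 'a set. finite G}| \<le>o |UNIV :: 'a set|"
proof -
  let ?F = "\<lambda>n. {G :: 'a set. finite G \<and> card G = n}"
  have inf: "infinite (Field |UNIV :: 'a set| )" using assms by (simp add: Field_card_of)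
  have "|?F n| \<le>o |UNIV :: 'a set|" for n
  proof (induction n)
    case 0
    have "|?F 0| \<le>o |{{} :: 'a set}|" by (rule card_of_mono1) auto
    moreover have "|{{} :: 'a set}| \<le>o |UNIV :: 'a set|"
      by (rule card_of_ordLeq[THEN iffD1]) auto
    ultimately show ?case by (rule ordLeq_transitive)
  next
    case (Suc n)
    \<comment> \<open>Sets of size \<open>Suc n\<close> arise by inserting an element into sets of
      size \<open>n\<close>; infinite cardinals absorb the product, and finally the countable union
      over sizes.\<close>
    have "?F (Suc n) \<subseteq> (\<lambda>(a, G). insert a G) ` (UNIV \<times> ?F n)"
    proof
      fix G assume "G \<in> ?F (Suc n)"
      then obtain a H where "G = insert a H" "a \<notin> H" "card H = n" "finite H"
        by (auto simp: card_Suc_eq_finite)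
      then show "G \<in> (\<lambda>(a, G). insert a G) ` (UNIV \<times> ?F n)" by auto
    qed
    then have "|?F (Suc n)| \<le>o |(\<lambda>(a, G). insert a G) ` (UNIV \<times> ?F n)|" by (rule card_of_mono1)
    moreover have "|(\<lambda>(a, G). insert a G) ` (UNIV \<times> ?F n)| \<le>o |(UNIV :: 'a set) \<times> ?F n|"
      by (rule card_of_image)
    moreover have "|(UNIV :: 'a set) \<times> ?F n| \<le>o |UNIV :: 'a set|"
      by (rule card_of_Times_ordLeq_infinite_Field[OF inf card_of_mono1[OF subset_UNIV] Suc card_of_Card_order])
    ultimately show ?case by (rule ordLeq_transitive[OF _ ordLeq_transitive])
  qed
  moreover have "|UNIV :: nat set| \<le>o |UNIV :: 'a set|" using assms infinite_iff_card_of_nat by blast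
  ultimately have "|\<Union>n. ?F n| \<le>o |UNIV :: 'a set|"
    by (intro card_of_UNION_ordLeq_infinite_Field[OF inf card_of_Card_order]) auto
  moreover have "(\<Union>n. ?F n) = {G. finite G}" by auto
  ultimately show ?thesis by simp
qed

text \<open>Elements of \<open>'q\<close> serve as codes of formulas, so a coordinate holds a finite
  set of codes and a position. The cardinal bounding the number of codes also bounds the families
  handled by regularity.\<close>

locale saturated_tower =
  powermean_tower "|UNIV :: 'q set|" "cesaro :: ('q set \<times> nat \<Rightarrow> real) \<Rightarrow> real" e \<tau> M d
  for e :: "('q set \<Rightarrow> 'q set \<times> nat) \<Rightarrow> 'i" and \<tau> :: "('f, 'r, 'c) signature"
    and M :: "('m, 'f, 'r, 'c) mstruct" and d :: "'d rel"
begin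

lemma inf_q: "infinite (UNIV :: 'q set)"
  using k(2) by (simp add: Field_card_of)

text \<open>Fixing the value off \<open>A\<close> makes the bundle of all parameters depend only on
  the representatives of \<open>A\<close>, hence on boundedly many coordinates.\<close>

definition reprs :: "('i \<Rightarrow> 'm) set set \<Rightarrow> ('i \<Rightarrow> 'm) set \<Rightarrow> 'i \<Rightarrow> 'm" where
  "reprs A = (\<lambda>a i. if a \<in> A then repr a i else undefined)"

lemma reprs:
  assumes A: "A \<subseteq> points N" "|A| \<le>o |UNIV :: 'q set|"
  shows "a \<in> A \<Longrightarrow> reprs A a \<in> maps \<and> cls (reprs A a) = a" "bdep (\<lambda>i a. reprs A a i)"
proof -
  show "reprs A a \<in> maps \<and> cls (reprs A a) = a" if "a \<in> A"
  proof -
    have "reprs A a = repr a" using that by (simp add: reprs_def fun_eq_iff)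
    then show ?thesis using repr[of a] A(1) that by (simp add: subset_iff)
  qed
  have "bdep (\<lambda>i. \<lambda>a\<in>A. repr a i)"
    by (rule bdep_family_fun[OF A(2)]) (use repr(1) A(1) maps_bdep in blast)
  then have "bdep (\<lambda>i. (\<lambda>u a. if a \<in> A then u a else undefined) (\<lambda>a\<in>A. repr a i))" by (rule bdep_comp)
  then show "bdep (\<lambda>i a. reprs A a i)" by (simp add: reprs_def if_distrib cong: if_cong)
qed

text \<open>The realization at index \<open>w\<close> reads off from a fresh coordinate \<open>b\<close> of \<open>w\<close> a finite set of
  formulas and the position in a sequence that averages these formulas correctly.\<close>

lemma averages_realized:
  fixes code :: "('f, 'r, 'c, ('i \<Rightarrow> 'm) set) form \<Rightarrow> 'q"
  assumes A: "A \<subseteq> points N" "|A| \<le>o |UNIV :: 'q set|"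
    and code: "inj_on code (unary_forms \<tau> A)"
    and c: "\<And>F. finite F \<Longrightarrow> F \<subseteq> unary_forms \<tau> A \<Longrightarrow> \<exists>c::nat \<Rightarrow> _. range c \<subseteq> points N \<and>
        (\<forall>\<phi>\<in>F. (\<lambda>n. (\<Sum>k<n. fval N (\<lambda>a. a) (\<lambda>_. c k) \<phi>) / real n) \<longlonglongrightarrow> P \<phi>)"
  shows "\<exists>X\<in>points N. \<forall>\<phi>\<in>unary_forms \<tau> A. fval N (\<lambda>a. a) (\<lambda>_. X) \<phi> = P \<phi>"
proof -
  define F where "F = (\<lambda>G :: 'q set. {\<phi> \<in> unary_forms \<tau> A. code \<phi> \<in> G})"
  have finF: "finite (F G)" if "finite G" for G
  proof -
    have "F G = code -` G \<inter> unary_forms \<tau> A" by (auto simp: F_def)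
    then show ?thesis using finite_vimage_IntI[OF that code] by simp
  qed
  define C where "C = (\<lambda>G. SOME c. range c \<subseteq> points N \<and>
        (\<forall>\<phi>\<in>F G. (\<lambda>n. (\<Sum>k<n. fval N (\<lambda>a. a) (\<lambda>_. c k) \<phi>) / real n) \<longlonglongrightarrow> P \<phi>))"
  have "range (C G) \<subseteq> points N \<and>
        (\<forall>\<phi>\<in>F G. (\<lambda>n. (\<Sum>k<n. fval N (\<lambda>a. a) (\<lambda>_. C G k) \<phi>) / real n) \<longlonglongrightarrow> P \<phi>)"
    if "finite G" for G
    unfolding C_def by (rule someI_ex[OF c[OF finF[OF that]]]) (simp add: F_def)
  then have C: "C G k \<in> points N"
    and lim: "\<phi> \<in> F G \<Longrightarrow> (\<lambda>n. (\<Sum>k<n. fval N (\<lambda>a. a) (\<lambda>_. C G k) \<phi>) / real n) \<longlonglongrightarrow> P \<phi>"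
    if "finite G" for G k \<phi>
    using that by (simp_all add: image_subset_iff)
  \<comment> \<open>The sequences \<open>C G\<close> are known to be good only for finite
    \<open>G\<close>; sending infinite \<open>G\<close> to \<open>{}\<close> makes
    \<open>R j\<close> a measurable map for every \<open>j\<close>.\<close>
  define R where "R = (\<lambda>(G, n). repr (C (if finite G then G else {}) n))"
  have Rm: "R j \<in> maps" for j using repr(1) C by (auto simp: R_def split: prod.split)
  have Rc: "cls (R (G, n)) = C G n" if "finite G" for G n using repr(2) C that by (simp add: R_def)
  define p where "p = reprs A"
  have p: "p a \<in> maps \<and> cls (p a) = a" if "a \<in> A" for a using reprs(1)[OF A that] by (simp add: p_def)
  have bp: "bdep (\<lambda>i a. p a i)" using reprs(2)[OF A] by (simp add: p_def)
  \<comment> \<open>Few enough pairs for regularity: a single coordinate \<open>a2\<close> bounds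
    all terms of all averaging sequences.\<close>
  have "|{G :: 'q set. finite G} \<times> (UNIV :: nat set)| \<le>o |UNIV :: 'q set|"
    by (rule card_of_Times_ordLeq_infinite_Field[OF k(2) card_finite_sets[OF inf_q] nat_ordLeq k(1)])
  then obtain a2 where a2: "a2 \<in> Field r" "\<And>j. j \<in> {G. finite G} \<times> UNIV \<Longrightarrow> dep a2 (R j)"
    using bdep_family[of "{G. finite G} \<times> UNIV" R] Rm maps_bdep by blast
  have a2': "dep a2 (R j)" for j
  proof -
    have "R j = R (if finite (fst j) then fst j else {}, snd j)" by (simp add: R_def split: prod.split)
    then show ?thesis using a2(2)[of "(if finite (fst j) then fst j else {}, snd j)"] by simp
  qed
  obtain a1 where a1: "a1 \<in> Field r" "dep a1 (\<lambda>i a. p a i)" using bp by (auto simp: bdep_def)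
  obtain a where a: "a \<in> Field r" "(a1, a) \<in> r" "(a2, a) \<in> r"
    using r_total[OF a1(1) a2(1)] a1(1) a2(1) r_refl by blast
  have pa: "dep a (\<lambda>i a. p a i)" and Ra: "dep a (R j)" for j
    using dep_mono a1(2) a2' a by blast+
  have r: "Card_order r" "infinite (Field r)" using cardSuc_Card_order[OF k(1)] cardSuc_finite[OF k(1)] k(2) by auto
  \<comment> \<open>An infinite cardinal has no greatest element, so a coordinate is left that
    neither the parameters nor the sequences use.\<close>
  then obtain b where b: "b \<in> Field r" "a \<noteq> b" "(a, b) \<in> r"
    using infinite_Card_order_limit[OF r a(1)] by (elim bexE conjE)
  \<comment> \<open>At the index \<open>i = e w\<close> the value \<open>inv e i b\<close> is
    \<open>w b\<close>, the content of the fresh coordinate.\<close>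
  define x where "x = (\<lambda>i\<in>I. R (inv e i b) i)"
  have xe: "x (e w) = R (w b) (e w)" for w by (simp add: x_def inv_f_f[OF inj_e])
  have Rb: "dep b (R j)" for j by (rule dep_mono[OF Ra b(3)])
  have "dep b x"
    unfolding dep_def depends_def
  proof (intro allI impI)
    fix w w' :: "'q set \<Rightarrow> 'q set \<times> nat" assume w: "\<forall>a. (a, b) \<in> r \<longrightarrow> w a = w' a"
    then have "w b = w' b" using r_refl[OF b(1)] by blast
    moreover have "R (w b) (e w) = R (w b) (e w')" using Rb w unfolding dep_def depends_def by blast
    ultimately show "x (e w) = x (e w')" by (simp add: xe)
  qed
  then have "bdep x" using b(1) by (auto simp: bdep_def)
  moreover have "x \<in> I \<rightarrow>\<^sub>E points M" by (auto simp: x_def inv_f_f[OF inj_e] intro!: maps_in[OF Rm])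
  ultimately have xm: "x \<in> maps" by (simp add: maps_iff)
  have "fval N (\<lambda>a. a) (\<lambda>_. cls x) \<phi> = P \<phi>" if \<phi>: "\<phi> \<in> unary_forms \<tau> A" for \<phi>
  proof -
    have fo: "form_over \<tau> A \<phi>" using \<phi> by (simp add: unary_forms_def)
    \<comment> \<open>\<open>h j\<close> is the integrand once the fresh coordinate has selected the
      term \<open>j\<close>; it depends on the coordinates up to \<open>a\<close> only, so the
      integral over \<open>b\<close> can be taken outermost.\<close>
    define h where "h = (\<lambda>j w. fval M (\<lambda>a. p a (e w)) (\<lambda>_. R j (e w)) \<phi>)"
    have los: "fval N (\<lambda>a. a) (\<lambda>_. cls y) \<phi> = total (\<lambda>w. fval M (\<lambda>a. p a (e w)) (\<lambda>_. y (e w)) \<phi>)"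
      if "y \<in> maps" for y
      by (rule fval_cls[OF p bp fo, where v="\<lambda>_. y"]) (use that in auto)
    have "\<And>j. depends a (h j)"
      unfolding depends_def
    proof (intro allI impI)
      fix j and w w' :: "'q set \<Rightarrow> 'q set \<times> nat" assume w: "\<forall>b. (b, a) \<in> r \<longrightarrow> w b = w' b"
      have "(\<lambda>a. p a (e w)) = (\<lambda>a. p a (e w'))" using pa w unfolding dep_def depends_def by blast
      moreover have "R j (e w) = R j (e w')" using Ra w unfolding dep_def depends_def by blast
      ultimately show "h j w = h j w'" by (simp add: h_def)
    qed
    then have "total (\<lambda>w. h (w b) w) = cesaro (\<lambda>j. total (h j))"
      by (rule total_fubini[OF _ b(3,2)])
    also have "\<dots> = P \<phi>"
    \<comment> \<open>The element required in \<open>G\<close> is the code of \<open>\<phi>\<close>: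
      then \<open>\<phi>\<close> is among the formulas that \<open>C G\<close> averages to their
      prescribed values.\<close>
    proof (rule cesaro_eq)
      fix G assume G: "finite G" "code \<phi> \<in> G"
      have "total (h (G, n)) = fval N (\<lambda>a. a) (\<lambda>_. C G n) \<phi>" for n
        using los[OF Rm, of "(G, n)"] by (simp add: h_def Rc[OF G(1)])
      then show "(\<lambda>n. (\<Sum>k<n. total (h (G, k))) / real n) \<longlonglongrightarrow> P \<phi>"
        using lim[OF G(1), of \<phi>] G(2) \<phi> by (simp add: F_def)
    qed
    finally show ?thesis using los[OF xm] by (simp add: h_def xe)
  qed
  then show ?thesis using xm points_N by blast
qed

lemma type_realized:
  fixes code :: "('f, 'r, 'c, ('i \<Rightarrow> 'm) set) form \<Rightarrow> 'q"
  assumes A: "A \<subseteq> points N" "|A| \<le>o |UNIV :: 'q set|"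
    and code: "inj_on code (unary_forms \<tau> A)" and p: "p \<in> lin_types \<tau> N 1 A"
  shows "realized_in N 1 p"
proof (rule realized_by_averages[OF sig p points_N_nonempty])
  fix \<phi> :: "('f, 'r, 'c, ('i \<Rightarrow> 'm) set) form" assume \<phi>: "\<phi> \<in> unary_forms \<tau> A"
  then have fo: "form_over \<tau> A \<phi>" by (simp add: unary_forms_def)
  note pm = reprs(1)[OF A] and bp = reprs(2)[OF A]
  obtain C where C: "\<forall>\<pi> v. \<pi> ` A \<subseteq> points M \<longrightarrow> range v \<subseteq> points M \<longrightarrow> \<bar>fval M \<pi> v \<phi>\<bar> \<le> C"
    using fval_bounded_uniform[OF sig M fo] by blast
  have "\<bar>fval N (\<lambda>a. a) (\<lambda>_. c) \<phi>\<bar> \<le> C" if c: "c \<in> points N" for c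
  proof -
    have "fval N (\<lambda>a. a) (\<lambda>_. cls (repr c)) \<phi> = total (\<lambda>w. fval M (\<lambda>a. reprs A a (e w)) (\<lambda>_. repr c (e w)) \<phi>)"
      by (rule fval_cls[OF pm bp fo, where v="\<lambda>_. repr c"]) (use repr(1)[OF c] in auto)
    moreover have "\<bar>total (\<lambda>w. fval M (\<lambda>a. reprs A a (e w)) (\<lambda>_. repr c (e w)) \<phi>)\<bar> \<le> C"
      by (rule mean_abs_le[OF mean_total]) (use C pm maps_in repr(1)[OF c] in \<open>simp add: image_subset_iff\<close>)
    ultimately show ?thesis by (simp add: repr(2)[OF c])
  qed
  then show "\<exists>C. \<forall>c\<in>points N. \<bar>fval N (\<lambda>a. a) (\<lambda>_. c) \<phi>\<bar> \<le> C" by blast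
next
  fix P
  assume "\<And>F. finite F \<Longrightarrow> F \<subseteq> unary_forms \<tau> A \<Longrightarrow> \<exists>c::nat \<Rightarrow> _. range c \<subseteq> points N \<and>
        (\<forall>\<phi>\<in>F. (\<lambda>n. (\<Sum>k<n. fval N (\<lambda>a. a) (\<lambda>_. c k) \<phi>) / real n) \<longlonglongrightarrow> P \<phi>)"
  then show "\<exists>X\<in>points N. \<forall>\<phi>\<in>unary_forms \<tau> A. fval N (\<lambda>a. a) (\<lambda>_. X) \<phi> = P \<phi>"
    by (rule averages_realized[OF A code])
qed

end


text \<open>Formulas with parameters in \<open>A\<close> are coded by formulas with only two parameters \<open>m\<^sub>0\<close> and
  \<open>m\<^sub>1\<close>: the member with index \<open>k\<close> of the code marks the occurrences of the parameter number \<open>k\<close>.\<close>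

lemma trm_eq_if_marked_eq:
  assumes m: "m\<^sub>0 \<noteq> m\<^sub>1" and g: "inj_on g A"
    and t: "trm_over \<tau> A t" "trm_over \<tau> A u"
    and eq: "\<And>k. map_trm id id (\<lambda>a. if g a = k then m\<^sub>0 else m\<^sub>1) t = map_trm id id (\<lambda>a. if g a = k then m\<^sub>0 else m\<^sub>1) u"
  shows "t = u"
  using t eq
proof (induction t arbitrary: u)
  case (Var n)
  then show ?case by (cases u) auto
next
  case (Con c)
  then show ?case by (cases u) auto
next
  case (Par a)
  then obtain b where u: "u = Par b" by (cases u) auto
  have "g b = g a" using Par.prems(3)[of "g a"] m by (auto simp: u split: if_splits)
  then show ?case using g Par.prems(1,2) by (auto simp: u inj_on_def)
next
  case (App F ts)
  then obtain us where u: "u = App F us" by (cases u) auto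
  have maps: "map (map_trm id id (\<lambda>a. if g a = k then m\<^sub>0 else m\<^sub>1)) ts
      = map (map_trm id id (\<lambda>a. if g a = k then m\<^sub>0 else m\<^sub>1)) us" for k
    using App.prems(3)[of k] by (simp add: u id_def)
  have len: "length ts = length us" using maps map_eq_imp_length_eq by blast
  have "ts = us"
  proof (rule nth_equalityI[OF len])
    fix i assume i: "i < length ts"
    have "map_trm id id (\<lambda>a. if g a = k then m\<^sub>0 else m\<^sub>1) (ts ! i)
        = map_trm id id (\<lambda>a. if g a = k then m\<^sub>0 else m\<^sub>1) (us ! i)" for k
      using arg_cong[OF maps[of k], of "\<lambda>xs. xs ! i"] i len by simp
    moreover have "trm_over \<tau> A (ts ! i)" "trm_over \<tau> A (us ! i)"
      using App.prems(1,2) i len by (auto simp: u list_all_iff)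
    ultimately show "ts ! i = us ! i" by (intro App.IH[OF nth_mem[OF i]])
  qed
  then show ?case by (simp add: u)
qed

lemma form_eq_if_marked_eq:
  assumes m: "m\<^sub>0 \<noteq> m\<^sub>1" and g: "inj_on g A"
    and f: "form_over \<tau> A \<phi>" "form_over \<tau> A \<psi>"
    and eq: "\<And>k. map_form id id id (\<lambda>a. if g a = k then m\<^sub>0 else m\<^sub>1) \<phi> = map_form id id id (\<lambda>a. if g a = k then m\<^sub>0 else m\<^sub>1) \<psi>"
  shows "\<phi> = \<psi>"
  using f eq
proof (induction \<phi> arbitrary: \<psi>)
  case (Const c)
  then show ?case by (cases \<psi>) auto
next
  case (Rel R ts)
  then obtain us where u: "\<psi> = Rel R us" by (cases \<psi>) auto
  have maps: "map (map_trm id id (\<lambda>a. if g a = k then m\<^sub>0 else m\<^sub>1)) ts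
      = map (map_trm id id (\<lambda>a. if g a = k then m\<^sub>0 else m\<^sub>1)) us" for k
    using Rel.prems(3)[of k] by (simp add: u id_def)
  have len: "length ts = length us" using maps map_eq_imp_length_eq by blast
  have "ts = us"
  proof (rule nth_equalityI[OF len])
    fix i assume i: "i < length ts"
    have "map_trm id id (\<lambda>a. if g a = k then m\<^sub>0 else m\<^sub>1) (ts ! i)
        = map_trm id id (\<lambda>a. if g a = k then m\<^sub>0 else m\<^sub>1) (us ! i)" for k
      using arg_cong[OF maps[of k], of "\<lambda>xs. xs ! i"] i len by simp
    moreover have "trm_over \<tau> A (ts ! i)" "trm_over \<tau> A (us ! i)"
      using Rel.prems(1,2) i len by (auto simp: u list_all_iff)
    ultimately show "ts ! i = us ! i" by (rule trm_eq_if_marked_eq[OF m g, rotated 2])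
  qed
  then show ?case by (simp add: u)
next
  case (Scale c \<phi>)
  then obtain \<theta> where u: "\<psi> = Scale c \<theta>" by (cases \<psi>) auto
  show ?case using Scale.IH[of \<theta>] Scale.prems by (simp add: u)
next
  case (Plus \<phi>1 \<phi>2)
  then obtain \<theta>1 \<theta>2 where u: "\<psi> = Plus \<theta>1 \<theta>2" by (cases \<psi>) auto
  show ?case using Plus.IH(1)[of \<theta>1] Plus.IH(2)[of \<theta>2] Plus.prems by (simp add: u)
next
  case (QSup x \<phi>)
  then obtain \<theta> where u: "\<psi> = QSup x \<theta>" by (cases \<psi>) auto
  show ?case using QSup.IH[of \<theta>] QSup.prems by (simp add: u)
next
  case (QInf x \<phi>)
  then obtain \<theta> where u: "\<psi> = QInf x \<theta>" by (cases \<psi>) auto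
  show ?case using QInf.IH[of \<theta>] QInf.prems by (simp add: u)
qed

text \<open>Pairing each marked formula with its index \<open>k\<close> makes the set the graph of
  the marking family, which can be read back and determines the formula.\<close>

lemma inj_form_code:
  assumes "m\<^sub>0 \<noteq> m\<^sub>1" "inj_on g A"
  shows "inj_on (\<lambda>\<phi>. range (\<lambda>k. (k, map_form id id id (\<lambda>a. if g a = k then m\<^sub>0 else m\<^sub>1) \<phi>)))
    (unary_forms \<tau> A)"
proof (rule inj_onI)
  fix \<phi> \<psi> assume f: "\<phi> \<in> unary_forms \<tau> A" "\<psi> \<in> unary_forms \<tau> A"
    and eq: "range (\<lambda>k. (k, map_form id id id (\<lambda>a. if g a = k then m\<^sub>0 else m\<^sub>1) \<phi>))
      = range (\<lambda>k. (k, map_form id id id (\<lambda>a. if g a = k then m\<^sub>0 else m\<^sub>1) \<psi>))"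
  have "map_form id id id (\<lambda>a. if g a = k then m\<^sub>0 else m\<^sub>1) \<phi>
      = map_form id id id (\<lambda>a. if g a = k then m\<^sub>0 else m\<^sub>1) \<psi>" for k
  proof -
    have "(k, map_form id id id (\<lambda>a. if g a = k then m\<^sub>0 else m\<^sub>1) \<phi>)
        \<in> range (\<lambda>k. (k, map_form id id id (\<lambda>a. if g a = k then m\<^sub>0 else m\<^sub>1) \<psi>))"
      unfolding eq[symmetric] by (rule rangeI)
    then show ?thesis by auto
  qed
  then show "\<phi> = \<psi>"
    using form_eq_if_marked_eq[OF assms, of \<tau> \<phi> \<psi>] f by (simp add: unary_forms_def)
qed

text \<open>A function is coded by the characteristic function of its graph, with
  \<open>m\<^sub>0\<close> and \<open>m\<^sub>1\<close> as truth values; the injection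
  \<open>u\<close> turns the points of the graph into elements of \<open>'q set\<close>.\<close>

lemma inj_function_code:
  assumes "infinite (UNIV :: 'q set)" and m: "m\<^sub>0 \<noteq> (m\<^sub>1 :: 'm)"
  shows "\<exists>e :: ('q set \<Rightarrow> 'q set \<times> nat) \<Rightarrow> 'q set \<Rightarrow> 'm. inj e"
proof -
  have inf: "infinite (UNIV :: 'q set set)" using assms(1) by (simp add: Finite_Set.finite_set)
  have F: "infinite (Field |UNIV :: 'q set set| )" using inf by (simp add: Field_card_of)
  have "|UNIV :: nat set| \<le>o |UNIV :: 'q set set|" using inf infinite_iff_card_of_nat by blast
  then have "|(UNIV :: 'q set set) \<times> (UNIV :: 'q set set) \<times> (UNIV :: nat set)| \<le>o |UNIV :: 'q set set|"
    by (intro card_of_Times_ordLeq_infinite_Field[OF F] card_of_mono1 subset_UNIV card_of_Card_order)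
  then obtain u :: "'q set \<times> 'q set \<times> nat \<Rightarrow> 'q set" where u: "inj u"
    unfolding card_of_ordLeq[symmetric] by auto
  define e where "e = (\<lambda>(w :: 'q set \<Rightarrow> 'q set \<times> nat) S. if \<exists>s. S = u (s, w s) then m\<^sub>0 else m\<^sub>1)"
  have "inj e"
  proof (rule injI)
    fix w w' assume eq: "e w = e w'"
    show "w = w'"
    proof
      fix s
      have "e w (u (s, w s)) = m\<^sub>0" by (auto simp: e_def)
      then have "e w' (u (s, w s)) = m\<^sub>0" by (simp add: eq)
      then have "\<exists>s'. u (s, w s) = u (s', w' s')" using m by (auto simp: e_def split: if_splits)
      then show "w s = w' s" using injD[OF u] by blast
    qed
  qed
  then show ?thesis by blast
qed

section \<open>Assembling the charge space\<close>

lemma saturated_powermean_two_elements: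
  fixes \<tau> :: "('f, 'r, 'c) signature" and M :: "('m, 'f, 'r, 'c) mstruct" and \<kappa> :: "'k rel"
  assumes sig: "signature \<tau>" and \<kappa>: "Card_order \<kappa>" and M: "tau_structure \<tau> M"
    and dense: "has_dense_subset \<tau> M \<kappa>" and m: "m\<^sub>0 \<noteq> (m\<^sub>1 :: 'm)"
  shows "\<exists>(I :: ('f, 'r, 'c, 'm, 'k) index set) \<A> \<mu>.
    charge_space I \<A> \<mu> \<and> meanable \<tau> M \<A> \<and> saturated \<tau> (powermean \<tau> M I \<A> \<mu>) (cardSuc \<kappa>)"
proof -
  let ?Q = "UNIV :: ('k \<times> ('f, 'r, 'c, 'm) form) set set"
  \<comment> \<open>Real constants already supply infinitely many codes, as singletons.\<close>
  have "inj (\<lambda>c. {(undefined :: 'k, Const c :: ('f, 'r, 'c, 'm) form)})" by (rule injI) simp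
  then have infQ: "infinite ?Q" using infinite_UNIV_char_0[where 'a=real] by (meson finite_imageD finite_subset subset_UNIV)
  obtain e :: "(('k \<times> ('f, 'r, 'c, 'm) form) set set \<Rightarrow> ('k \<times> ('f, 'r, 'c, 'm) form) set set \<times> nat)
      \<Rightarrow> ('f, 'r, 'c, 'm, 'k) index" where e: "inj e"
    using inj_function_code[OF infQ m] by blast
  have "inj_on (\<lambda>k. {(k, Const 0 :: ('f, 'r, 'c, 'm) form)}) (Field \<kappa>)" by (rule inj_onI) simp
  then have "|Field \<kappa>| \<le>o |?Q|" unfolding card_of_ordLeq[symmetric] by blast
  then have \<kappa>Q: "\<kappa> \<le>o |?Q|"
    using card_of_Field_ordIso[OF \<kappa>] by (meson ordIso_ordLeq_trans ordIso_symmetric)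
  interpret saturated_tower e \<tau> M \<kappa>
    by unfold_locales (use infQ e sig M dense \<kappa>Q mean_cesaro in \<open>auto simp: Field_card_of card_of_card_order_on\<close>)
  have "meanable \<tau> M \<A>"
  proof -
    \<comment> \<open>The cardinal in \<open>meanable\<close> lives on the type of \<open>M\<close>,
      so that of the dense set itself replaces \<open>\<kappa>\<close>.\<close>
    obtain D where D: "D \<subseteq> points M" "stopology \<tau> M closure_of D = points M" "|D| \<le>o \<kappa>"
      using dense unfolding has_dense_subset_def by blast
    have "has_dense_subset \<tau> M |D|" unfolding has_dense_subset_def using D(1,2) card_of_mono1 by blast
    moreover have "suc_complete \<A> |D|" by (rule suc_complete_le[OF ordLeq_transitive[OF D(3) \<kappa>Q]])
    ultimately show ?thesis unfolding meanable_def using card_of_Card_order by blast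
  qed
  moreover have "saturated \<tau> N (cardSuc \<kappa>)"
    unfolding saturated_def
  proof (intro allI impI ballI, elim conjE)
    fix A p assume A: "A \<subseteq> points N" "|A| <o cardSuc \<kappa>" and p: "p \<in> lin_types \<tau> N 1 A"
    \<comment> \<open>Size below the successor of \<open>\<kappa>\<close> means at most
      \<open>\<kappa>\<close>, so \<open>A\<close> can be numbered by elements of \<open>'k\<close>;
      these numbers index the markings in the formula code.\<close>
    have A\<kappa>: "|A| \<le>o \<kappa>" using A(2) cardSuc_ordLeq_ordLess[OF \<kappa> card_of_Card_order] by blast
    then have "|A| \<le>o |Field \<kappa>|"
      using card_of_Field_ordIso[OF \<kappa>] by (meson ordLeq_ordIso_trans ordIso_symmetric)
    then obtain g :: "_ \<Rightarrow> 'k" where g: "inj_on g A" unfolding card_of_ordLeq[symmetric] by blast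
    show "realized_in N 1 p"
      by (rule type_realized[OF A(1) ordLeq_transitive[OF A\<kappa> \<kappa>Q] inj_form_code[OF m g] p])
  qed
  ultimately show ?thesis using charge_space_charge by blast
qed

text \<open>All sequences of points are constant, so averages can converge only to the values at the
  single point.\<close>

lemma saturated_if_single_point:
  assumes sig: "signature \<tau>" and N: "points N = {X}"
  shows "saturated \<tau> N k"
  unfolding saturated_def
proof (intro allI impI ballI, elim conjE)
  fix A p assume p: "p \<in> lin_types \<tau> N 1 A"
  show "realized_in N 1 p"
  proof (rule realized_by_averages[OF sig p])
    fix P assume c: "\<And>F. finite F \<Longrightarrow> F \<subseteq> unary_forms \<tau> A \<Longrightarrow> \<exists>c::nat \<Rightarrow> _. range c \<subseteq> points N \<and>
        (\<forall>\<phi>\<in>F. (\<lambda>n. (\<Sum>k<n. fval N (\<lambda>a. a) (\<lambda>_. c k) \<phi>) / real n) \<longlonglongrightarrow> P \<phi>)"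
    have "fval N (\<lambda>a. a) (\<lambda>_. X) \<phi> = P \<phi>" if "\<phi> \<in> unary_forms \<tau> A" for \<phi>
    proof -
      obtain c :: "nat \<Rightarrow> _" where "range c \<subseteq> {X}"
        and lim: "(\<lambda>n. (\<Sum>k<n. fval N (\<lambda>a. a) (\<lambda>_. c k) \<phi>) / real n) \<longlonglongrightarrow> P \<phi>"
        using c[of "{\<phi>}"] \<open>\<phi> \<in> unary_forms \<tau> A\<close> N by auto
      then have "c k = X" for k by auto
      then have "(\<lambda>n. (\<Sum>k<n. fval N (\<lambda>a. a) (\<lambda>_. X) \<phi>) / real n) \<longlonglongrightarrow> P \<phi>" using lim by simp
      then have "(\<lambda>n. real n * fval N (\<lambda>a. a) (\<lambda>_. X) \<phi> / real n) \<longlonglongrightarrow> P \<phi>" by simp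
      moreover have "(\<lambda>n. real n * fval N (\<lambda>a. a) (\<lambda>_. X) \<phi> / real n) \<longlonglongrightarrow> fval N (\<lambda>a. a) (\<lambda>_. X) \<phi>"
        by (rule tendsto_eventually, rule eventually_sequentiallyI[of 1]) simp
      ultimately show ?thesis using LIMSEQ_unique by blast
    qed
    then show "\<exists>X\<in>points N. \<forall>\<phi>\<in>unary_forms \<tau> A. fval N (\<lambda>a. a) (\<lambda>_. X) \<phi> = P \<phi>" by (simp add: N)
  qed (auto simp: N)
qed

text \<open>Here the index type has exactly one element and cannot code a large power. The point
  mass on it is a charge, and the powermean is again a single point.\<close>

lemma saturated_powermean_one_element:
  fixes \<tau> :: "('f, 'r, 'c) signature" and M :: "('m, 'f, 'r, 'c) mstruct" and \<kappa> :: "'k rel"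
  assumes sig: "signature \<tau>" and M: "tau_structure \<tau> M"
    and dense: "has_dense_subset \<tau> M \<kappa>" and one: "\<And>x y :: 'm. x = y"
  shows "\<exists>(I :: ('f, 'r, 'c, 'm, 'k) index set) \<A> \<mu>.
    charge_space I \<A> \<mu> \<and> meanable \<tau> M \<A> \<and> saturated \<tau> (powermean \<tau> M I \<A> \<mu>) (cardSuc \<kappa>)"
proof -
  obtain x where x: "x \<in> points M" using M by (auto simp: tau_structure_def)
  let ?I = "UNIV :: ('f, 'r, 'c, 'm, 'k) index set"
  define \<mu> where "\<mu> = (\<lambda>X :: ('f, 'r, 'c, 'm, 'k) index set. if X = {} then 0 else 1 :: real)"
  have oneI: "i = j" for i j :: "('f, 'r, 'c, 'm, 'k) index" using one by (rule ext)
  have "charge_space ?I (Pow ?I) \<mu>"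
    unfolding charge_space_def
  proof (intro conjI)
    show "algebra ?I (Pow ?I)" by (rule algebra_Pow)
    have dichotomy: "X = {} \<or> X = UNIV" for X :: "('f, 'r, 'c, 'm, 'k) index set"
    proof (cases "X = {}")
      case False
      then obtain i where "i \<in> X" by blast
      then have "j \<in> X" for j using oneI[of j i] by simp
      then show ?thesis by blast
    qed simp
    show "additive (Pow ?I) \<mu>"
      unfolding additive_def
    proof (intro ballI impI)
      fix X Y :: "('f, 'r, 'c, 'm, 'k) index set" assume "X \<inter> Y = {}"
      then have "X = {} \<or> Y = {}" using dichotomy[of X] dichotomy[of Y] by (elim disjE) simp_all
      then show "\<mu> (X \<union> Y) = \<mu> X + \<mu> Y" by (elim disjE) (simp_all add: \<mu>_def)
    qed
  qed (auto simp: \<mu>_def)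
  moreover have "meanable \<tau> M (Pow ?I)"
  proof -
    obtain D where D: "D \<subseteq> points M" "stopology \<tau> M closure_of D = points M"
      using dense unfolding has_dense_subset_def by blast
    have "has_dense_subset \<tau> M |D|" unfolding has_dense_subset_def using D card_of_mono1 by blast
    then show ?thesis unfolding meanable_def suc_complete_def using card_of_Card_order by blast
  qed
  moreover have "saturated \<tau> (powermean \<tau> M ?I (Pow ?I) \<mu>) (cardSuc \<kappa>)"
  proof (rule saturated_if_single_point[OF sig])
    have "(\<lambda>_. x) \<in> meas_maps \<tau> M ?I (Pow ?I)" using x by (simp add: meas_maps_def PiE_def Pi_def)
    moreover have "a = (\<lambda>_. x)" for a :: "('f, 'r, 'c, 'm, 'k) index \<Rightarrow> 'm" using one by (rule ext)
    ultimately have "meas_maps \<tau> M ?I (Pow ?I) = {\<lambda>_. x}" by blast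
    then show "points (powermean \<tau> M ?I (Pow ?I) \<mu>) = {mean_eq \<tau> M ?I (Pow ?I) \<mu> `` {\<lambda>_. x}}"
      by (simp add: powermean_def quotient_def)
  qed
  ultimately show ?thesis by (intro exI conjI)
qed

theorem theorem4p4:
  fixes \<tau> :: "('f, 'r, 'c) signature" and M :: "('m, 'f, 'r, 'c) mstruct" and \<kappa> :: "'k rel"
  assumes "signature \<tau>"
    and "Card_order \<kappa>" and "infinite (Field \<kappa>)"
    and "tau_structure \<tau> M" and "complete_structure \<tau> M"
    and "has_dense_subset \<tau> M \<kappa>"
  shows "\<exists>(I :: ('f, 'r, 'c, 'm, 'k) index set) \<A> \<mu>.
    charge_space I \<A> \<mu> \<and> meanable \<tau> M \<A> \<and> saturated \<tau> (powermean \<tau> M I \<A> \<mu>) (cardSuc \<kappa>)"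
\<comment> \<open>The split concerns the type \<open>'m\<close>: the two values serve only as marks
  in codes and may lie outside the universe of \<open>M\<close>.\<close>
proof (cases "\<exists>m\<^sub>0 m\<^sub>1 :: 'm. m\<^sub>0 \<noteq> m\<^sub>1")
  case True
  then obtain m\<^sub>0 m\<^sub>1 :: 'm where "m\<^sub>0 \<noteq> m\<^sub>1" by blast
  with assms show ?thesis by (intro saturated_powermean_two_elements) auto
next
  case False
  then have "x = y" for x y :: 'm by blast
  with assms show ?thesis by (intro saturated_powermean_one_element) auto
qed

end
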